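(* Let $G$ be a Lie group with Lie algebra $\mathfrak{g}$, $[X_1\rightrightarrows X_0]$ a Lie groupoid equipped with an integrable connection $\mathcal{H}\subseteq TX_1$, $(E_G\to X_0,[X_1\rightrightarrows X_0])$ a principal $G$-bundle over it, and $\mathcal{D}\colon(TE_G)/G\to(E_G\times\mathfrak{g})/G$ a connection on $(E_G\to X_0,[X_1\rightrightarrows X_0])$. Let $\omega\colon E_G\to\Lambda^1_{\mathfrak{g}}T^*E_G$ be the $\mathfrak{g}$-valued differential $1$-form on $E_G$ associated to $\mathcal{D}$. Then $\omega$ is a differential $1$-form on the Lie groupoid $[s^*E_G\rightrightarrows E_G]$ (with respect to the pull-back connection $\widetilde{\mathcal{H}}\subseteq T(s^*E_G)$ on $[s^*E_G\rightrightarrows E_G]$).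
   Context: Connections on Lie groupoids. A Lie groupoid $[X_1\rightrightarrows X_0]$ has smooth structure maps and submersive source and target $s,t$; $e(a)=1_a$ is the unit map. A connection on it is a sub-bundle $\mathcal{H}\subseteq TX_1$ with $T_\gamma X_1=\mathcal{H}_\gamma X_1\oplus\ker(s_{*,\gamma})$ for all $\gamma$ such that, with $\theta_\gamma=t_{*,\gamma}\circ(s_{*,\gamma}|_{\mathcal{H}_\gamma X_1})^{-1}\colon T_{s(\gamma)}X_0\to T_{t(\gamma)}X_0$, (1) $\theta_{\gamma\circ\gamma'}=\theta_\gamma\circ\theta_{\gamma'}$ for composable $\gamma,\gamma'$, and (2) $e_{*,a}(T_aX_0)=\mathcal{H}_{1_a}$. It is integrable if brackets of vector fields in $\mathcal{H}$ lie in $\mathcal{H}$. $\mathcal{H}_\gamma(v)$ is the component of $v\in T_\gamma X_1$ in $\mathcal{H}_\gamma X_1$. For a (possibly vector-valued) $k$-form $\eta$ on $X_1$, $\mathcal{H}(\eta)(\gamma)(v_1,\dots,v_k)=\eta(\gamma)(\mathcal{H}_\gamma(v_1),\dots,\mathcal{H}_\gamma(v_k))$. A differential $k$-form on the Lie groupoid with respect to $\mathcal{H}$ is a $k$-form $\omega$ on $X_0$ with $\mathcal{H}(s^*\omega)=\mathcal{H}(t^*\omega)$. Principal bundles. A principal $G$-bundle $(E_G\to X_0,[X_1\rightrightarrows X_0])$ is a (right) principal $G$-bundle $\pi\colon E_G\to X_0$ together with a smooth left action $\mu\colon X_1\times_{s,X_0,\pi}E_G\to E_G$, $(\gamma,a)\mapsto\gamma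 a$, of $[X_1\rightrightarrows X_0]$ ($\pi(\gamma a)=t(\gamma)$, $1_{\pi(a)}a=a$, $\gamma(\gamma'a)=(\gamma\circ\gamma')a$) with $(\gamma a)g=\gamma(ag)$. Put $s^*E_G=X_1\times_{s,X_0,\pi}E_G$; $[s^*E_G\rightrightarrows E_G]$ is a Lie groupoid with source $(\gamma,a)\mapsto a$, target $(\gamma,a)\mapsto\gamma a$ and composition induced from $X_1$. The pull-back connection is $\widetilde{\mathcal{H}}_{(\gamma,a)}=(\mathrm{pr}_1)_{*,(\gamma,a)}^{-1}(\mathcal{H}_\gamma X_1)$; its horizontal projection is $(v,w)\mapsto(\mathcal{H}_\gamma(v),w)$. Let $\widetilde\theta_{(\gamma,a)}\colon T_aE_G\to T_{\gamma a}E_G$, $\widetilde\theta_{(\gamma,a)}(w)=\mu_{*,(\gamma,a)}(\mathcal{H}_\gamma(v),w)$ for any $v\in T_\gamma X_1$ with $s_{*,\gamma}(v)=\pi_{*,a}(w)$. Connections on principal bundles. $G$ acts on $TE_G$ by differentials of right translations and on $E_G\times\mathfrak{g}$ by $(a,A)g=(ag,\mathrm{ad}(g^{-1})A)$ (adjoint representation). The Atiyah sequence is $0\to(E_G\times\mathfrak{g})/G\xrightarrow{j^{/G}}(TE_G)/G\xrightarrow{\pi_*^{/G}}TX_0\to0$, where $j^{/G}[(a,A)]=[A^*(a)]$, $A^*$ being the fundamental vector field of $A$. The groupoid $[X_1\rightrightarrows X_0]$ acts fibrewise-linearly on these three vector bundles by $\gamma\cdot[(a,A)]=[(\gamma a,A)]$,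 $\gamma\cdot[w]=[\widetilde\theta_{(\gamma,a)}(w)]$ for $w\in T_aE_G$, and $\gamma\cdot v=\theta_\gamma(v)$, making this an exact sequence of vector bundles over $[X_1\rightrightarrows X_0]$. A connection on $(E_G\to X_0,[X_1\rightrightarrows X_0])$ is a splitting of it as vector bundles over $[X_1\rightrightarrows X_0]$, i.e. a vector bundle morphism $\mathcal{D}\colon(TE_G)/G\to(E_G\times\mathfrak{g})/G$ over $X_0$, equivariant for the $[X_1\rightrightarrows X_0]$-actions, with $\mathcal{D}\circ j^{/G}=\mathrm{id}$. The associated $1$-form $\omega$ is determined by $\mathcal{D}([v])=[(a,\omega(a)(v))]$ for $v\in T_aE_G$. *)

theory Defs
  imports "HOL-Analysis.Analysis" "HOL-Library.Function_Algebras" "HOL-Algebra.Group"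
begin

instantiation "fun" :: (type, real_vector) real_vector
begin

definition scaleR_fun :: "real \<Rightarrow> ('a \<Rightarrow> 'b) \<Rightarrow> 'a \<Rightarrow> 'b"
  where "scaleR_fun c f = (\<lambda>x. c *\<^sub>R f x)"

instance
  by standard (auto simp: scaleR_fun_def plus_fun_def scaleR_add_right scaleR_add_left)

end


section \<open>Smooth manifolds\<close>

primrec Ck :: "nat \<Rightarrow> 'a::euclidean_space set \<Rightarrow> ('a \<Rightarrow> 'b::euclidean_space) \<Rightarrow> bool" where
  "Ck 0 U f = continuous_on U f"
| "Ck (Suc k) U f =
     (\<exists>f'. (\<forall>x\<in>U. (f has_derivative f' x) (at x)) \<and> (\<forall>v. Ck k U (\<lambda>x. f' x v)))"

text \<open>On an arbitrary subset of a Euclidean space, smooth means that the function extends, near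
  each point, to a smooth function on an open set.\<close>

definition smooth_on :: "'a::euclidean_space set \<Rightarrow> ('a \<Rightarrow> 'b::euclidean_space) \<Rightarrow> bool" where
  "smooth_on S f \<longleftrightarrow>
     (\<forall>x\<in>S. \<exists>U g. open U \<and> x \<in> U \<and> (\<forall>k. Ck k U g) \<and> (\<forall>y\<in>S \<inter> U. g y = f y))"

text \<open>A manifold is given by an atlas on a set. A chart \<open>(U, \<phi>)\<close> maps \<open>U\<close> injectively onto a
  relatively open subset of some linear subspace of the model space; only the values of \<open>\<phi>\<close> on
  \<open>U\<close> matter. Subspaces are used because the type of a Euclidean space fixes a positive
  dimension: they give access to dimension 0 and to the dimensions of fibre products and
  quotients. The topology is the one determined by the charts.\<close>

type_synonym ('a, 'e) atlas = "('a set \<times> ('a \<Rightarrow> 'e)) set"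

definition points :: "('a, 'e) atlas \<Rightarrow> 'a set" where
  "points M = (\<Union>(U, \<phi>)\<in>M. U)"

definition mopen :: "('a, 'e::euclidean_space) atlas \<Rightarrow> 'a set \<Rightarrow> bool" where
  "mopen M W \<longleftrightarrow> W \<subseteq> points M \<and>
     (\<forall>(U, \<phi>)\<in>M. openin (top_of_set (\<phi> ` U)) (\<phi> ` (U \<inter> W)))"

definition mtopology :: "('a, 'e::euclidean_space) atlas \<Rightarrow> 'a topology" where
  "mtopology M = topology (mopen M)"

definition manifold :: "('a, 'e::euclidean_space) atlas \<Rightarrow> bool" where
  "manifold M \<longleftrightarrow>
     (\<exists>n. \<forall>(U, \<phi>)\<in>M. inj_on \<phi> U \<and>
        (\<exists>L. subspace L \<and> dim L = n \<and> openin (top_of_set L) (\<phi> ` U))) \<and>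
     (\<forall>(U, \<phi>)\<in>M. \<forall>(V, \<psi>)\<in>M. openin (top_of_set (\<phi> ` U)) (\<phi> ` (U \<inter> V)) \<and>
        smooth_on (\<phi> ` (U \<inter> V)) (\<lambda>y. \<psi> (inv_into U \<phi> y))) \<and>
     Hausdorff_space (mtopology M) \<and> second_countable (mtopology M)"

text \<open>\<open>smooth_at M N f p\<close>: \<open>f\<close> is smooth on some open neighbourhood of \<open>p\<close>.\<close>

definition smooth_at ::
  "('a, 'e::euclidean_space) atlas \<Rightarrow> ('b, 'f::euclidean_space) atlas \<Rightarrow> ('a \<Rightarrow> 'b) \<Rightarrow> 'a \<Rightarrow> bool"
  where
  "smooth_at M N f p \<longleftrightarrow>
     (\<exists>(U, \<phi>)\<in>M. \<exists>(V, \<psi>)\<in>N. \<exists>W. mopen M W \<and> p \<in> W \<and> W \<subseteq> U \<and> f ` W \<subseteq> V \<and>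
        smooth_on (\<phi> ` W) (\<lambda>y. \<psi> (f (inv_into U \<phi> y))))"

definition smooth_map ::
  "('a, 'e::euclidean_space) atlas \<Rightarrow> ('b, 'f::euclidean_space) atlas \<Rightarrow> ('a \<Rightarrow> 'b) \<Rightarrow> bool" where
  "smooth_map M N f \<longleftrightarrow> (\<forall>p\<in>points M. smooth_at M N f p)"

text \<open>A relatively open subset of a linear subspace, with its standard structure.\<close>

definition flat_atlas :: "'e set \<Rightarrow> ('e, 'e) atlas" where
  "flat_atlas W = {(W, id)}"

definition open_sub :: "('a, 'e) atlas \<Rightarrow> 'a set \<Rightarrow> ('a, 'e) atlas" where
  "open_sub M W = (\<lambda>(U, \<phi>). (U \<inter> W, \<phi>)) ` M"

definition prod_atlas :: "('a, 'e) atlas \<Rightarrow> ('b, 'f) atlas \<Rightarrow> ('a \<times> 'b, 'e \<times> 'f) atlas" where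
  "prod_atlas M N = {(U \<times> V, map_prod \<phi> \<psi>) | U \<phi> V \<psi>. (U, \<phi>) \<in> M \<and> (V, \<psi>) \<in> N}"

text \<open>The smooth structure of an embedded submanifold \<open>S\<close> of \<open>M\<close>, as its maximal atlas: the
  charts are the injective maps from relatively open subsets of \<open>S\<close> onto relatively open
  subsets of linear subspaces that locally extend to smooth maps on \<open>M\<close> and whose inverses are
  smooth as maps to \<open>M\<close>.\<close>

definition sub_atlas :: "('a, 'e::euclidean_space) atlas \<Rightarrow> 'a set \<Rightarrow> ('a, 'e) atlas" where
  "sub_atlas M S =
     {(V, \<phi>). (\<exists>W. mopen M W \<and> V = S \<inter> W) \<and> inj_on \<phi> V \<and>
        (\<exists>L. subspace L \<and> openin (top_of_set L) (\<phi> ` V)) \<and>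
        (\<forall>p\<in>V. \<exists>W \<Phi>. mopen M W \<and> p \<in> W \<and> smooth_map (open_sub M W) (flat_atlas UNIV) \<Phi> \<and>
           (\<forall>x\<in>V \<inter> W. \<Phi> x = \<phi> x)) \<and>
        smooth_map (flat_atlas (\<phi> ` V)) M (inv_into V \<phi>)}"

text \<open>The smooth structure on the set \<open>Q\<close> of classes of a partition of \<open>M\<close> for which the
  projection \<open>M \<rightarrow> Q\<close> is a submersion, as its maximal atlas: a chart, composed with the
  projection, is smooth and has a smooth local section through every point.\<close>

definition block_of :: "'a set set \<Rightarrow> 'a \<Rightarrow> 'a set" where
  "block_of Q x = (THE c. c \<in> Q \<and> x \<in> c)"

definition quotient_atlas ::
  "('a, 'e::euclidean_space) atlas \<Rightarrow> 'a set set \<Rightarrow> ('a set, 'e) atlas" where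
  "quotient_atlas M Q =
     {(V, \<phi>). V \<subseteq> Q \<and> mopen M (\<Union>V) \<and> inj_on \<phi> V \<and>
        (\<exists>L. subspace L \<and> openin (top_of_set L) (\<phi> ` V) \<and>
           smooth_map (open_sub M (\<Union>V)) (flat_atlas UNIV) (\<lambda>x. \<phi> (block_of Q x)) \<and>
           (\<forall>x\<in>\<Union>V. \<exists>W \<sigma>. openin (top_of_set L) W \<and> W \<subseteq> \<phi> ` V \<and> \<phi> (block_of Q x) \<in> W \<and>
              smooth_map (flat_atlas W) M \<sigma> \<and> \<sigma> (\<phi> (block_of Q x)) = x \<and>
              (\<forall>y\<in>W. \<sigma> y \<in> \<Union>V \<and> \<phi> (block_of Q (\<sigma> y)) = y)))}"


section \<open>Tangent vectors\<close>

text \<open>Tangent vectors at \<open>p\<close> are the derivations of the algebra of real functions that are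
  smooth near \<open>p\<close>. They are set to 0 on all other functions, so that they are determined by
  their values on functions smooth near \<open>p\<close>. By the Leibniz rule they depend only on germs.\<close>

definition smooth_near :: "('a, 'e::euclidean_space) atlas \<Rightarrow> 'a \<Rightarrow> ('a \<Rightarrow> real) set" where
  "smooth_near M p = {f. smooth_at M (flat_atlas (UNIV :: real set)) f p}"

type_synonym 'a tvec = "('a \<Rightarrow> real) \<Rightarrow> real"

definition tangent :: "('a, 'e::euclidean_space) atlas \<Rightarrow> 'a \<Rightarrow> 'a tvec set" where
  "tangent M p =
     {X. (\<forall>f\<in>smooth_near M p. \<forall>g\<in>smooth_near M p.
            X (\<lambda>x. f x + g x) = X f + X g \<and>
            X (\<lambda>x. f x * g x) = f p * X g + g p * X f) \<and>
         (\<forall>f\<in>smooth_near M p. \<forall>c. X (\<lambda>x. c * f x) = c * X f) \<and>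
         (\<forall>f. f \<notin> smooth_near M p \<longrightarrow> X f = 0)}"

text \<open>The differential at \<open>p\<close> of \<open>f\<close>, a map smooth near \<open>p\<close> with values in \<open>N\<close>.\<close>

definition tangent_map ::
  "('b, 'f::euclidean_space) atlas \<Rightarrow> ('a \<Rightarrow> 'b) \<Rightarrow> 'a \<Rightarrow> 'a tvec \<Rightarrow> 'b tvec" where
  "tangent_map N f p X = (\<lambda>g. if g \<in> smooth_near N (f p) then X (\<lambda>x. g (f x)) else 0)"

definition chart_vec :: "('a \<Rightarrow> 'e::euclidean_space) \<Rightarrow> 'a tvec \<Rightarrow> 'e" where
  "chart_vec \<phi> X = (\<Sum>b\<in>Basis. X (\<lambda>x. \<phi> x \<bullet> b) *\<^sub>R b)"

definition tangent_atlas ::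
  "('a, 'e::euclidean_space) atlas \<Rightarrow> ('a \<times> 'a tvec, 'e \<times> 'e) atlas" where
  "tangent_atlas M =
     {({(p, X). p \<in> U \<and> X \<in> tangent M p}, \<lambda>(p, X). (\<phi> p, chart_vec \<phi> X)) | U \<phi>. (U, \<phi>) \<in> M}"

text \<open>The vector space \<open>tangent M p\<close> as a manifold.\<close>

definition tangent_space_atlas ::
  "('a, 'e::euclidean_space) atlas \<Rightarrow> 'a \<Rightarrow> ('a tvec, 'e) atlas" where
  "tangent_space_atlas M p = {(tangent M p, chart_vec \<phi>) | U \<phi>. (U, \<phi>) \<in> M \<and> p \<in> U}"

definition submersion ::
  "('a, 'e::euclidean_space) atlas \<Rightarrow> ('b, 'f::euclidean_space) atlas \<Rightarrow> ('a \<Rightarrow> 'b) \<Rightarrow> bool" where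
  "submersion M N f \<longleftrightarrow> smooth_map M N f \<and>
     (\<forall>p\<in>points M. tangent_map N f p ` tangent M p = tangent N (f p))"

definition vector_field_on ::
  "('a, 'e::euclidean_space) atlas \<Rightarrow> 'a set \<Rightarrow> ('a \<Rightarrow> 'a tvec) \<Rightarrow> bool" where
  "vector_field_on M W Y \<longleftrightarrow> (\<forall>p\<in>W. Y p \<in> tangent M p) \<and>
     smooth_map (open_sub M W) (tangent_atlas M) (\<lambda>p. (p, Y p))"

definition lie_bracket ::
  "('a, 'e::euclidean_space) atlas \<Rightarrow> ('a \<Rightarrow> 'a tvec) \<Rightarrow> ('a \<Rightarrow> 'a tvec) \<Rightarrow> 'a \<Rightarrow> 'a tvec" where
  "lie_bracket M Y Z p =
     (\<lambda>f. if f \<in> smooth_near M p then Y p (\<lambda>q. Z q f) - Z p (\<lambda>q. Y q f) else 0)"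

text \<open>Smooth subbundles of the tangent bundle: linear subspaces with local smooth frames.\<close>

definition subbundle :: "('a, 'e::euclidean_space) atlas \<Rightarrow> ('a \<Rightarrow> 'a tvec set) \<Rightarrow> bool" where
  "subbundle M H \<longleftrightarrow>
     (\<forall>p\<in>points M. subspace (H p) \<and> H p \<subseteq> tangent M p) \<and>
     (\<forall>p\<in>points M. \<exists>W k. \<exists>Y :: nat \<Rightarrow> 'a \<Rightarrow> 'a tvec. mopen M W \<and> p \<in> W \<and>
        (\<forall>i<k. vector_field_on M W (Y i)) \<and>
        (\<forall>q\<in>W. inj_on (\<lambda>i. Y i q) {..<k} \<and> independent ((\<lambda>i. Y i q) ` {..<k}) \<and>
           span ((\<lambda>i. Y i q) ` {..<k}) = H q))"

text \<open>Differential 1-forms with values in a vector space whose manifold structure is \<open>V\<close>.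
  A fibrewise linear form is smooth iff it is smooth as a map on the tangent bundle.\<close>

definition one_form ::
  "('a, 'e::euclidean_space) atlas \<Rightarrow> ('v::real_vector, 'f::euclidean_space) atlas \<Rightarrow>
   ('a \<Rightarrow> 'a tvec \<Rightarrow> 'v) \<Rightarrow> bool" where
  "one_form M V \<omega> \<longleftrightarrow>
     (\<forall>p\<in>points M. \<forall>X\<in>tangent M p. \<omega> p X \<in> points V \<and>
        (\<forall>Y\<in>tangent M p. \<omega> p (X + Y) = \<omega> p X + \<omega> p Y) \<and>
        (\<forall>c. \<omega> p (c *\<^sub>R X) = c *\<^sub>R \<omega> p X)) \<and>
     smooth_map (tangent_atlas M) V (\<lambda>(p, X). \<omega> p X)"

definition pullback_form ::
  "('b, 'f::euclidean_space) atlas \<Rightarrow> ('a \<Rightarrow> 'b) \<Rightarrow> ('b \<Rightarrow> 'b tvec \<Rightarrow> 'v) \<Rightarrow> 'a \<Rightarrow> 'a tvec \<Rightarrow> 'v" where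
  "pullback_form N f \<omega> p X = \<omega> (f p) (tangent_map N f p X)"


section \<open>Lie groups\<close>

record ('g, 'eg) smooth_group = "'g monoid" +
  group_atlas :: "('g, 'eg) atlas"

definition lie_group :: "('g, 'eg::euclidean_space) smooth_group \<Rightarrow> bool" where
  "lie_group G \<longleftrightarrow> group G \<and> manifold (group_atlas G) \<and> points (group_atlas G) = carrier G \<and>
     smooth_map (prod_atlas (group_atlas G) (group_atlas G)) (group_atlas G)
       (\<lambda>(x, y). x \<otimes>\<^bsub>G\<^esub> y) \<and>
     smooth_map (group_atlas G) (group_atlas G) (\<lambda>x. inv\<^bsub>G\<^esub> x)"

definition lie_algebra :: "('g, 'eg::euclidean_space) smooth_group \<Rightarrow> 'g tvec set" where
  "lie_algebra G = tangent (group_atlas G) \<one>\<^bsub>G\<^esub>"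

definition lie_algebra_atlas ::
  "('g, 'eg::euclidean_space) smooth_group \<Rightarrow> ('g tvec, 'eg) atlas" where
  "lie_algebra_atlas G = tangent_space_atlas (group_atlas G) \<one>\<^bsub>G\<^esub>"

definition Ad :: "('g, 'eg::euclidean_space) smooth_group \<Rightarrow> 'g \<Rightarrow> 'g tvec \<Rightarrow> 'g tvec" where
  "Ad G g = tangent_map (group_atlas G) (\<lambda>x. g \<otimes>\<^bsub>G\<^esub> x \<otimes>\<^bsub>G\<^esub> inv\<^bsub>G\<^esub> g) \<one>\<^bsub>G\<^esub>"


section \<open>Lie groupoids and connections on them\<close>

text \<open>\<open>gcomp \<Gamma> \<gamma> \<gamma>'\<close> is the composite of \<open>\<gamma>\<close> after \<open>\<gamma>'\<close>.\<close>

record ('x1, 'x0, 'e1, 'e0) smooth_groupoid =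
  arrows :: "('x1, 'e1) atlas"
  objects :: "('x0, 'e0) atlas"
  source :: "'x1 \<Rightarrow> 'x0"
  target :: "'x1 \<Rightarrow> 'x0"
  gunit :: "'x0 \<Rightarrow> 'x1"
  gcomp :: "'x1 \<Rightarrow> 'x1 \<Rightarrow> 'x1"
  ginv :: "'x1 \<Rightarrow> 'x1"

definition composable :: "('x1, 'x0, 'e1, 'e0) smooth_groupoid \<Rightarrow> ('x1 \<times> 'x1) set" where
  "composable \<Gamma> = {(\<gamma>, \<gamma>'). \<gamma> \<in> points (arrows \<Gamma>) \<and> \<gamma>' \<in> points (arrows \<Gamma>) \<and>
                           source \<Gamma> \<gamma> = target \<Gamma> \<gamma>'}"

definition lie_groupoid ::
  "('x1, 'x0, 'e1::euclidean_space, 'e0::euclidean_space) smooth_groupoid \<Rightarrow> bool" where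
  "lie_groupoid \<Gamma> \<longleftrightarrow>
     manifold (arrows \<Gamma>) \<and> manifold (objects \<Gamma>) \<and>
     submersion (arrows \<Gamma>) (objects \<Gamma>) (source \<Gamma>) \<and>
     submersion (arrows \<Gamma>) (objects \<Gamma>) (target \<Gamma>) \<and>
     smooth_map (objects \<Gamma>) (arrows \<Gamma>) (gunit \<Gamma>) \<and>
     smooth_map (sub_atlas (prod_atlas (arrows \<Gamma>) (arrows \<Gamma>)) (composable \<Gamma>)) (arrows \<Gamma>)
       (\<lambda>(\<gamma>, \<gamma>'). gcomp \<Gamma> \<gamma> \<gamma>') \<and>
     smooth_map (arrows \<Gamma>) (arrows \<Gamma>) (ginv \<Gamma>) \<and>
     (\<forall>x\<in>points (objects \<Gamma>). source \<Gamma> (gunit \<Gamma> x) = x \<and> target \<Gamma> (gunit \<Gamma> x) = x) \<and>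
     (\<forall>(\<gamma>, \<gamma>')\<in>composable \<Gamma>. gcomp \<Gamma> \<gamma> \<gamma>' \<in> points (arrows \<Gamma>) \<and>
        source \<Gamma> (gcomp \<Gamma> \<gamma> \<gamma>') = source \<Gamma> \<gamma>' \<and> target \<Gamma> (gcomp \<Gamma> \<gamma> \<gamma>') = target \<Gamma> \<gamma>) \<and>
     (\<forall>\<gamma> \<gamma>' \<gamma>''. (\<gamma>, \<gamma>') \<in> composable \<Gamma> \<and> (\<gamma>', \<gamma>'') \<in> composable \<Gamma> \<longrightarrow>
        gcomp \<Gamma> (gcomp \<Gamma> \<gamma> \<gamma>') \<gamma>'' = gcomp \<Gamma> \<gamma> (gcomp \<Gamma> \<gamma>' \<gamma>'')) \<and>
     (\<forall>\<gamma>\<in>points (arrows \<Gamma>).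
        gcomp \<Gamma> (gunit \<Gamma> (target \<Gamma> \<gamma>)) \<gamma> = \<gamma> \<and> gcomp \<Gamma> \<gamma> (gunit \<Gamma> (source \<Gamma> \<gamma>)) = \<gamma> \<and>
        source \<Gamma> (ginv \<Gamma> \<gamma>) = target \<Gamma> \<gamma> \<and> target \<Gamma> (ginv \<Gamma> \<gamma>) = source \<Gamma> \<gamma> \<and>
        gcomp \<Gamma> (ginv \<Gamma> \<gamma>) \<gamma> = gunit \<Gamma> (source \<Gamma> \<gamma>) \<and>
        gcomp \<Gamma> \<gamma> (ginv \<Gamma> \<gamma>) = gunit \<Gamma> (target \<Gamma> \<gamma>))"

definition vertical ::
  "('x1, 'x0, 'e1::euclidean_space, 'e0::euclidean_space) smooth_groupoid \<Rightarrow>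
   'x1 \<Rightarrow> 'x1 tvec set" where
  "vertical \<Gamma> \<gamma> = {v \<in> tangent (arrows \<Gamma>) \<gamma>. tangent_map (objects \<Gamma>) (source \<Gamma>) \<gamma> v = 0}"

text \<open>The component of \<open>v\<close> in \<open>H \<gamma>\<close>.\<close>

definition hor_proj ::
  "('x1, 'x0, 'e1::euclidean_space, 'e0::euclidean_space) smooth_groupoid \<Rightarrow>
   ('x1 \<Rightarrow> 'x1 tvec set) \<Rightarrow> 'x1 \<Rightarrow> 'x1 tvec \<Rightarrow> 'x1 tvec" where
  "hor_proj \<Gamma> H \<gamma> v = (THE h. h \<in> H \<gamma> \<and> v - h \<in> vertical \<Gamma> \<gamma>)"

definition transport ::
  "('x1, 'x0, 'e1::euclidean_space, 'e0::euclidean_space) smooth_groupoid \<Rightarrow>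
   ('x1 \<Rightarrow> 'x1 tvec set) \<Rightarrow> 'x1 \<Rightarrow> 'x0 tvec \<Rightarrow> 'x0 tvec" where
  "transport \<Gamma> H \<gamma> v =
     tangent_map (objects \<Gamma>) (target \<Gamma>) \<gamma>
       (the_inv_into (H \<gamma>) (tangent_map (objects \<Gamma>) (source \<Gamma>) \<gamma>) v)"

definition groupoid_connection ::
  "('x1, 'x0, 'e1::euclidean_space, 'e0::euclidean_space) smooth_groupoid \<Rightarrow>
   ('x1 \<Rightarrow> 'x1 tvec set) \<Rightarrow> bool" where
  "groupoid_connection \<Gamma> H \<longleftrightarrow>
     subbundle (arrows \<Gamma>) H \<and>
     (\<forall>\<gamma>\<in>points (arrows \<Gamma>). H \<gamma> \<inter> vertical \<Gamma> \<gamma> = {0} \<and>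
        tangent (arrows \<Gamma>) \<gamma> = {h + k | h k. h \<in> H \<gamma> \<and> k \<in> vertical \<Gamma> \<gamma>}) \<and>
     (\<forall>(\<gamma>, \<gamma>')\<in>composable \<Gamma>. \<forall>v\<in>tangent (objects \<Gamma>) (source \<Gamma> \<gamma>').
        transport \<Gamma> H (gcomp \<Gamma> \<gamma> \<gamma>') v = transport \<Gamma> H \<gamma> (transport \<Gamma> H \<gamma>' v)) \<and>
     (\<forall>x\<in>points (objects \<Gamma>).
        tangent_map (arrows \<Gamma>) (gunit \<Gamma>) x ` tangent (objects \<Gamma>) x = H (gunit \<Gamma> x))"

definition integrable_connection ::
  "('x1, 'x0, 'e1::euclidean_space, 'e0::euclidean_space) smooth_groupoid \<Rightarrow>
   ('x1 \<Rightarrow> 'x1 tvec set) \<Rightarrow> bool" where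
  "integrable_connection \<Gamma> H \<longleftrightarrow>
     (\<forall>Y Z. vector_field_on (arrows \<Gamma>) (points (arrows \<Gamma>)) Y \<and>
            vector_field_on (arrows \<Gamma>) (points (arrows \<Gamma>)) Z \<and>
            (\<forall>\<gamma>\<in>points (arrows \<Gamma>). Y \<gamma> \<in> H \<gamma> \<and> Z \<gamma> \<in> H \<gamma>) \<longrightarrow>
            (\<forall>\<gamma>\<in>points (arrows \<Gamma>). lie_bracket (arrows \<Gamma>) Y Z \<gamma> \<in> H \<gamma>))"

definition hor_form ::
  "('x1, 'x0, 'e1::euclidean_space, 'e0::euclidean_space) smooth_groupoid \<Rightarrow>
   ('x1 \<Rightarrow> 'x1 tvec set) \<Rightarrow> ('x1 \<Rightarrow> 'x1 tvec \<Rightarrow> 'v) \<Rightarrow> 'x1 \<Rightarrow> 'x1 tvec \<Rightarrow> 'v" where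
  "hor_form \<Gamma> H \<eta> \<gamma> v = \<eta> \<gamma> (hor_proj \<Gamma> H \<gamma> v)"

definition groupoid_one_form ::
  "('x1, 'x0, 'e1::euclidean_space, 'e0::euclidean_space) smooth_groupoid \<Rightarrow>
   ('x1 \<Rightarrow> 'x1 tvec set) \<Rightarrow> ('v::real_vector, 'f::euclidean_space) atlas \<Rightarrow>
   ('x0 \<Rightarrow> 'x0 tvec \<Rightarrow> 'v) \<Rightarrow> bool" where
  "groupoid_one_form \<Gamma> H V \<omega> \<longleftrightarrow> one_form (objects \<Gamma>) V \<omega> \<and>
     (\<forall>\<gamma>\<in>points (arrows \<Gamma>). \<forall>v\<in>tangent (arrows \<Gamma>) \<gamma>.
        hor_form \<Gamma> H (pullback_form (objects \<Gamma>) (source \<Gamma>) \<omega>) \<gamma> v =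
        hor_form \<Gamma> H (pullback_form (objects \<Gamma>) (target \<Gamma>) \<omega>) \<gamma> v)"


section \<open>Principal bundles over Lie groupoids\<close>

record ('x1, 'x0, 'g, 'p, 'ep) smooth_bundle =
  total_space :: "('p, 'ep) atlas"
  bproj :: "'p \<Rightarrow> 'x0"
  ract :: "'p \<Rightarrow> 'g \<Rightarrow> 'p"
  lact :: "'x1 \<Rightarrow> 'p \<Rightarrow> 'p"

definition principal_bundle ::
  "('g, 'eg::euclidean_space) smooth_group \<Rightarrow> ('x0, 'e0::euclidean_space) atlas \<Rightarrow>
   ('x1, 'x0, 'g, 'p, 'ep::euclidean_space) smooth_bundle \<Rightarrow> bool" where
  "principal_bundle G X B \<longleftrightarrow>
     manifold (total_space B) \<and> smooth_map (total_space B) X (bproj B) \<and>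
     smooth_map (prod_atlas (total_space B) (group_atlas G)) (total_space B) (\<lambda>(a, g). ract B a g) \<and>
     (\<forall>a\<in>points (total_space B). ract B a \<one>\<^bsub>G\<^esub> = a \<and>
        (\<forall>g\<in>carrier G. bproj B (ract B a g) = bproj B a \<and>
           (\<forall>h\<in>carrier G. ract B (ract B a g) h = ract B a (g \<otimes>\<^bsub>G\<^esub> h)))) \<and>
     (\<forall>x\<in>points X. \<exists>U \<tau> \<tau>'. mopen X U \<and> x \<in> U \<and>
        (let BU = {a \<in> points (total_space B). bproj B a \<in> U} in
           smooth_map (open_sub (total_space B) BU) (prod_atlas (open_sub X U) (group_atlas G)) \<tau> \<and>
           smooth_map (prod_atlas (open_sub X U) (group_atlas G)) (open_sub (total_space B) BU) \<tau>' \<and>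
           (\<forall>a\<in>BU. \<tau>' (\<tau> a) = a) \<and> (\<forall>y\<in>U \<times> carrier G. \<tau> (\<tau>' y) = y) \<and>
           (\<forall>a\<in>BU. fst (\<tau> a) = bproj B a \<and>
              (\<forall>g\<in>carrier G. \<tau> (ract B a g) = (bproj B a, snd (\<tau> a) \<otimes>\<^bsub>G\<^esub> g)))))"

text \<open>The manifold \<open>s\<^sup>*E\<close>, i.e. the fibre product of the source map and the bundle projection.\<close>

definition pullback_points ::
  "('x1, 'x0, 'e1, 'e0) smooth_groupoid \<Rightarrow> ('x1, 'x0, 'g, 'p, 'ep) smooth_bundle \<Rightarrow>
   ('x1 \<times> 'p) set" where
  "pullback_points \<Gamma> B = {(\<gamma>, a). \<gamma> \<in> points (arrows \<Gamma>) \<and> a \<in> points (total_space B) \<and>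
                                  source \<Gamma> \<gamma> = bproj B a}"

definition pullback_atlas ::
  "('x1, 'x0, 'e1::euclidean_space, 'e0) smooth_groupoid \<Rightarrow>
   ('x1, 'x0, 'g, 'p, 'ep::euclidean_space) smooth_bundle \<Rightarrow> ('x1 \<times> 'p, 'e1 \<times> 'ep) atlas" where
  "pullback_atlas \<Gamma> B = sub_atlas (prod_atlas (arrows \<Gamma>) (total_space B)) (pullback_points \<Gamma> B)"

definition groupoid_principal_bundle ::
  "('g, 'eg::euclidean_space) smooth_group \<Rightarrow>
   ('x1, 'x0, 'e1::euclidean_space, 'e0::euclidean_space) smooth_groupoid \<Rightarrow>
   ('x1, 'x0, 'g, 'p, 'ep::euclidean_space) smooth_bundle \<Rightarrow> bool" where
  "groupoid_principal_bundle G \<Gamma> B \<longleftrightarrow>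
     principal_bundle G (objects \<Gamma>) B \<and>
     smooth_map (pullback_atlas \<Gamma> B) (total_space B) (\<lambda>(\<gamma>, a). lact B \<gamma> a) \<and>
     (\<forall>(\<gamma>, a)\<in>pullback_points \<Gamma> B.
        lact B \<gamma> a \<in> points (total_space B) \<and> bproj B (lact B \<gamma> a) = target \<Gamma> \<gamma> \<and>
        (\<forall>g\<in>carrier G. ract B (lact B \<gamma> a) g = lact B \<gamma> (ract B a g))) \<and>
     (\<forall>a\<in>points (total_space B). lact B (gunit \<Gamma> (bproj B a)) a = a) \<and>
     (\<forall>\<gamma> \<gamma>' a. (\<gamma>, \<gamma>') \<in> composable \<Gamma> \<and> (\<gamma>', a) \<in> pullback_points \<Gamma> B \<longrightarrow>
        lact B \<gamma> (lact B \<gamma>' a) = lact B (gcomp \<Gamma> \<gamma> \<gamma>') a)"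

definition pullback_groupoid ::
  "('x1, 'x0, 'e1::euclidean_space, 'e0::euclidean_space) smooth_groupoid \<Rightarrow>
   ('x1, 'x0, 'g, 'p, 'ep::euclidean_space) smooth_bundle \<Rightarrow>
   ('x1 \<times> 'p, 'p, 'e1 \<times> 'ep, 'ep) smooth_groupoid" where
  "pullback_groupoid \<Gamma> B =
     \<lparr> arrows = pullback_atlas \<Gamma> B, objects = total_space B,
       source = (\<lambda>(\<gamma>, a). a), target = (\<lambda>(\<gamma>, a). lact B \<gamma> a),
       gunit = (\<lambda>a. (gunit \<Gamma> (bproj B a), a)),
       gcomp = (\<lambda>(\<gamma>, a) (\<gamma>', a'). (gcomp \<Gamma> \<gamma> \<gamma>', a')),
       ginv = (\<lambda>(\<gamma>, a). (ginv \<Gamma> \<gamma>, lact B \<gamma> a)) \<rparr>"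

definition pullback_connection ::
  "('x1, 'x0, 'e1::euclidean_space, 'e0::euclidean_space) smooth_groupoid \<Rightarrow>
   ('x1 \<Rightarrow> 'x1 tvec set) \<Rightarrow> ('x1, 'x0, 'g, 'p, 'ep::euclidean_space) smooth_bundle \<Rightarrow>
   'x1 \<times> 'p \<Rightarrow> ('x1 \<times> 'p) tvec set" where
  "pullback_connection \<Gamma> H B q =
     {u \<in> tangent (pullback_atlas \<Gamma> B) q. tangent_map (arrows \<Gamma>) fst q u \<in> H (fst q)}"

text \<open>The tangent vector of \<open>s\<^sup>*E\<close> written \<open>(v, w)\<close> under the identification of the tangent
  space of the fibre product with the fibre product of the tangent spaces.\<close>

definition pullback_vec ::
  "('x1, 'x0, 'e1::euclidean_space, 'e0::euclidean_space) smooth_groupoid \<Rightarrow>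
   ('x1, 'x0, 'g, 'p, 'ep::euclidean_space) smooth_bundle \<Rightarrow>
   'x1 \<times> 'p \<Rightarrow> 'x1 tvec \<Rightarrow> 'p tvec \<Rightarrow> ('x1 \<times> 'p) tvec" where
  "pullback_vec \<Gamma> B q v w =
     (THE u. u \<in> tangent (pullback_atlas \<Gamma> B) q \<and>
        tangent_map (arrows \<Gamma>) fst q u = v \<and> tangent_map (total_space B) snd q u = w)"

text \<open>The choice of \<open>v\<close> is immaterial: \<open>hor_proj \<Gamma> H \<gamma> v\<close> depends only on the image of \<open>v\<close>
  under the differential of the source map.\<close>

definition bundle_transport ::
  "('x1, 'x0, 'e1::euclidean_space, 'e0::euclidean_space) smooth_groupoid \<Rightarrow>
   ('x1 \<Rightarrow> 'x1 tvec set) \<Rightarrow> ('x1, 'x0, 'g, 'p, 'ep::euclidean_space) smooth_bundle \<Rightarrow>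
   'x1 \<Rightarrow> 'p \<Rightarrow> 'p tvec \<Rightarrow> 'p tvec" where
  "bundle_transport \<Gamma> H B \<gamma> a w =
     (let v = (SOME v. v \<in> tangent (arrows \<Gamma>) \<gamma> \<and>
                 tangent_map (objects \<Gamma>) (source \<Gamma>) \<gamma> v = tangent_map (objects \<Gamma>) (bproj B) a w)
      in tangent_map (total_space B) (\<lambda>(\<gamma>, a). lact B \<gamma> a) (\<gamma>, a)
           (pullback_vec \<Gamma> B (\<gamma>, a) (hor_proj \<Gamma> H \<gamma> v) w))"


section \<open>The Atiyah sequence and connections on principal bundles\<close>

text \<open>\<open>tclass\<close> and \<open>adclass\<close> form the orbits \<open>[w]\<close> in \<open>(TE)/G\<close> and \<open>[(a, A)]\<close> in
  \<open>(E \<times> \<gg>)/G\<close>.\<close>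

definition tclass ::
  "('g, 'eg::euclidean_space) smooth_group \<Rightarrow>
   ('x1, 'x0, 'g, 'p, 'ep::euclidean_space) smooth_bundle \<Rightarrow>
   'p \<Rightarrow> 'p tvec \<Rightarrow> ('p \<times> 'p tvec) set" where
  "tclass G B a w =
     {(ract B a g, tangent_map (total_space B) (\<lambda>b. ract B b g) a w) | g. g \<in> carrier G}"

definition adclass ::
  "('g, 'eg::euclidean_space) smooth_group \<Rightarrow>
   ('x1, 'x0, 'g, 'p, 'ep::euclidean_space) smooth_bundle \<Rightarrow>
   'p \<Rightarrow> 'g tvec \<Rightarrow> ('p \<times> 'g tvec) set" where
  "adclass G B a A = {(ract B a g, Ad G (inv\<^bsub>G\<^esub> g) A) | g. g \<in> carrier G}"

definition atiyah_atlas ::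
  "('g, 'eg::euclidean_space) smooth_group \<Rightarrow>
   ('x1, 'x0, 'g, 'p, 'ep::euclidean_space) smooth_bundle \<Rightarrow>
   (('p \<times> 'p tvec) set, 'ep \<times> 'ep) atlas" where
  "atiyah_atlas G B = quotient_atlas (tangent_atlas (total_space B))
     {tclass G B a w | a w. a \<in> points (total_space B) \<and> w \<in> tangent (total_space B) a}"

definition adjoint_atlas ::
  "('g, 'eg::euclidean_space) smooth_group \<Rightarrow>
   ('x1, 'x0, 'g, 'p, 'ep::euclidean_space) smooth_bundle \<Rightarrow>
   (('p \<times> 'g tvec) set, 'ep \<times> 'eg) atlas" where
  "adjoint_atlas G B = quotient_atlas (prod_atlas (total_space B) (lie_algebra_atlas G))
     {adclass G B a A | a A. a \<in> points (total_space B) \<and> A \<in> lie_algebra G}"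

definition fundamental_field ::
  "('g, 'eg::euclidean_space) smooth_group \<Rightarrow>
   ('x1, 'x0, 'g, 'p, 'ep::euclidean_space) smooth_bundle \<Rightarrow>
   'g tvec \<Rightarrow> 'p \<Rightarrow> 'p tvec" where
  "fundamental_field G B A a = tangent_map (total_space B) (\<lambda>g. ract B a g) \<one>\<^bsub>G\<^esub> A"

text \<open>Vector bundle morphisms \<open>(TE)/G \<rightarrow> (E \<times> \<gg>)/G\<close> over the base: smooth, fibre preserving
  and fibrewise linear. The vector space operations in the fibres are
  \<open>[(a, v)] + [(a, w)] = [(a, v + w)]\<close> and \<open>c [(a, v)] = [(a, c v)]\<close>.\<close>

definition atiyah_morphism ::
  "('g, 'eg::euclidean_space) smooth_group \<Rightarrow>
   ('x1, 'x0, 'g, 'p, 'ep::euclidean_space) smooth_bundle \<Rightarrow>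
   (('p \<times> 'p tvec) set \<Rightarrow> ('p \<times> 'g tvec) set) \<Rightarrow> bool" where
  "atiyah_morphism G B D \<longleftrightarrow>
     smooth_map (atiyah_atlas G B) (adjoint_atlas G B) D \<and>
     (\<forall>a\<in>points (total_space B). \<forall>w\<in>tangent (total_space B) a.
        \<exists>b\<in>points (total_space B). \<exists>A\<in>lie_algebra G.
          bproj B b = bproj B a \<and> D (tclass G B a w) = adclass G B b A) \<and>
     (\<forall>a\<in>points (total_space B). \<forall>v\<in>tangent (total_space B) a. \<forall>w\<in>tangent (total_space B) a.
        \<forall>A\<in>lie_algebra G. \<forall>C\<in>lie_algebra G. \<forall>c.
          D (tclass G B a v) = adclass G B a A \<and> D (tclass G B a w) = adclass G B a C \<longrightarrow>
          D (tclass G B a (v + w)) = adclass G B a (A + C) \<and>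
          D (tclass G B a (c *\<^sub>R v)) = adclass G B a (c *\<^sub>R A))"

text \<open>Equivariance uses \<open>\<gamma> [w] = [bundle_transport \<Gamma> H B \<gamma> a w]\<close> for \<open>w\<close> tangent at \<open>a\<close>, and
  \<open>\<gamma> [(a, A)] = [(\<gamma> a, A)]\<close>, where every class over \<open>bproj B a\<close> has a representative at \<open>a\<close>.\<close>

definition bundle_connection ::
  "('g, 'eg::euclidean_space) smooth_group \<Rightarrow>
   ('x1, 'x0, 'e1::euclidean_space, 'e0::euclidean_space) smooth_groupoid \<Rightarrow>
   ('x1 \<Rightarrow> 'x1 tvec set) \<Rightarrow> ('x1, 'x0, 'g, 'p, 'ep::euclidean_space) smooth_bundle \<Rightarrow>
   (('p \<times> 'p tvec) set \<Rightarrow> ('p \<times> 'g tvec) set) \<Rightarrow> bool" where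
  "bundle_connection G \<Gamma> H B D \<longleftrightarrow>
     atiyah_morphism G B D \<and>
     (\<forall>(\<gamma>, a)\<in>pullback_points \<Gamma> B. \<forall>w\<in>tangent (total_space B) a. \<forall>A\<in>lie_algebra G.
        D (tclass G B a w) = adclass G B a A \<longrightarrow>
        D (tclass G B (lact B \<gamma> a) (bundle_transport \<Gamma> H B \<gamma> a w)) =
          adclass G B (lact B \<gamma> a) A) \<and>
     (\<forall>a\<in>points (total_space B). \<forall>A\<in>lie_algebra G.
        D (tclass G B a (fundamental_field G B A a)) = adclass G B a A)"

definition associated_form ::
  "('g, 'eg::euclidean_space) smooth_group \<Rightarrow>
   ('x1, 'x0, 'g, 'p, 'ep::euclidean_space) smooth_bundle \<Rightarrow>
   (('p \<times> 'p tvec) set \<Rightarrow> ('p \<times> 'g tvec) set) \<Rightarrow> ('p \<Rightarrow> 'p tvec \<Rightarrow> 'g tvec) \<Rightarrow> bool" where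
  "associated_form G B D \<omega> \<longleftrightarrow>
     one_form (total_space B) (lie_algebra_atlas G) \<omega> \<and>
     (\<forall>a\<in>points (total_space B). \<forall>v\<in>tangent (total_space B) a.
        D (tclass G B a v) = adclass G B a (\<omega> a v))"

end

theory Submission
  imports Defs
begin

text \<open>Charts take values in linear subspaces of the model space, so a coordinate expression is
  known only as the restriction of some smooth function on an open set, and the derivative of that
  function carries information only along the subspace. This is why derivations and curves are
  treated with arbitrary extensions and why the implicit function argument carries two subspaces.
  The fibre product has no explicit charts: its atlas is described by extension properties, so
  functions near a point of it are read in the product coordinates of the ambient space.

  The source map of the pull-back groupoid is the projection to \<open>E\<close>. The horizontal
  part of a vector must therefore keep the second component and replace the first one by its part in
  \<open>H\<close>. Hence existence comes down to lifting the vertical part of the first component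
  with second component 0, and subtracting that lift.

  \<open>hor_proj\<close> and \<open>pullback_vec\<close> are definite descriptions and
  \<open>bundle_transport\<close> chooses its vector, so uniqueness must be available before any of
  them can be computed.\<close>

text \<open>For a tangent vector \<open>v\<close> of \<open>s\<^sup>*E\<close> at \<open>(\<gamma>, a)\<close> with horizontal part \<open>h = (x, w)\<close>, the vector \<open>x\<close> is
  the horizontal lift used to define the action of \<open>\<gamma>\<close> on \<open>w\<close>, so the differential of the
  action map sends \<open>h\<close> to \<open>\<gamma> w\<close>. Equivariance of the connection then gives
  \<open>[(\<gamma> a, \<omega> (\<gamma> w))] = [(\<gamma> a, \<omega> w)]\<close>, and the two forms agree on \<open>h\<close> because \<open>G\<close> acts freely on \<open>E\<close>.

  What needs work is that the horizontal part exists and that \<open>h\<close> is determined by \<open>(x, w)\<close>, since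
  tangent vectors are derivations. Uniqueness follows from Hadamard's lemma: a derivation that
  kills the ambient coordinates vanishes. For existence, a vertical vector \<open>k\<close> at \<open>\<gamma>\<close> is lifted to
  \<open>(k, 0)\<close> as the velocity of \<open>(c, a)\<close>, where \<open>c\<close> is a curve in the source fibre of \<open>\<gamma>\<close> with velocity
  \<open>k\<close>, obtained from the inverse function theorem.\<close>

section \<open>Functions of class C^k\<close>

lemma Ck_Suc_imp: "Ck (Suc k) U f \<Longrightarrow> Ck k U f"
proof (induction k arbitrary: f)
  case 0
  then obtain f' where "\<forall>x\<in>U. (f has_derivative f' x) (at x)"
    by auto
  then have "\<forall>x\<in>U. isCont f x"
    using has_derivative_continuous by blast
  then show ?case
    by (simp add: continuous_at_imp_continuous_on)
next
  case (Suc k)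
  then obtain f' where "\<forall>x\<in>U. (f has_derivative f' x) (at x)" "\<forall>v. Ck (Suc k) U (\<lambda>x. f' x v)"
    by auto
  then show ?case
    using Suc.IH by (auto intro!: exI[of _ f'])
qed

lemma Ck_subset: "Ck k U f \<Longrightarrow> V \<subseteq> U \<Longrightarrow> Ck k V f"
proof (induction k arbitrary: f)
  case 0
  then show ?case by (auto intro: continuous_on_subset)
next
  case (Suc k)
  then obtain f' where "\<forall>x\<in>U. (f has_derivative f' x) (at x)" "\<forall>v. Ck k U (\<lambda>x. f' x v)"
    by auto
  then show ?case
    using Suc.IH Suc.prems(2) by (auto intro!: exI[of _ f'])
qed

text \<open>The derivatives in \<open>Ck\<close> are full derivatives \<open>at x\<close>; agreement
  on \<open>U\<close> carries over to them because \<open>U\<close> is open.\<close>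

lemma Ck_cong:
  assumes "open U" "\<And>x. x \<in> U \<Longrightarrow> f x = g x" "Ck k U f"
  shows "Ck k U g"
proof (cases k)
  case 0
  then show ?thesis using assms by (auto cong: continuous_on_cong)
next
  case (Suc j)
  then obtain f' where f': "\<And>x. x\<in>U \<Longrightarrow> (f has_derivative f' x) (at x)" "\<forall>v. Ck j U (\<lambda>x. f' x v)"
    using assms by auto
  have "(g has_derivative f' x) (at x)" if "x \<in> U" for x
    using has_derivative_transform_within_open[OF f'(1)[OF that] assms(1) that assms(2)] .
  then show ?thesis using Suc f' by auto
qed

lemma Ck_const: "Ck k U (\<lambda>x. c)"
proof (induction k arbitrary: c)
  case (Suc k)
  then show ?case by (auto intro!: exI[of _ "\<lambda>x v. 0"])
qed simp

lemma Ck_bounded_linear: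
  assumes "bounded_linear L"
  shows "Ck k U L"
proof (cases k)
  case 0
  then show ?thesis using assms by (auto intro: linear_continuous_on)
next
  case (Suc j)
  then show ?thesis
    using assms Ck_const by (auto intro!: exI[of _ "\<lambda>x. L"] bounded_linear_imp_has_derivative)
qed

lemma Ck_linear_compose:
  assumes "bounded_linear L"
  shows "Ck k U f \<Longrightarrow> Ck k U (\<lambda>x. L (f x))"
proof (induction k arbitrary: f)
  case 0
  then show ?case using assms by (auto intro: linear_continuous_on_compose bounded_linear.continuous_on)
next
  case (Suc k)
  then obtain f' where "\<And>x. x\<in>U \<Longrightarrow> (f has_derivative f' x) (at x)" "\<forall>v. Ck k U (\<lambda>x. f' x v)"
    by auto
  then show ?case
    using Suc.IH by (auto intro!: exI[of _ "\<lambda>x v. L (f' x v)"] bounded_linear.has_derivative[OF assms])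
qed

lemma Ck_add: "Ck k U f \<Longrightarrow> Ck k U g \<Longrightarrow> Ck k U (\<lambda>x. f x + g x)"
proof (induction k arbitrary: f g)
  case 0
  then show ?case by (auto intro: continuous_intros)
next
  case (Suc k)
  obtain f' where "\<And>x. x\<in>U \<Longrightarrow> (f has_derivative f' x) (at x)" "\<forall>v. Ck k U (\<lambda>x. f' x v)"
    using Suc.prems by auto
  moreover obtain g' where "\<And>x. x\<in>U \<Longrightarrow> (g has_derivative g' x) (at x)" "\<forall>v. Ck k U (\<lambda>x. g' x v)"
    using Suc.prems by auto
  ultimately show ?case
    using Suc.IH by (auto intro!: exI[of _ "\<lambda>x v. f' x v + g' x v"] has_derivative_add)
qed

lemma Ck_sum: "(\<And>i. i \<in> I \<Longrightarrow> Ck k U (f i)) \<Longrightarrow> Ck k U (\<lambda>x. \<Sum>i\<in>I. f i x)"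
  by (induction I rule: infinite_finite_induct) (auto intro: Ck_const Ck_add)

lemma Ck_scaleR:
  "Ck k U c \<Longrightarrow> Ck k U f \<Longrightarrow> Ck k U (\<lambda>x. (c x :: real) *\<^sub>R f x)"
proof (induction k arbitrary: c f)
  case 0
  then show ?case by (auto intro: continuous_intros)
next
  case (Suc k)
  obtain f' where f': "\<And>x. x\<in>U \<Longrightarrow> (f has_derivative f' x) (at x)" "\<forall>v. Ck k U (\<lambda>x. f' x v)"
    using Suc.prems by auto
  obtain c' where c': "\<And>x. x\<in>U \<Longrightarrow> (c has_derivative c' x) (at x)" "\<forall>v. Ck k U (\<lambda>x. c' x v)"
    using Suc.prems by auto
  \<comment> \<open>The product rule leaves undifferentiated factors, so both functions are needed
    in the lower class as well.\<close>
  have "Ck k U c" "Ck k U f"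
    using Suc.prems Ck_Suc_imp by blast+
  then show ?case
    using Suc.IH f' c'
    by (auto intro!: exI[of _ "\<lambda>x v. c x *\<^sub>R f' x v + c' x v *\<^sub>R f x"] has_derivative_scaleR Ck_add)
qed

lemma Ck_compose:
  fixes f :: "'b::euclidean_space \<Rightarrow> 'c::euclidean_space"
  shows "Ck k V f \<Longrightarrow> Ck k U g \<Longrightarrow> g ` U \<subseteq> V \<Longrightarrow> Ck k U (\<lambda>x. f (g x))"
proof (induction k arbitrary: f)
  case 0
  then show ?case by (auto intro: continuous_on_compose2)
next
  case (Suc k)
  obtain f' where f': "\<And>x. x\<in>V \<Longrightarrow> (f has_derivative f' x) (at x)" "\<forall>v. Ck k V (\<lambda>x. f' x v)"
    using Suc.prems by auto
  obtain g' where g': "\<And>x. x\<in>U \<Longrightarrow> (g has_derivative g' x) (at x)" "\<forall>v. Ck k U (\<lambda>x. g' x v)"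
    using Suc.prems(2) by auto
  \<comment> \<open>\<open>Ck\<close> controls \<open>f' y v\<close> only for a fixed direction
    \<open>v\<close>, while the chain rule produces the moving direction \<open>g' x v\<close>.
    Expanding that direction in the basis leaves fixed directions with smooth coefficients.\<close>
  let ?h = "\<lambda>x v. \<Sum>b\<in>Basis. (g' x v \<bullet> b) *\<^sub>R f' (g x) b"
  have gk: "Ck k U g"
    using Suc.prems Ck_Suc_imp by blast
  have "((\<lambda>x. f (g x)) has_derivative ?h x) (at x)" if "x \<in> U" for x
  proof -
    have lin: "linear (f' (g x))"
      using f'(1)[of "g x"] that Suc.prems(3) has_derivative_linear by blast
    have "f' (g x) w = (\<Sum>b\<in>Basis. (w \<bullet> b) *\<^sub>R f' (g x) b)" for w
      by (subst euclidean_representation[symmetric, of w])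
        (simp only: linear_sum[OF lin] linear_scale[OF lin])
    then have "?h x = (\<lambda>v. f' (g x) (g' x v))"
      by metis
    moreover have "g x \<in> V" using that Suc.prems(3) by auto
    ultimately show ?thesis
      using has_derivative_compose[OF g'(1)[OF that] f'(1)] by simp
  qed
  moreover have "Ck k U (\<lambda>x. ?h x v)" for v
  proof (intro Ck_sum Ck_scaleR)
    fix b :: 'b
    show "Ck k U (\<lambda>x. g' x v \<bullet> b)"
      using g'(2) by (intro Ck_linear_compose[OF bounded_linear_inner_left]) blast
    show "Ck k U (\<lambda>x. f' (g x) b)"
      using Suc.IH[of "\<lambda>y. f' y b"] f'(2) gk Suc.prems(3) by blast
  qed
  ultimately show ?case by (auto intro!: exI[of _ ?h])
qed

lemma Ck_Pair:
  fixes f :: "'a::euclidean_space \<Rightarrow> 'b::euclidean_space" and g :: "'a \<Rightarrow> 'c::euclidean_space"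
  assumes "Ck k U f" "Ck k U g"
  shows "Ck k U (\<lambda>x. (f x, g x))"
proof -
  have "bounded_linear (\<lambda>y::'b. (y, 0::'c))" "bounded_linear (\<lambda>y::'c. (0::'b, y))"
    by (auto intro!: bounded_linear_Pair bounded_linear_ident bounded_linear_zero)
  then have "Ck k U (\<lambda>x. (f x, 0::'c))" "Ck k U (\<lambda>x. (0::'b, g x))"
    using Ck_linear_compose assms by blast+
  from Ck_add[OF this] show ?thesis by simp
qed

section \<open>Smooth functions on open sets\<close>

definition smooth_open :: "'a::euclidean_space set \<Rightarrow> ('a \<Rightarrow> 'b::euclidean_space) \<Rightarrow> bool" where
  "smooth_open U f \<longleftrightarrow> open U \<and> (\<forall>k. Ck k U f)"

text \<open>Each class \<open>Ck (Suc k)\<close> comes with its own derivative family. Uniqueness of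
  derivatives on \<open>U\<close> identifies them all with the one obtained for
  \<open>k = 0\<close>, whose directional derivatives are then of every class.\<close>

lemma smooth_open_derivative:
  assumes "smooth_open U f"
  obtains f' where "\<And>x. x \<in> U \<Longrightarrow> (f has_derivative f' x) (at x)" "\<And>v. smooth_open U (\<lambda>x. f' x v)"
proof -
  have "Ck (Suc 0) U f"
    using assms smooth_open_def by blast
  then obtain f' where f': "\<And>x. x \<in> U \<Longrightarrow> (f has_derivative f' x) (at x)"
    by auto
  have "Ck k U (\<lambda>x. f' x v)" for k v
  proof -
    have "Ck (Suc k) U f"
      using assms smooth_open_def by blast
    then obtain h where h: "\<And>x. x \<in> U \<Longrightarrow> (f has_derivative h x) (at x)" "Ck k U (\<lambda>x. h x v)"
      by auto
    have "h x v = f' x v" if "x \<in> U" for x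
      using has_derivative_unique[OF h(1) f'] that by metis
    moreover have "open U"
      using assms smooth_open_def by blast
    ultimately show ?thesis
      using Ck_cong[of U "\<lambda>x. h x v" "\<lambda>x. f' x v"] h(2) by blast
  qed
  then have "smooth_open U (\<lambda>x. f' x v)" for v
    using assms unfolding smooth_open_def by blast
  with f' that show ?thesis
    by blast
qed

lemma smooth_open_continuous_on: "smooth_open U f \<Longrightarrow> continuous_on U f"
  unfolding smooth_open_def by (metis Ck.simps(1))

lemma smooth_open_vimage:
  assumes "smooth_open U f" "open V"
  shows "open {x \<in> U. f x \<in> V}"
proof -
  have "{x \<in> U. f x \<in> V} = f -` V \<inter> U" by auto
  then show ?thesis
    using assms smooth_open_continuous_on[OF assms(1)]
    by (auto simp: smooth_open_def continuous_on_open_vimage)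
qed

lemma smooth_open_subset: "smooth_open U f \<Longrightarrow> open V \<Longrightarrow> V \<subseteq> U \<Longrightarrow> smooth_open V f"
  unfolding smooth_open_def using Ck_subset by blast

lemma smooth_open_compose:
  assumes "smooth_open V f" "smooth_open U g"
  shows "smooth_open {x \<in> U. g x \<in> V} (\<lambda>x. f (g x))"
proof -
  have o: "open {x \<in> U. g x \<in> V}"
    using smooth_open_vimage assms by (auto simp: smooth_open_def)
  moreover have "Ck k {x \<in> U. g x \<in> V} g" for k
    by (rule Ck_subset[of _ U]) (use assms in \<open>auto simp: smooth_open_def\<close>)
  moreover have "Ck k V f" for k
    using assms by (simp add: smooth_open_def)
  ultimately have "Ck k {x \<in> U. g x \<in> V} (\<lambda>x. f (g x))" for k
    by (intro Ck_compose[of k V f _ g]) auto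
  with o show ?thesis by (simp add: smooth_open_def)
qed

lemma smooth_open_mult:
  fixes f g :: "'a::euclidean_space \<Rightarrow> real"
  assumes "smooth_open U f" "smooth_open U g"
  shows "smooth_open U (\<lambda>x. f x * g x)"
proof -
  have "Ck k U (\<lambda>x. f x *\<^sub>R g x)" for k
    using assms by (intro Ck_scaleR) (auto simp: smooth_open_def)
  with assms show ?thesis by (simp add: smooth_open_def)
qed

section \<open>Hadamard's lemma\<close>

text \<open>The inverse function theorem wants the derivative as a continuous map into the bounded
  linear maps; in finite dimension continuity in each basis direction suffices.\<close>

lemma derivative_Blinfun_continuous:
  fixes f' :: "'a::euclidean_space \<Rightarrow> 'a \<Rightarrow> 'b::euclidean_space"
  assumes "\<And>x. x \<in> U \<Longrightarrow> bounded_linear (f' x)" "\<And>v. continuous_on U (\<lambda>x. f' x v)"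
  shows "continuous_on U (\<lambda>x. Blinfun (f' x))"
proof (rule continuous_on_blinfun_componentwise)
  fix i :: 'a assume "i \<in> Basis"
  have "continuous_on U (\<lambda>x. f' x i)" by (rule assms)
  then show "continuous_on U (\<lambda>x. blinfun_apply (Blinfun (f' x)) i)"
    by (rule continuous_on_eq) (simp add: bounded_linear_Blinfun_apply assms(1))
qed

text \<open>The weight \<open>t ^ m\<close> makes the induction go through: differentiating
  \<open>f (z + t *\<^sub>R (x - z))\<close> in \<open>x\<close> brings out one more factor
  \<open>t\<close>, so the derivative is an integral of the same kind with exponent
  \<open>Suc m\<close>.\<close>

lemma Ck_ray_integral:
  fixes f :: "'a::euclidean_space \<Rightarrow> 'b::euclidean_space"
  assumes U: "open U" "convex U" "z \<in> U"
  shows "Ck k U f \<Longrightarrow> Ck k U (\<lambda>x. integral {0..1::real} (\<lambda>t. t ^ m *\<^sub>R f (z + t *\<^sub>R (x - z))))"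
proof (induction k arbitrary: f m)
  have ray: "z + t *\<^sub>R (x - z) \<in> U" if "x \<in> U" "t \<in> {0..1}" for x t
    using convexD_alt[OF U(2,3) that(1), of t] that(2) by (simp add: algebra_simps)
  have cont: "continuous_on (U \<times> {0..1}) (\<lambda>(x, t). t ^ m *\<^sub>R g (z + t *\<^sub>R (x - z)))"
    if "continuous_on U g" for g :: "'a \<Rightarrow> 'c::euclidean_space" and m
  proof -
    have "continuous_on (U \<times> {0..1}) (\<lambda>p. g (z + snd p *\<^sub>R (fst p - z)))"
      by (rule continuous_on_compose2[OF that]) (auto intro!: continuous_intros ray)
    then show ?thesis
      by (auto simp: case_prod_beta' intro!: continuous_intros)
  qed
  {
    case 0
    have "continuous_on U (\<lambda>x. integral (cbox 0 1) (\<lambda>t. t ^ m *\<^sub>R f (z + t *\<^sub>R (x - z))))"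
      by (rule integral_continuous_on_param) (use cont[of f m] 0 in simp)
    then show ?case by simp
  next
    case (Suc k)
    obtain f' where f': "\<And>x. x\<in>U \<Longrightarrow> (f has_derivative f' x) (at x)" "\<And>v. Ck k U (\<lambda>x. f' x v)"
      using Suc.prems by auto
    let ?h = "\<lambda>x t. t ^ m *\<^sub>R f (z + t *\<^sub>R (x - z))"
    let ?d = "\<lambda>x t v. t ^ Suc m *\<^sub>R f' (z + t *\<^sub>R (x - z)) v"
    have fc: "continuous_on U f"
      using f'(1) by (auto intro!: continuous_at_imp_continuous_on has_derivative_continuous)
    have f'c: "continuous_on U (\<lambda>x. f' x v)" for v
    proof -
      \<comment> \<open>The directional derivatives are given in class \<open>k\<close>; continuity
        is class 0, reached by lowering the class step by step.\<close>
      have "Ck j U h \<Longrightarrow> Ck 0 U h" for j and h :: "'a \<Rightarrow> 'b"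
        by (induction j) (auto dest: Ck_Suc_imp simp del: Ck.simps)
      then show ?thesis using f'(2) by (metis Ck.simps(1))
    qed
    have bl: "bounded_linear (f' x)" if "x \<in> U" for x
      using f'(1)[OF that] by (rule has_derivative_bounded_linear)
    have hd: "((\<lambda>x. ?h x t) has_derivative ?d x t) (at x within U)" if "x \<in> U" "t \<in> {0..1}" for x t
    proof -
      have "((\<lambda>x. z + t *\<^sub>R (x - z)) has_derivative (\<lambda>v. t *\<^sub>R v)) (at x within U)"
        by (auto intro!: derivative_eq_intros)
      from has_derivative_compose[OF this f'(1)[OF ray[OF that]]]
      have "((\<lambda>x. ?h x t) has_derivative (\<lambda>v. t ^ m *\<^sub>R f' (z + t *\<^sub>R (x - z)) (t *\<^sub>R v))) (at x within U)"
        by (rule has_derivative_scaleR_right)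
      then show ?thesis
        by (simp add: linear_scale[OF bounded_linear.linear[OF bl[OF ray[OF that]]]] mult.commute)
    qed
    have bld: "bounded_linear (?d x t)" if "x \<in> U" "t \<in> {0..1}" for x t
      using hd[OF that] by (rule has_derivative_bounded_linear)
    have contd: "continuous_on (U \<times> cbox 0 1) (\<lambda>p. Blinfun (?d (fst p) (snd p)))"
    proof (rule continuous_on_blinfun_componentwise)
      fix i :: 'a
      have "continuous_on (U \<times> cbox 0 1) (\<lambda>p. ?d (fst p) (snd p) i)"
        using cont[OF f'c[of i], of "Suc m"] by (simp add: case_prod_beta')
      then show "continuous_on (U \<times> cbox 0 1) (\<lambda>p. blinfun_apply (Blinfun (?d (fst p) (snd p))) i)"
        by (rule continuous_on_eq) (auto simp: bounded_linear_Blinfun_apply bld simp del: power_Suc)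
    qed
    have hint: "?h x integrable_on cbox 0 1" if "x \<in> U" for x
    proof -
      have "continuous_on {0..1} (\<lambda>t. (\<lambda>(x, t). ?h x t) (x, t))"
        by (rule continuous_on_compose2[OF cont[OF fc, of m]])
          (use that in \<open>auto intro!: continuous_intros\<close>)
      then show ?thesis
        by (auto intro!: integrable_continuous_interval)
    qed
    have "((\<lambda>x. integral (cbox 0 1) (?h x)) has_derivative
            (\<lambda>v. integral {0..1} (\<lambda>t. ?d x t v))) (at x)" if x: "x \<in> U" for x
    proof -
      have "((\<lambda>x. integral (cbox 0 1) (?h x)) has_derivative
          integral (cbox 0 1) (\<lambda>t. Blinfun (?d x t))) (at x within U)"
        by (rule leibniz_rule)
          (use x U(2) hd bld hint contd in \<open>auto simp: bounded_linear_Blinfun_apply case_prod_beta'\<close>)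
      \<comment> \<open>Differentiation under the integral sign yields an integral of operators.
        Evaluating it at \<open>v\<close> returns to an integral of vectors, to which the induction
        hypothesis applies.\<close>
      moreover have "blinfun_apply (integral (cbox 0 1) (\<lambda>t. Blinfun (?d x t))) v
          = integral {0..1} (\<lambda>t. ?d x t v)" for v
      proof -
        have "continuous_on {0..1} (\<lambda>t. Blinfun (?d (fst (x, t)) (snd (x, t))))"
          by (rule continuous_on_compose2[OF contd]) (use x in \<open>auto intro!: continuous_intros\<close>)
        then have "(\<lambda>t. Blinfun (?d x t)) integrable_on {0..1}"
          by (auto intro: integrable_continuous_interval)
        then have "blinfun_apply (integral {0..1} (\<lambda>t. Blinfun (?d x t))) v
            = integral {0..1} (\<lambda>t. blinfun_apply (Blinfun (?d x t)) v)"
          by (rule blinfun_apply_integral)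
        also have "\<dots> = integral {0..1} (\<lambda>t. ?d x t v)"
          by (rule integral_cong) (use x bld in \<open>simp add: bounded_linear_Blinfun_apply\<close>)
        finally show ?thesis by simp
      qed
      then have "blinfun_apply (integral (cbox 0 1) (\<lambda>t. Blinfun (?d x t)))
          = (\<lambda>v. integral {0..1} (\<lambda>t. ?d x t v))"
        by blast
      ultimately show ?thesis
        using at_within_open[OF x U(1)] by metis
    qed
    moreover have "Ck k U (\<lambda>x. integral {0..1} (\<lambda>t. ?d x t v))" for v
      using Suc.IH[OF f'(2)[of v], of "Suc m"] .
    ultimately show ?case
      by (auto intro!: exI[of _ "\<lambda>x v. integral {0..1} (\<lambda>t. ?d x t v)"])
  }
qed

text \<open>The difference \<open>F x - F z\<close> is the integral of the derivative of
  \<open>F\<close> along the segment from \<open>z\<close> to \<open>x\<close>, which convexity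
  keeps inside \<open>U\<close>. Expanding the direction \<open>x - z\<close> in the basis,
  \<open>G b x\<close> is the mean of the partial derivative in direction \<open>b\<close> over the
  segment; at \<open>x = z\<close> the integrand is constant.\<close>

lemma hadamard:
  fixes F :: "'a::euclidean_space \<Rightarrow> real"
  assumes F: "smooth_open U F" and U: "convex U" "z \<in> U" and F': "(F has_derivative F') (at z)"
  obtains G where "\<And>b. smooth_open U (G b)" "\<And>b. G b z = F' b"
    "\<And>x. x \<in> U \<Longrightarrow> F x = F z + (\<Sum>b\<in>Basis. ((x - z) \<bullet> b) * G b x)"
proof -
  obtain f' where f': "\<And>x. x \<in> U \<Longrightarrow> (F has_derivative f' x) (at x)" "\<And>v. smooth_open U (\<lambda>x. f' x v)"
    using smooth_open_derivative[OF F] by blast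
  have oU: "open U" using F smooth_open_def by blast
  have ray: "z + t *\<^sub>R (x - z) \<in> U" if "x \<in> U" "t \<in> {0..1}" for x t
    using convexD_alt[OF U that(1), of t] that(2) by (simp add: algebra_simps)
  \<comment> \<open>The factor \<open>t ^ 0\<close> is kept so that \<open>Ck_ray_integral\<close>
    applies with \<open>m = 0\<close>.\<close>
  define G where "G b x = integral {0..1::real} (\<lambda>t. t ^ 0 *\<^sub>R f' (z + t *\<^sub>R (x - z)) b)" for b x
  have G: "smooth_open U (G b)" for b
    using f'(2)[of b] oU Ck_ray_integral[OF oU U, of _ "\<lambda>x. f' x b" 0]
    unfolding smooth_open_def G_def by blast
  have "F' = f' z"
    using has_derivative_unique[OF F' f'(1)[OF U(2)]] .
  then have Gz: "G b z = F' b" for b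
    unfolding G_def by simp
  have "F x = F z + (\<Sum>b\<in>Basis. ((x - z) \<bullet> b) * G b x)" if x: "x \<in> U" for x
  proof -
    have lin: "linear (f' y)" if "y \<in> U" for y
      using f'(1)[OF that] has_derivative_linear by blast
    have int: "(\<lambda>t. f' (z + t *\<^sub>R (x - z)) b) integrable_on {0..1}" for b
      by (intro integrable_continuous_interval
          continuous_on_compose2[OF smooth_open_continuous_on[OF f'(2)[of b]]])
        (auto intro!: continuous_intros ray x)
    have "((\<lambda>t. f' (z + t *\<^sub>R (x - z)) (x - z)) has_integral
        F (z + 1 *\<^sub>R (x - z)) - F (z + 0 *\<^sub>R (x - z))) {0..1}"
    proof (rule fundamental_theorem_of_calculus)
      fix t :: real assume t: "t \<in> {0..1}"
      have "((\<lambda>t. z + t *\<^sub>R (x - z)) has_vector_derivative (x - z)) (at t within {0..1})"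
        by (auto intro!: derivative_eq_intros simp: has_vector_derivative_def)
      from vector_derivative_diff_chain_within[OF this has_derivative_at_withinI[OF f'(1)[OF ray[OF x t]]]]
      show "((\<lambda>t. F (z + t *\<^sub>R (x - z))) has_vector_derivative f' (z + t *\<^sub>R (x - z)) (x - z)) (at t within {0..1})"
        by (simp add: o_def)
    qed auto
    then have "F x - F z = integral {0..1} (\<lambda>t. f' (z + t *\<^sub>R (x - z)) (x - z))"
      by (simp add: integral_unique)
    also have "\<dots> = integral {0..1} (\<lambda>t. \<Sum>b\<in>Basis. ((x - z) \<bullet> b) * f' (z + t *\<^sub>R (x - z)) b)"
    proof (rule integral_cong)
      fix t :: real assume "t \<in> {0..1}"
      then have l: "linear (f' (z + t *\<^sub>R (x - z)))" using lin ray x by blast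
      show "f' (z + t *\<^sub>R (x - z)) (x - z) = (\<Sum>b\<in>Basis. ((x - z) \<bullet> b) * f' (z + t *\<^sub>R (x - z)) b)"
        using linear_sum[OF l, of "\<lambda>b. ((x - z) \<bullet> b) *\<^sub>R b" Basis] linear_scale[OF l]
        by (simp add: euclidean_representation)
    qed
    also have "\<dots> = (\<Sum>b\<in>Basis. ((x - z) \<bullet> b) * G b x)"
      unfolding G_def by (subst integral_sum) (auto intro!: integrable_on_mult_right int)
    finally show ?thesis by simp
  qed
  with G Gz that show ?thesis by blast
qed

section \<open>Level curves of submersions\<close>

text \<open>If \<open>n\<close> is orthogonal to \<open>M\<close>, then
  \<open>g (x0 + t *\<^sub>R v) \<bullet> n\<close> vanishes for small \<open>t\<close>, hence so
  does its derivative \<open>g' v \<bullet> n\<close>. Thus \<open>g' v\<close> lies in the double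
  orthogonal complement of \<open>M\<close>, which is \<open>M\<close>.\<close>

lemma derivative_in_subspace:
  fixes g :: "'a::euclidean_space \<Rightarrow> 'b::euclidean_space"
  assumes g': "(g has_derivative g') (at x0)" and U: "open U" "x0 \<in> U" "x0 \<in> L"
    and L: "subspace L" and M: "subspace M"
    and gM: "\<And>x. x \<in> U \<Longrightarrow> x \<in> L \<Longrightarrow> g x \<in> M"
    and v: "v \<in> L"
  shows "g' v \<in> M"
proof -
  have "g' v \<bullet> n = 0" if n: "\<And>y. y \<in> M \<Longrightarrow> y \<bullet> n = 0" for n
  proof -
    have "((\<lambda>t. x0 + t *\<^sub>R v) has_derivative (\<lambda>t. t *\<^sub>R v)) (at 0)"
      by (auto intro!: derivative_eq_intros)
    moreover have "(g has_derivative g') (at (x0 + 0 *\<^sub>R v))" using g' by simp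
    ultimately have "((\<lambda>t. g (x0 + t *\<^sub>R v)) has_derivative (\<lambda>t. g' (t *\<^sub>R v))) (at 0)"
      by (rule has_derivative_compose)
    then have 1: "((\<lambda>t. g (x0 + t *\<^sub>R v) \<bullet> n) has_derivative (\<lambda>t. g' (t *\<^sub>R v) \<bullet> n)) (at 0)"
      by (rule has_derivative_inner_left)
    have "((\<lambda>t. x0 + t *\<^sub>R v) \<longlongrightarrow> x0 + 0 *\<^sub>R v) (at 0)"
      by (intro tendsto_intros)
    then have "\<forall>\<^sub>F t in at 0. x0 + t *\<^sub>R v \<in> U"
      using U by (auto intro: topological_tendstoD)
    then have "\<forall>\<^sub>F t in at 0. g (x0 + t *\<^sub>R v) \<bullet> n = 0"
      by eventually_elim (use U(3) v L n gM in \<open>auto intro: subspace_add subspace_scale\<close>)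
    then have "((\<lambda>t. 0) has_derivative (\<lambda>t. g' (t *\<^sub>R v) \<bullet> n)) (at (0::real))"
      by (rule has_derivative_transform_eventually[OF 1]) (use U n gM in auto)
    from has_derivative_unique[OF this has_derivative_const] show ?thesis
      by (metis scaleR_one)
  qed
  then have "g' v \<in> orthogonal_comp (orthogonal_comp M)"
    by (auto simp: orthogonal_comp_def orthogonal_def inner_commute)
  then show ?thesis by (simp add: M orthogonal_comp_self)
qed

text \<open>An implicit function theorem relative to subspaces: \<open>L\<close> and
  \<open>M\<close> are the spaces in which the charts of the source and of the target of a
  submersion take their values, and off \<open>L\<close> the map \<open>g\<close> is an arbitrary
  extension. The curve is the preimage, under a local diffeomorphism \<open>F\<close>, of the
  straight line through \<open>F x0\<close> in direction \<open>k\<close>.\<close>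

lemma level_curve:
  fixes g :: "'a::euclidean_space \<Rightarrow> 'b::euclidean_space"
  assumes g: "smooth_open U g" and x0: "x0 \<in> U" "x0 \<in> L"
    and g': "(g has_derivative g') (at x0)"
    and L: "subspace L" and M: "subspace M"
    and gM: "\<And>x. x \<in> U \<Longrightarrow> x \<in> L \<Longrightarrow> g x \<in> M"
    and onto: "\<And>y. y \<in> M \<Longrightarrow> \<exists>x\<in>L. g' x = y"
    and k: "k \<in> L" "g' k = 0"
  obtains c :: "real \<Rightarrow> 'a" where "c 0 = x0" "(c has_vector_derivative k) (at 0)"
    "\<forall>\<^sub>F t in at 0. c t \<in> L \<and> c t \<in> U \<and> g (c t) = g x0"
proof -
  obtain d where d: "\<And>x. x \<in> U \<Longrightarrow> (g has_derivative d x) (at x)" "\<And>v. smooth_open U (\<lambda>x. d x v)"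
    using smooth_open_derivative[OF g] by blast
  have dg: "d x0 = g'"
    using has_derivative_unique[OF d(1)[OF x0(1)] g'] .
  have lin: "linear g'" using g' has_derivative_linear by blast
  \<comment> \<open>A right inverse of \<open>g'\<close> on \<open>M\<close>. All its values lie in
    \<open>L\<close>, also those at arguments outside \<open>M\<close>, so that \<open>F\<close>
    below displaces every point by a vector of \<open>L\<close>.\<close>
  have "\<exists>R. linear R \<and> (\<forall>y\<in>M. R y \<in> L \<and> g' (R y) = y) \<and> range R \<subseteq> L"
  proof -
    obtain Bs where Bs: "Bs \<subseteq> M" "independent Bs" "span Bs = M"
      using basis_exists[of M] M by (metis span_eq_iff subset_antisym span_mono)
    define r where "r y = (if y \<in> Bs then (SOME x. x \<in> L \<and> g' x = y) else 0)" for y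
    have r: "r y \<in> L \<and> g' (r y) = y" if "y \<in> Bs" for y
      using someI_ex[of "\<lambda>x. x \<in> L \<and> g' x = y"] onto[of y] Bs(1) that by (auto simp: r_def)
    obtain R where R: "linear R" "\<And>x. x \<in> Bs \<Longrightarrow> R x = r x" "range R = span (r ` Bs)"
      using linear_independent_extend_subspace[OF Bs(2), of r] by metis
    have "span (r ` Bs) \<subseteq> L"
      using r L by (intro span_minimal) auto
    moreover have "g' (R y) = y" if "y \<in> M" for y
    proof -
      have "(g' \<circ> R) y = id y"
      proof (rule linear_eq_on[of _ _ y Bs])
        show "linear (g' \<circ> R)" using lin R(1) linear_compose by blast
        show "linear (id :: 'b \<Rightarrow> 'b)" by (rule linear_id)
        show "y \<in> span Bs" using that Bs(3) by simp
      qed (use R(2) r in auto)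
      then show ?thesis by simp
    qed
    ultimately show ?thesis using R by blast
  qed
  then obtain R where R: "linear R" "\<And>y. y \<in> M \<Longrightarrow> g' (R y) = y" "\<And>y. R y \<in> L"
    by (metis rangeI subset_iff)
  have blR: "bounded_linear R" using R(1) linear_conv_bounded_linear by blast
  text \<open>The map \<open>F\<close> has derivative \<open>id\<close> at \<open>x0\<close> and straightens the fibres of \<open>g\<close>:
    on \<open>L\<close> it satisfies \<open>g' (F x) = g x\<close>.\<close>
  define F where "F x = x + R (g x - g' x)" for x
  have F': "(F has_derivative (\<lambda>v. v + R (d x v - g' v))) (at x)" if "x \<in> U" for x
    unfolding F_def
    by (intro has_derivative_add has_derivative_ident bounded_linear.has_derivative[OF blR]
        has_derivative_diff d(1) that bounded_linear_imp_has_derivative)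
      (use g' in \<open>rule has_derivative_bounded_linear\<close>)
  have blF: "bounded_linear (\<lambda>v. v + R (d x v - g' v))" if "x \<in> U" for x
    using F'[OF that] by (rule has_derivative_bounded_linear)
  define f' where "f' x = Blinfun (\<lambda>v. v + R (d x v - g' v))" for x
  have c: "continuous_on U f'"
    unfolding f'_def using blF smooth_open_continuous_on[OF d(2)]
    by (intro derivative_Blinfun_continuous)
      (auto intro!: continuous_intros bounded_linear.continuous_on[OF blR])
  have oU: "open U" using g smooth_open_def by blast
  have f'ap: "blinfun_apply (f' x) = (\<lambda>v. v + R (d x v - g' v))" if "x \<in> U" for x
    unfolding f'_def using blF[OF that] by (rule bounded_linear_Blinfun_apply)
  have f'0: "blinfun_apply (f' x0) = (\<lambda>v. v)"
    using f'ap[OF x0(1)] dg linear_0[OF R(1)] by simp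
  have inv: "id_blinfun o\<^sub>L f' x0 = id_blinfun"
    by (rule blinfun_eqI) (simp add: f'0)
  have derF: "(F has_derivative blinfun_apply (f' x)) (at x)" if "x \<in> U" for x
    using F'[OF that] f'ap[OF that] by simp
  obtain U' V h h' where ift: "open U'" "U' \<subseteq> U" "x0 \<in> U'" "open V" "F x0 \<in> V" "homeomorphism U' V F h"
    "\<And>y. y \<in> V \<Longrightarrow> (h has_derivative (h' y)) (at y)"
    "\<And>y. y \<in> V \<Longrightarrow> h' y = Hilbert_Choice.inv (blinfun_apply (f'(h y)))"
    "\<And>y. y \<in> V \<Longrightarrow> bij (blinfun_apply (f'(h y)))"
    by (rule inverse_function_theorem[OF oU _ c x0(1) inv], erule derF, rule that; assumption)
  have hF: "h (F x) = x" if "x \<in> U'" for x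
    using ift(6) that homeomorphism_apply1 by metis
  have Fh: "F (h y) = y" "h y \<in> U'" if "y \<in> V" for y
    using ift(6) that homeomorphism_apply2 homeomorphism_image2 by (metis, metis imageI)
  have h'0: "h' (F x0) = (\<lambda>v. v)"
    using ift(8)[OF ift(5)] hF[OF ift(3)] f'0 by (simp add: inv_id[unfolded id_def])
  define c where "c t = h (F x0 + t *\<^sub>R k)" for t :: real
  have "c 0 = x0" using hF[OF ift(3)] by (simp add: c_def)
  moreover have "(c has_vector_derivative k) (at 0)"
  proof -
    have "((\<lambda>t. F x0 + t *\<^sub>R k) has_vector_derivative k) (at 0)"
      by (auto intro!: derivative_eq_intros simp: has_vector_derivative_def)
    moreover have "(h has_derivative h' (F x0)) (at (F x0 + 0 *\<^sub>R k))"
      using ift(7)[OF ift(5)] by simp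
    ultimately have "(h \<circ> (\<lambda>t. F x0 + t *\<^sub>R k) has_vector_derivative h' (F x0) k) (at 0)"
      by (rule vector_derivative_diff_chain_within[of _ _ _ UNIV, simplified, OF _ has_derivative_at_withinI])
    then show ?thesis by (simp add: c_def[abs_def] o_def h'0)
  qed
  moreover have "\<forall>\<^sub>F t in at 0. c t \<in> L \<and> c t \<in> U \<and> g (c t) = g x0"
  proof -
    have "((\<lambda>t. F x0 + t *\<^sub>R k) \<longlongrightarrow> F x0 + 0 *\<^sub>R k) (at 0)"
      by (intro tendsto_intros)
    then have "\<forall>\<^sub>F t in at 0. F x0 + t *\<^sub>R k \<in> V"
      using ift(4,5) by (auto intro: topological_tendstoD)
    then show ?thesis
    proof eventually_elim
      case (elim t)
      let ?y = "F x0 + t *\<^sub>R k"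
      have F0L: "F x0 \<in> L"
        unfolding F_def using x0(2) R(3) L subspace_add by blast
      have yL: "?y \<in> L"
        using F0L k(1) L subspace_add subspace_scale by blast
      have cU: "c t \<in> U" using Fh(2)[OF elim] ift(2) c_def by auto
      have Fc: "F (c t) = ?y" using Fh(1)[OF elim] c_def by simp
      \<comment> \<open>The inverse function theorem works in the whole space. The curve returns to
        \<open>L\<close> because \<open>F (c t)\<close> is in \<open>L\<close> and differs from
        \<open>c t\<close> by a value of \<open>R\<close>.\<close>
      have "c t = ?y - R (g (c t) - g' (c t))"
        using Fc by (simp add: F_def algebra_simps)
      then have cL: "c t \<in> L"
        using yL R(3) L subspace_diff by metis
      have g'F: "g' (F x) = g x" if "x \<in> U" "x \<in> L" for x
      proof -
        \<comment> \<open>\<open>R\<close> inverts \<open>g'\<close> on \<open>M\<close> only, so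
          \<open>g x - g' x\<close> must be placed in \<open>M\<close> before
          \<open>g' (F x) = g' x + (g x - g' x)\<close> can be used.\<close>
        have "g' x \<in> M"
          using derivative_in_subspace[OF g' oU x0 L M gM that(2)] .
        then have "g x - g' x \<in> M" using gM that M subspace_diff by blast
        then show ?thesis
          unfolding F_def by (simp add: linear_add[OF lin] R(2))
      qed
      have "g' ?y = g' (F x0)"
        by (simp add: linear_add[OF lin] linear_scale[OF lin] k(2))
      then have "g (c t) = g x0"
        using g'F[OF cU cL] g'F[OF x0] Fc by simp
      with cL cU show ?case by simp
    qed
  qed
  ultimately show ?thesis using that by blast
qed

lemma smooth_open_Int: "smooth_open U f \<Longrightarrow> open V \<Longrightarrow> smooth_open (U \<inter> V) f"
  using smooth_open_subset by (metis inf_le1 open_Int smooth_open_def)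

section \<open>Maps that are smooth in charts\<close>

text \<open>The domain \<open>D\<close> need not be open in a manifold: taking the intersection of a submanifold with
  the domain of an ambient chart covers smoothness on the submanifold in ambient coordinates.\<close>

definition chart_smooth ::
  "'a set \<Rightarrow> ('a \<Rightarrow> 'e::euclidean_space) \<Rightarrow> 'b set \<Rightarrow> ('b \<Rightarrow> 'f::euclidean_space) \<Rightarrow> ('a \<Rightarrow> 'b) \<Rightarrow> 'a \<Rightarrow> bool"
  where
  "chart_smooth D \<phi> V \<psi> f p \<longleftrightarrow> p \<in> D \<and>
     (\<exists>O' F. smooth_open O' F \<and> \<phi> p \<in> O' \<and> (\<forall>x\<in>D. \<phi> x \<in> O' \<longrightarrow> f x \<in> V \<and> \<psi> (f x) = F (\<phi> x)))"

text \<open>The locality condition for germs. It refers to one coordinate map, so it can be checked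
  without the topology that the atlas generates.\<close>

definition chart_nbhd :: "'a set \<Rightarrow> ('a \<Rightarrow> 'e::euclidean_space) \<Rightarrow> 'a set \<Rightarrow> 'a \<Rightarrow> bool" where
  "chart_nbhd D \<phi> W p \<longleftrightarrow> p \<in> D \<and> (\<exists>O'. open O' \<and> \<phi> p \<in> O' \<and> (\<forall>x\<in>D. \<phi> x \<in> O' \<longrightarrow> x \<in> W))"

lemma chart_smoothI:
  assumes "p \<in> D" "smooth_open O' F" "\<phi> p \<in> O'"
    "\<And>x. x \<in> D \<Longrightarrow> \<phi> x \<in> O' \<Longrightarrow> f x \<in> V \<and> \<psi> (f x) = F (\<phi> x)"
  shows "chart_smooth D \<phi> V \<psi> f p"
  using assms unfolding chart_smooth_def by blast

lemma chart_smoothE: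
  assumes "chart_smooth D \<phi> V \<psi> f p"
  obtains O' F where "p \<in> D" "smooth_open O' F" "\<phi> p \<in> O'"
    "\<And>x. x \<in> D \<Longrightarrow> \<phi> x \<in> O' \<Longrightarrow> f x \<in> V" "\<And>x. x \<in> D \<Longrightarrow> \<phi> x \<in> O' \<Longrightarrow> \<psi> (f x) = F (\<phi> x)"
  using assms unfolding chart_smooth_def by blast

lemma chart_smooth_point: "chart_smooth D \<phi> V \<psi> f p \<Longrightarrow> p \<in> D \<and> f p \<in> V"
  unfolding chart_smooth_def by blast

lemma smooth_open_linear: "bounded_linear L \<Longrightarrow> smooth_open UNIV L"
  by (simp add: smooth_open_def Ck_bounded_linear)

lemma chart_smooth_ident:
  assumes "p \<in> D" "D \<subseteq> V"
  shows "chart_smooth D \<phi> V \<phi> (\<lambda>x. x) p"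
  by (rule chart_smoothI[of _ _ UNIV "\<lambda>x. x"])
    (use assms in \<open>auto intro: smooth_open_linear bounded_linear_ident\<close>)

lemma chart_smooth_linear:
  assumes "p \<in> D" "bounded_linear L" "\<And>x. x \<in> D \<Longrightarrow> f x \<in> V \<and> \<psi> (f x) = L (\<phi> x)"
  shows "chart_smooth D \<phi> V \<psi> f p"
  by (rule chart_smoothI[of _ _ UNIV L]) (use assms in \<open>auto intro: smooth_open_linear\<close>)

lemma chart_smooth_const: "p \<in> D \<Longrightarrow> chart_smooth D \<phi> UNIV \<psi> (\<lambda>x. c) p"
  by (rule chart_smoothI[of _ _ UNIV "\<lambda>x. \<psi> c"]) (auto simp: smooth_open_def Ck_const)

lemma chart_smooth_mono:
  assumes "chart_smooth D \<phi> V \<psi> f p" "D' \<subseteq> D" "V \<subseteq> V'" "p \<in> D'"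
  shows "chart_smooth D' \<phi> V' \<psi> f p"
  using assms unfolding chart_smooth_def by blast

lemma chart_smooth_compose:
  assumes "chart_smooth D \<phi> V \<psi> f p" "chart_smooth V \<psi> Z \<zeta> g (f p)"
  shows "chart_smooth D \<phi> Z \<zeta> (\<lambda>x. g (f x)) p"
proof -
  obtain O1 F where F: "p \<in> D" "smooth_open O1 F" "\<phi> p \<in> O1" "\<And>x. x \<in> D \<Longrightarrow> \<phi> x \<in> O1 \<Longrightarrow> f x \<in> V"
    "\<And>x. x \<in> D \<Longrightarrow> \<phi> x \<in> O1 \<Longrightarrow> \<psi> (f x) = F (\<phi> x)"
    by (rule chart_smoothE[OF assms(1)]) (rule that)
  obtain O2 H where H: "smooth_open O2 H" "\<psi> (f p) \<in> O2" "\<And>y. y \<in> V \<Longrightarrow> \<psi> y \<in> O2 \<Longrightarrow> g y \<in> Z"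
    "\<And>y. y \<in> V \<Longrightarrow> \<psi> y \<in> O2 \<Longrightarrow> \<zeta> (g y) = H (\<psi> y)"
    using chart_smoothE[OF assms(2)] by metis
  show ?thesis
    by (rule chart_smoothI[OF F(1) smooth_open_compose[OF H(1) F(2)]])
      (use F H in auto)
qed

lemma chart_smooth_cong:
  assumes "chart_smooth D \<phi> V \<psi> f p" "chart_nbhd D \<phi> W p" "\<And>x. x \<in> D \<Longrightarrow> x \<in> W \<Longrightarrow> f x = g x"
  shows "chart_smooth D \<phi> V \<psi> g p"
proof -
  obtain O1 F where F: "p \<in> D" "smooth_open O1 F" "\<phi> p \<in> O1" "\<And>x. x \<in> D \<Longrightarrow> \<phi> x \<in> O1 \<Longrightarrow> f x \<in> V"
    "\<And>x. x \<in> D \<Longrightarrow> \<phi> x \<in> O1 \<Longrightarrow> \<psi> (f x) = F (\<phi> x)"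
    by (rule chart_smoothE[OF assms(1)]) (rule that)
  obtain O2 where O2: "open O2" "\<phi> p \<in> O2" "\<And>x. x \<in> D \<Longrightarrow> \<phi> x \<in> O2 \<Longrightarrow> x \<in> W"
    using assms(2) unfolding chart_nbhd_def by blast
  have "smooth_open (O1 \<inter> O2) F"
    using F(2) O2(1) by (rule smooth_open_Int)
  then show ?thesis
    by (rule chart_smoothI[OF F(1)]) (use F O2 assms(3) in \<open>auto simp flip: assms(3)\<close>)
qed

lemma chart_nbhd_Int:
  "chart_nbhd D \<phi> V p \<Longrightarrow> chart_nbhd D \<phi> W p \<Longrightarrow> chart_nbhd D \<phi> (V \<inter> W) p"
  unfolding chart_nbhd_def by (metis IntD1 IntD2 IntI open_Int)

lemma chart_nbhd_open: "p \<in> D \<Longrightarrow> open O' \<Longrightarrow> \<phi> p \<in> O' \<Longrightarrow> chart_nbhd D \<phi> {x. \<phi> x \<in> O'} p"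
  unfolding chart_nbhd_def by blast

lemma chart_nbhd_mono: "chart_nbhd D \<phi> W p \<Longrightarrow> W \<inter> D \<subseteq> W' \<Longrightarrow> D' \<subseteq> D \<Longrightarrow> p \<in> D' \<Longrightarrow> chart_nbhd D' \<phi> W' p"
  unfolding chart_nbhd_def by blast

text \<open>Continuity is contained in \<open>chart_smooth\<close>: the function \<open>F\<close>
  that represents \<open>f\<close> is continuous, so the preimage of an open set of coordinates is
  open.\<close>

lemma chart_smooth_nbhd:
  assumes "chart_smooth D \<phi> V \<psi> f p" "chart_nbhd V \<psi> W (f p)"
  shows "chart_nbhd D \<phi> {x. f x \<in> V \<inter> W} p"
proof -
  obtain O1 F where F: "p \<in> D" "smooth_open O1 F" "\<phi> p \<in> O1" "\<And>x. x \<in> D \<Longrightarrow> \<phi> x \<in> O1 \<Longrightarrow> f x \<in> V"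
    "\<And>x. x \<in> D \<Longrightarrow> \<phi> x \<in> O1 \<Longrightarrow> \<psi> (f x) = F (\<phi> x)"
    by (rule chart_smoothE[OF assms(1)]) (rule that)
  obtain O2 where O2: "open O2" "\<psi> (f p) \<in> O2" "\<And>x. x \<in> V \<Longrightarrow> \<psi> x \<in> O2 \<Longrightarrow> x \<in> W"
    using assms(2) unfolding chart_nbhd_def by blast
  have "open {y \<in> O1. F y \<in> O2}"
    using smooth_open_vimage[OF F(2) O2(1)] .
  moreover have "\<phi> p \<in> {y \<in> O1. F y \<in> O2}"
    using F(1,3,5) O2(2) by auto
  moreover have "f x \<in> V \<inter> W" if "x \<in> D" "\<phi> x \<in> {y \<in> O1. F y \<in> O2}" for x
    using F(4,5) O2(3) that by auto
  ultimately show ?thesis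
    using F(1) unfolding chart_nbhd_def by blast
qed

lemma chart_smooth_restrict_codomain:
  assumes "chart_smooth D \<phi> V \<psi> f p" "chart_nbhd V \<psi> W (f p)"
  shows "chart_smooth D \<phi> (V \<inter> W) \<psi> f p"
proof -
  have "f p \<in> V"
    using assms(1) chart_smooth_point by metis
  obtain O2 where O2: "open O2" "\<psi> (f p) \<in> O2" "\<And>x. x \<in> V \<Longrightarrow> \<psi> x \<in> O2 \<Longrightarrow> x \<in> W"
    using assms(2) unfolding chart_nbhd_def by blast
  have "smooth_open O2 (\<lambda>x. x)"
    using smooth_open_linear[OF bounded_linear_ident] O2(1) by (rule smooth_open_subset) simp
  then have "chart_smooth V \<psi> (V \<inter> W) \<psi> (\<lambda>x. x) (f p)"
    by (rule chart_smoothI[OF \<open>f p \<in> V\<close>]) (use O2 in auto)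
  from chart_smooth_compose[OF assms(1) this] show ?thesis .
qed

lemma chart_smooth_Pair:
  fixes f :: "'a \<Rightarrow> 'b::euclidean_space" and g :: "'a \<Rightarrow> 'c::euclidean_space"
  assumes "chart_smooth D \<phi> UNIV id f p" "chart_smooth D \<phi> UNIV id g p"
  shows "chart_smooth D \<phi> UNIV id (\<lambda>x. (f x, g x)) p"
proof -
  obtain O1 F where F: "p \<in> D" "smooth_open O1 F" "\<phi> p \<in> O1"
    "\<And>x. x \<in> D \<Longrightarrow> \<phi> x \<in> O1 \<Longrightarrow> id (f x) = F (\<phi> x)"
    using chart_smoothE[OF assms(1)] by metis
  obtain O2 H where H: "smooth_open O2 H" "\<phi> p \<in> O2"
    "\<And>x. x \<in> D \<Longrightarrow> \<phi> x \<in> O2 \<Longrightarrow> id (g x) = H (\<phi> x)"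
    using chart_smoothE[OF assms(2)] by metis
  have "smooth_open (O1 \<inter> O2) F" "smooth_open (O2 \<inter> O1) H"
    using F(2) H(1) smooth_open_Int unfolding smooth_open_def by blast+
  then have "smooth_open (O1 \<inter> O2) (\<lambda>y. (F y, H y))"
    by (simp add: smooth_open_def Ck_Pair Int_commute)
  then show ?thesis
    by (rule chart_smoothI[OF F(1)]) (use F H in auto)
qed

lemma chart_smooth_outer:
  fixes f :: "'a \<Rightarrow> 'b::euclidean_space" and H :: "'b \<Rightarrow> 'c::euclidean_space"
  assumes "chart_smooth D \<phi> UNIV id f p" "smooth_open O' H" "f p \<in> O'"
  shows "chart_smooth D \<phi> UNIV id (\<lambda>x. H (f x)) p"
  by (rule chart_smooth_compose[OF assms(1)], rule chart_smoothI[OF _ assms(2)]) (use assms in auto)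

lemma chart_smooth_add:
  fixes f g :: "'a \<Rightarrow> 'b::euclidean_space"
  assumes "chart_smooth D \<phi> UNIV id f p" "chart_smooth D \<phi> UNIV id g p"
  shows "chart_smooth D \<phi> UNIV id (\<lambda>x. f x + g x) p"
proof -
  have "bounded_linear (\<lambda>y::'b \<times> 'b. fst y + snd y)"
    by (intro bounded_linear_add bounded_linear_fst bounded_linear_snd)
  from chart_smooth_outer[OF chart_smooth_Pair[OF assms] smooth_open_linear[OF this]]
  show ?thesis by simp
qed

lemma chart_smooth_mult:
  fixes f g :: "'a \<Rightarrow> real"
  assumes "chart_smooth D \<phi> UNIV id f p" "chart_smooth D \<phi> UNIV id g p"
  shows "chart_smooth D \<phi> UNIV id (\<lambda>x. f x * g x) p"
proof -
  have "smooth_open UNIV (\<lambda>y::real \<times> real. fst y * snd y)"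
    by (intro smooth_open_mult smooth_open_linear bounded_linear_fst bounded_linear_snd)
  from chart_smooth_outer[OF chart_smooth_Pair[OF assms] this] show ?thesis by simp
qed


section \<open>Atlases\<close>

lemma smooth_on_iff:
  "smooth_on S f \<longleftrightarrow> (\<forall>x\<in>S. \<exists>U g. smooth_open U g \<and> x \<in> U \<and> (\<forall>y\<in>S \<inter> U. g y = f y))"
  unfolding smooth_on_def smooth_open_def by (intro ball_cong refl ex_cong1) auto

text \<open>The part of the definition of a manifold that the calculus of smooth maps depends on; it
  also holds for the atlas of a submanifold.\<close>

definition compatible_atlas :: "('a, 'e::euclidean_space) atlas \<Rightarrow> bool" where
  "compatible_atlas M \<longleftrightarrow> (\<forall>(U, \<phi>)\<in>M. inj_on \<phi> U) \<and>
     (\<forall>(U, \<phi>)\<in>M. \<forall>(V, \<psi>)\<in>M. \<forall>p\<in>U \<inter> V. chart_smooth U \<phi> V \<psi> (\<lambda>x. x) p)"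

lemma compatible_atlas_inj: "compatible_atlas M \<Longrightarrow> (U, \<phi>) \<in> M \<Longrightarrow> inj_on \<phi> U"
  unfolding compatible_atlas_def by blast

lemma compatible_atlas_change:
  "compatible_atlas M \<Longrightarrow> (U, \<phi>) \<in> M \<Longrightarrow> (V, \<psi>) \<in> M \<Longrightarrow> p \<in> U \<Longrightarrow> p \<in> V \<Longrightarrow>
    chart_smooth U \<phi> V \<psi> (\<lambda>x. x) p"
  unfolding compatible_atlas_def by blast

lemma openin_image_nbhd:
  assumes "openin (top_of_set (\<phi> ` U)) (\<phi> ` (U \<inter> W))" "inj_on \<phi> U" "p \<in> U" "p \<in> W"
  shows "chart_nbhd U \<phi> W p"
proof -
  obtain O' where O': "open O'" "\<phi> ` (U \<inter> W) = \<phi> ` U \<inter> O'"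
    using assms(1) unfolding openin_open by blast
  have "x \<in> W" if "x \<in> U" "\<phi> x \<in> O'" for x
  proof -
    have "\<phi> x \<in> \<phi> ` (U \<inter> W)" using O'(2) that by blast
    then show ?thesis using that(1) assms(2) by (auto dest: inj_onD)
  qed
  moreover have "\<phi> p \<in> O'" using O'(2) assms(3,4) by blast
  ultimately show ?thesis
    using O'(1) assms(3) unfolding chart_nbhd_def by blast
qed

lemma mopen_nbhd:
  assumes "mopen M W" "(U, \<phi>) \<in> M" "inj_on \<phi> U" "p \<in> U" "p \<in> W"
  shows "chart_nbhd U \<phi> W p"
  using assms by (intro openin_image_nbhd) (auto simp: mopen_def)

lemma mopenI:
  assumes "W \<subseteq> points M" "\<And>U \<phi> p. (U, \<phi>) \<in> M \<Longrightarrow> p \<in> U \<Longrightarrow> p \<in> W \<Longrightarrow> chart_nbhd U \<phi> W p"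
  shows "mopen M W"
proof -
  have "openin (top_of_set (\<phi> ` U)) (\<phi> ` (U \<inter> W))" if M: "(U, \<phi>) \<in> M" for U \<phi>
  proof (subst openin_subopen, intro ballI)
    fix y assume "y \<in> \<phi> ` (U \<inter> W)"
    then obtain p where p: "p \<in> U" "p \<in> W" "y = \<phi> p" by blast
    obtain O' where "open O'" "\<phi> p \<in> O'" "\<And>x. x \<in> U \<Longrightarrow> \<phi> x \<in> O' \<Longrightarrow> x \<in> W"
      using assms(2)[OF M p(1,2)] unfolding chart_nbhd_def by blast
    then show "\<exists>T. openin (top_of_set (\<phi> ` U)) T \<and> y \<in> T \<and> T \<subseteq> \<phi> ` (U \<inter> W)"
      using p by (intro exI[of _ "\<phi> ` U \<inter> O'"]) (auto simp: openin_open_Int)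
  qed
  then show ?thesis using assms(1) unfolding mopen_def by blast
qed

lemma manifold_compatible_atlas:
  assumes "manifold M"
  shows "compatible_atlas M"
proof -
  have inj: "inj_on \<phi> U" if "(U, \<phi>) \<in> M" for U \<phi>
    using assms that unfolding manifold_def by fast
  have "chart_smooth U \<phi> V \<psi> (\<lambda>x. x) p" if UV: "(U, \<phi>) \<in> M" "(V, \<psi>) \<in> M" "p \<in> U" "p \<in> V" for U \<phi> V \<psi> p
  proof -
    have 1: "openin (top_of_set (\<phi> ` U)) (\<phi> ` (U \<inter> V))"
      and 2: "smooth_on (\<phi> ` (U \<inter> V)) (\<lambda>y. \<psi> (inv_into U \<phi> y))"
      using assms UV(1,2) unfolding manifold_def by fast+
    obtain O2 where O2: "open O2" "\<phi> p \<in> O2" "\<And>x. x \<in> U \<Longrightarrow> \<phi> x \<in> O2 \<Longrightarrow> x \<in> V"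
      using openin_image_nbhd[OF 1 inj[OF UV(1)] UV(3,4)] unfolding chart_nbhd_def by blast
    obtain O1 F where F: "smooth_open O1 F" "\<phi> p \<in> O1"
      "\<And>y. y \<in> \<phi> ` (U \<inter> V) \<Longrightarrow> y \<in> O1 \<Longrightarrow> F y = \<psi> (inv_into U \<phi> y)"
      using 2 UV(3,4) unfolding smooth_on_iff by (metis IntI imageI)
    have "smooth_open (O1 \<inter> O2) F"
      using F(1) O2(1) by (rule smooth_open_Int)
    then show ?thesis
      by (rule chart_smoothI[OF UV(3)]) (use F O2 inj[OF UV(1)] in auto)
  qed
  with inj show ?thesis unfolding compatible_atlas_def by blast
qed

text \<open>Only injectivity of the charts is assumed, a condition that passes at once to the
  restricted atlas \<open>open_sub M W\<close>.\<close>

lemma smooth_atE: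
  assumes "smooth_at M N f p" "\<And>U \<phi>. (U, \<phi>) \<in> M \<Longrightarrow> inj_on \<phi> U"
  obtains U \<phi> V \<psi> where "(U, \<phi>) \<in> M" "(V, \<psi>) \<in> N" "chart_smooth U \<phi> V \<psi> f p"
proof -
  obtain U \<phi> V \<psi> W where W: "(U, \<phi>) \<in> M" "(V, \<psi>) \<in> N" "mopen M W" "p \<in> W" "W \<subseteq> U" "f ` W \<subseteq> V"
    "smooth_on (\<phi> ` W) (\<lambda>y. \<psi> (f (inv_into U \<phi> y)))"
    using assms(1) unfolding smooth_at_def by fast
  have pU: "p \<in> U" using W by blast
  obtain O2 where O2: "open O2" "\<phi> p \<in> O2" "\<And>x. x \<in> U \<Longrightarrow> \<phi> x \<in> O2 \<Longrightarrow> x \<in> W"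
    using mopen_nbhd[OF W(3,1) assms(2)[OF W(1)] pU W(4)] unfolding chart_nbhd_def by blast
  obtain O1 F where F: "smooth_open O1 F" "\<phi> p \<in> O1"
    "\<And>y. y \<in> \<phi> ` W \<Longrightarrow> y \<in> O1 \<Longrightarrow> F y = \<psi> (f (inv_into U \<phi> y))"
    using W(7,4) unfolding smooth_on_iff by (metis IntI imageI)
  have "smooth_open (O1 \<inter> O2) F"
    using F(1) O2(1) by (rule smooth_open_Int)
  then have "chart_smooth U \<phi> V \<psi> f p"
    by (rule chart_smoothI[OF pU]) (use F O2 W(6) assms(2)[OF W(1)] in auto)
  with W that show ?thesis by blast
qed

lemma chart_smooth_transfer:
  assumes "compatible_atlas M" "compatible_atlas N"
    and "(U, \<phi>) \<in> M" "(V, \<psi>) \<in> N" "chart_smooth U \<phi> V \<psi> f p"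
    and "(U', \<phi>') \<in> M" "p \<in> U'" "(V', \<psi>') \<in> N" "f p \<in> V'"
  shows "chart_smooth U' \<phi>' V' \<psi>' f p"
proof -
  have p: "p \<in> U" "f p \<in> V"
    using assms(5) chart_smooth_point by metis+
  show ?thesis
    using chart_smooth_compose[OF compatible_atlas_change[OF assms(1,6,3,7) p(1)]
        chart_smooth_compose[OF assms(5) compatible_atlas_change[OF assms(2,4,8) p(2) assms(9)]]]
    by simp
qed

lemma smooth_at_chart_smooth:
  assumes "smooth_at M N f p" "compatible_atlas M" "compatible_atlas N"
    and "(U, \<phi>) \<in> M" "p \<in> U" "(V, \<psi>) \<in> N" "f p \<in> V"
  shows "chart_smooth U \<phi> V \<psi> f p"
proof -
  obtain U' \<phi>' V' \<psi>' where c: "(U', \<phi>') \<in> M" "(V', \<psi>') \<in> N" "chart_smooth U' \<phi>' V' \<psi>' f p"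
    by (rule smooth_atE[OF assms(1)], erule compatible_atlas_inj[OF assms(2)]) (rule that)
  show ?thesis
    by (intro chart_smooth_transfer[OF assms(2,3) c]) fact+
qed

lemma chart_smooth_smooth_at:
  assumes M: "compatible_atlas M" and U: "(U, \<phi>) \<in> M" and V: "(V, \<psi>) \<in> N"
    and f: "chart_smooth U \<phi> V \<psi> f p"
  shows "smooth_at M N f p"
proof -
  obtain O' F where F: "p \<in> U" "smooth_open O' F" "\<phi> p \<in> O'" "\<And>x. x \<in> U \<Longrightarrow> \<phi> x \<in> O' \<Longrightarrow> f x \<in> V"
    "\<And>x. x \<in> U \<Longrightarrow> \<phi> x \<in> O' \<Longrightarrow> \<psi> (f x) = F (\<phi> x)"
    by (rule chart_smoothE[OF f]) (rule that)
  have inj: "inj_on \<phi> U" using compatible_atlas_inj M U by blast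
  \<comment> \<open>\<open>smooth_at\<close> asks for a set that is open in the manifold. The points
    with coordinate in \<open>O'\<close> form one, because all chart changes are continuous.\<close>
  let ?W = "{x \<in> U. \<phi> x \<in> O'}"
  have "mopen M ?W"
  proof (rule mopenI)
    show "?W \<subseteq> points M" using U by (auto simp: points_def)
    fix U1 \<phi>1 q assume q: "(U1, \<phi>1) \<in> M" "q \<in> U1" "q \<in> ?W"
    have "chart_nbhd U1 \<phi>1 {x. x \<in> U \<inter> {x. \<phi> x \<in> O'}} q"
      by (rule chart_smooth_nbhd[OF compatible_atlas_change[OF M q(1) U]])
        (use q F(2) in \<open>auto intro!: chart_nbhd_open simp: smooth_open_def\<close>)
    then show "chart_nbhd U1 \<phi>1 ?W q"
      by (rule chart_nbhd_mono) (use q in auto)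
  qed
  moreover have "smooth_on (\<phi> ` ?W) (\<lambda>y. \<psi> (f (inv_into U \<phi> y)))"
    unfolding smooth_on_iff using F inj by (auto intro!: exI[of _ O'] exI[of _ F])
  ultimately show ?thesis
    unfolding smooth_at_def using U V F by (intro bexI[OF _ U] bexI[OF _ V]) auto
qed

lemma compatible_flat_atlas: "compatible_atlas (flat_atlas W)"
  unfolding compatible_atlas_def flat_atlas_def by (auto intro: chart_smooth_ident)

lemma smooth_near_iff:
  assumes "compatible_atlas M" "(U, \<phi>) \<in> M" "p \<in> U"
  shows "f \<in> smooth_near M p \<longleftrightarrow> chart_smooth U \<phi> UNIV id f p"
proof
  assume "f \<in> smooth_near M p"
  then show "chart_smooth U \<phi> UNIV id f p"
    using smooth_at_chart_smooth[OF _ assms(1) compatible_flat_atlas assms(2,3)]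
    by (auto simp: smooth_near_def flat_atlas_def)
next
  assume "chart_smooth U \<phi> UNIV id f p"
  then show "f \<in> smooth_near M p"
    using chart_smooth_smooth_at[OF assms(1,2), of UNIV id "flat_atlas UNIV"]
    by (simp add: smooth_near_def flat_atlas_def)
qed

lemma smooth_near_points:
  assumes "f \<in> smooth_near M p"
  shows "p \<in> points M"
  using assms unfolding smooth_near_def smooth_at_def mopen_def by blast

lemma pointsE:
  assumes "p \<in> points M"
  obtains U \<phi> where "(U, \<phi>) \<in> M" "p \<in> U"
  using assms unfolding points_def by fast

lemma smooth_near_compose:
  assumes "compatible_atlas M" "compatible_atlas N" "smooth_at M N f p" "g \<in> smooth_near N (f p)"
  shows "(\<lambda>x. g (f x)) \<in> smooth_near M p"
proof -
  obtain V \<psi> where V: "(V, \<psi>) \<in> N" "f p \<in> V"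
    using smooth_near_points[OF assms(4)] pointsE by metis
  obtain U \<phi> V' \<psi>' where U: "(U, \<phi>) \<in> M" "(V', \<psi>') \<in> N" "chart_smooth U \<phi> V' \<psi>' f p"
    by (rule smooth_atE[OF assms(3)], erule compatible_atlas_inj[OF assms(1)]) (rule that)
  then have p: "p \<in> U" using chart_smooth_point by metis
  have "chart_smooth U \<phi> V \<psi> f p"
    by (rule smooth_at_chart_smooth[OF assms(3,1,2) U(1) p V])
  moreover have "chart_smooth V \<psi> UNIV id g (f p)"
    using assms(4) smooth_near_iff[OF assms(2) V] by blast
  ultimately have "chart_smooth U \<phi> UNIV id (\<lambda>x. g (f x)) p"
    by (rule chart_smooth_compose)
  then show ?thesis
    using smooth_near_iff[OF assms(1) U(1) p] by blast
qed

section \<open>Product atlases and submanifold atlases\<close>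

lemma chart_smooth_map_prod:
  fixes \<phi>1 :: "'a \<Rightarrow> 'e1::euclidean_space" and \<phi>2 :: "'b \<Rightarrow> 'e2::euclidean_space"
  assumes "chart_smooth U1 \<phi>1 V1 \<psi>1 (\<lambda>x. x) p" "chart_smooth U2 \<phi>2 V2 \<psi>2 (\<lambda>x. x) q"
  shows "chart_smooth (U1 \<times> U2) (map_prod \<phi>1 \<phi>2) (V1 \<times> V2) (map_prod \<psi>1 \<psi>2) (\<lambda>x. x) (p, q)"
proof -
  obtain O1 F where F: "p \<in> U1" "smooth_open O1 F" "\<phi>1 p \<in> O1" "\<And>x. x \<in> U1 \<Longrightarrow> \<phi>1 x \<in> O1 \<Longrightarrow> x \<in> V1"
    "\<And>x. x \<in> U1 \<Longrightarrow> \<phi>1 x \<in> O1 \<Longrightarrow> \<psi>1 x = F (\<phi>1 x)"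
    by (rule chart_smoothE[OF assms(1)]) (rule that)
  obtain O2 H where H: "q \<in> U2" "smooth_open O2 H" "\<phi>2 q \<in> O2" "\<And>x. x \<in> U2 \<Longrightarrow> \<phi>2 x \<in> O2 \<Longrightarrow> x \<in> V2"
    "\<And>x. x \<in> U2 \<Longrightarrow> \<phi>2 x \<in> O2 \<Longrightarrow> \<psi>2 x = H (\<phi>2 x)"
    by (rule chart_smoothE[OF assms(2)]) (rule that)
  have "smooth_open {y \<in> UNIV. fst y \<in> O1} (\<lambda>y::'e1 \<times> 'e2. F (fst y))"
    by (rule smooth_open_compose[OF F(2) smooth_open_linear[OF bounded_linear_fst]])
  moreover have "smooth_open {y \<in> UNIV. snd y \<in> O2} (\<lambda>y::'e1 \<times> 'e2. H (snd y))"
    by (rule smooth_open_compose[OF H(2) smooth_open_linear[OF bounded_linear_snd]])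
  moreover have o: "open (O1 \<times> O2)"
    using F(2) H(2) by (auto simp: smooth_open_def intro: open_Times)
  ultimately have "smooth_open (O1 \<times> O2) (\<lambda>y. F (fst y))" "smooth_open (O1 \<times> O2) (\<lambda>y. H (snd y))"
    by (auto intro: smooth_open_subset)
  then have "smooth_open (O1 \<times> O2) (\<lambda>y. (F (fst y), H (snd y)))"
    by (simp add: smooth_open_def Ck_Pair)
  then show ?thesis
    by (rule chart_smoothI[rotated]) (use F H in auto)
qed

lemma compatible_prod_atlas:
  assumes "compatible_atlas M" "compatible_atlas N"
  shows "compatible_atlas (prod_atlas M N)"
  unfolding compatible_atlas_def
proof (intro conjI ballI; clarify)
  fix U \<phi> assume "(U, \<phi>) \<in> prod_atlas M N"
  then show "inj_on \<phi> U"
    using compatible_atlas_inj[OF assms(1)] compatible_atlas_inj[OF assms(2)]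
    by (auto simp: prod_atlas_def inj_on_def)
next
  fix U V \<phi> \<psi> a b
  assume "(U, \<phi>) \<in> prod_atlas M N" "(V, \<psi>) \<in> prod_atlas M N" "(a, b) \<in> U" "(a, b) \<in> V"
  then show "chart_smooth U \<phi> V \<psi> (\<lambda>x. x) (a, b)"
    using compatible_atlas_change[OF assms(1)] compatible_atlas_change[OF assms(2)]
    by (auto simp: prod_atlas_def intro!: chart_smooth_map_prod)
qed

text \<open>The bridge between intrinsic charts of a submanifold and ambient coordinates. One
  direction comes from the local smooth extension of \<open>\<phi>\<close> to \<open>M\<close>, the
  other from smoothness of the inverse of \<open>\<phi>\<close> as a map into \<open>M\<close>; both
  are clauses of \<open>sub_atlas\<close>.\<close>

lemma sub_atlas_charts:
  fixes M :: "('a, 'e::euclidean_space) atlas"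
  assumes M: "compatible_atlas M" and V: "(V, \<phi>) \<in> sub_atlas M S" "q \<in> V" and U: "(U, \<kappa>) \<in> M" "q \<in> U"
  shows "chart_smooth (S \<inter> U) \<kappa> V \<phi> (\<lambda>x. x) q" "chart_smooth V \<phi> (S \<inter> U) \<kappa> (\<lambda>x. x) q"
proof -
  have V': "\<exists>W. mopen M W \<and> V = S \<inter> W" "inj_on \<phi> V"
    "\<forall>p\<in>V. \<exists>W \<Phi>. mopen M W \<and> p \<in> W \<and> smooth_map (open_sub M W) (flat_atlas UNIV) \<Phi> \<and>
           (\<forall>x\<in>V \<inter> W. \<Phi> x = \<phi> x)"
    "smooth_map (flat_atlas (\<phi> ` V)) M (inv_into V \<phi>)"
    using V(1) unfolding sub_atlas_def by blast+
  obtain W where W: "mopen M W" "V = S \<inter> W" using V'(1) by blast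
  obtain W' \<Phi> where W': "mopen M W'" "q \<in> W'" "smooth_map (open_sub M W') (flat_atlas UNIV) \<Phi>"
      "\<And>x. x\<in>V \<Longrightarrow> x \<in> W' \<Longrightarrow> \<Phi> x = \<phi> x"
    using V'(3) V(2) by blast
  have injU: "inj_on \<kappa> U" using compatible_atlas_inj M U(1) by blast
  have qS: "q \<in> S" using V(2) W(2) by blast
  have "q \<in> points (open_sub M W')"
    using U W'(2) by (force simp: points_def open_sub_def)
  then have "smooth_at (open_sub M W') (flat_atlas UNIV) \<Phi> q"
    using W'(3) smooth_map_def by metis
  moreover have "inj_on \<phi> U" if "(U, \<phi>) \<in> open_sub M W'" for U \<phi>
    using that compatible_atlas_inj[OF M] by (auto simp: open_sub_def intro: inj_on_subset)
  ultimately obtain U2 \<kappa>1 where U2: "(U2, \<kappa>1) \<in> open_sub M W'" "chart_smooth U2 \<kappa>1 UNIV id \<Phi> q"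
    by (auto simp: flat_atlas_def elim!: smooth_atE)
  then obtain U1 where U1: "(U1, \<kappa>1) \<in> M" "U2 = U1 \<inter> W'"
    by (auto simp: open_sub_def)
  have q1: "q \<in> U1" using U2(2) U1(2) chart_smooth_point by fast
  have inj1: "inj_on \<kappa>1 U1" using compatible_atlas_inj M U1(1) by blast
  \<comment> \<open>The extension \<open>\<Phi>\<close> is smooth in some chart
    \<open>\<kappa>1\<close> of its own; a chart change carries this over to the prescribed chart
    \<open>\<kappa>\<close>.\<close>
  have "chart_smooth U \<kappa> U1 \<kappa>1 (\<lambda>x. x) q"
    by (rule compatible_atlas_change[OF M U(1) U1(1) U(2) q1])
  then have "chart_smooth U \<kappa> U2 \<kappa>1 (\<lambda>x. x) q"
    unfolding U1(2) by (rule chart_smooth_restrict_codomain) (rule mopen_nbhd[OF W'(1) U1(1) inj1 q1 W'(2)])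
  from chart_smooth_compose[OF this U2(2)] have "chart_smooth U \<kappa> UNIV id \<Phi> q" .
  then have "chart_smooth (S \<inter> U) \<kappa> UNIV id \<Phi> q"
    by (rule chart_smooth_mono) (use qS U(2) in auto)
  \<comment> \<open>For points of \<open>S\<close> near \<open>q\<close>, being in \<open>W\<close>
    means being in \<open>V\<close>, and being in \<open>W'\<close> as well makes
    \<open>\<Phi>\<close> agree with \<open>\<phi>\<close>.\<close>
  moreover have n: "chart_nbhd (S \<inter> U) \<kappa> (W \<inter> W') q"
    by (rule chart_nbhd_mono[OF chart_nbhd_Int[OF mopen_nbhd[OF W(1) U(1) injU] mopen_nbhd[OF W'(1) U(1) injU]]])
      (use U(2) V(2) W W'(2) in auto)
  ultimately have "chart_smooth (S \<inter> U) \<kappa> UNIV id \<phi> q"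
    by (rule chart_smooth_cong) (use W(2) W'(4) in auto)
  then obtain O1 F where F: "smooth_open O1 F" "\<kappa> q \<in> O1" "\<And>x. x \<in> S \<inter> U \<Longrightarrow> \<kappa> x \<in> O1 \<Longrightarrow> id (\<phi> x) = F (\<kappa> x)"
    using chart_smoothE by metis
  obtain O2 where O2: "open O2" "\<kappa> q \<in> O2" "\<And>x. x \<in> S \<inter> U \<Longrightarrow> \<kappa> x \<in> O2 \<Longrightarrow> x \<in> W"
    using n unfolding chart_nbhd_def by blast
  have "smooth_open (O1 \<inter> O2) F"
    using F(1) O2(1) by (rule smooth_open_Int)
  then show "chart_smooth (S \<inter> U) \<kappa> V \<phi> (\<lambda>x. x) q"
    by (rule chart_smoothI[rotated]) (use F(2,3) O2(2,3) qS U(2) W(2) in auto)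
  have "\<phi> q \<in> points (flat_atlas (\<phi> ` V))"
    using V(2) by (simp add: points_def flat_atlas_def)
  then have sm: "smooth_at (flat_atlas (\<phi> ` V)) M (inv_into V \<phi>) (\<phi> q)"
    using V'(4) smooth_map_def by metis
  have "chart_smooth (\<phi> ` V) id U \<kappa> (inv_into V \<phi>) (\<phi> q)"
    by (rule smooth_at_chart_smooth[OF sm compatible_flat_atlas M])
      (use V(2) V'(2) U in \<open>auto simp: flat_atlas_def\<close>)
  then obtain O3 H where H: "smooth_open O3 H" "\<phi> q \<in> O3"
    "\<And>y. y \<in> \<phi> ` V \<Longrightarrow> y \<in> O3 \<Longrightarrow> inv_into V \<phi> y \<in> U \<and> \<kappa> (inv_into V \<phi> y) = H y"
    unfolding chart_smooth_def by (metis id_apply)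
  show "chart_smooth V \<phi> (S \<inter> U) \<kappa> (\<lambda>x. x) q"
    by (rule chart_smoothI[where O' = O3 and F = H]) (use H V V'(2) W(2) in force)+
qed

lemma sub_atlas_chart_subset:
  assumes "(V, \<phi>) \<in> sub_atlas M S"
  shows "V \<subseteq> S \<inter> points M"
proof -
  have "\<exists>W. mopen M W \<and> V = S \<inter> W"
    using assms unfolding sub_atlas_def by blast
  then obtain W where "mopen M W" "V = S \<inter> W"
    by blast
  moreover from this have "W \<subseteq> points M"
    unfolding mopen_def by simp
  ultimately show ?thesis by blast
qed

text \<open>A change between two submanifold charts factors through an ambient chart.\<close>

lemma compatible_sub_atlas:
  assumes M: "compatible_atlas M"
  shows "compatible_atlas (sub_atlas M S)"
proof -
  have "chart_smooth U \<phi> V \<psi> (\<lambda>x. x) p"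
    if UV: "(U, \<phi>) \<in> sub_atlas M S" "(V, \<psi>) \<in> sub_atlas M S" "p \<in> U" "p \<in> V" for U \<phi> V \<psi> p
  proof -
    obtain Z \<kappa> where Z: "(Z, \<kappa>) \<in> M" "p \<in> Z"
      by (rule pointsE[of p M]) (use sub_atlas_chart_subset[OF UV(1)] UV(3) in blast)
    show ?thesis
      using chart_smooth_compose[OF sub_atlas_charts(2)[OF M UV(1,3) Z] sub_atlas_charts(1)[OF M UV(2,4) Z]] .
  qed
  moreover have "inj_on \<phi> U" if "(U, \<phi>) \<in> sub_atlas M S" for U \<phi>
    using that unfolding sub_atlas_def by blast
  ultimately show ?thesis unfolding compatible_atlas_def by blast
qed

lemma smooth_near_sub_atlas_iff:
  assumes M: "compatible_atlas M" and q: "q \<in> points (sub_atlas M S)" and U: "(U, \<kappa>) \<in> M" "q \<in> U"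
  shows "f \<in> smooth_near (sub_atlas M S) q \<longleftrightarrow> chart_smooth (S \<inter> U) \<kappa> UNIV id f q"
proof -
  obtain V \<phi> where V: "(V, \<phi>) \<in> sub_atlas M S" "q \<in> V"
    by (rule pointsE[OF q])
  show ?thesis
    unfolding smooth_near_iff[OF compatible_sub_atlas[OF M] V]
    using chart_smooth_compose[OF sub_atlas_charts(1)[OF M V U]]
      chart_smooth_compose[OF sub_atlas_charts(2)[OF M V U]] by blast
qed

section \<open>Derivations\<close>

lemma smooth_near_const: "compatible_atlas M \<Longrightarrow> p \<in> points M \<Longrightarrow> (\<lambda>x. c) \<in> smooth_near M p"
  by (erule pointsE) (simp add: smooth_near_iff chart_smooth_const)

lemma smooth_near_add:
  assumes "compatible_atlas M" "f \<in> smooth_near M p" "g \<in> smooth_near M p"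
  shows "(\<lambda>x. f x + g x) \<in> smooth_near M p"
  by (rule pointsE[OF smooth_near_points[OF assms(2)]])
    (use assms in \<open>simp add: smooth_near_iff chart_smooth_add\<close>)

lemma smooth_near_mult:
  assumes "compatible_atlas M" "f \<in> smooth_near M p" "g \<in> smooth_near M p"
  shows "(\<lambda>x. f x * g x) \<in> smooth_near M p"
  by (rule pointsE[OF smooth_near_points[OF assms(2)]])
    (use assms in \<open>simp add: smooth_near_iff chart_smooth_mult\<close>)

lemma smooth_near_cmult:
  assumes "compatible_atlas M" "f \<in> smooth_near M p"
  shows "(\<lambda>x. c * f x) \<in> smooth_near M p"
  using smooth_near_mult[OF assms(1) smooth_near_const[OF assms(1) smooth_near_points[OF assms(2)]] assms(2)] .

lemma smooth_near_sum:
  assumes "compatible_atlas M" "p \<in> points M" "\<And>i. i \<in> I \<Longrightarrow> f i \<in> smooth_near M p"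
  shows "(\<lambda>x. \<Sum>i\<in>I. f i x) \<in> smooth_near M p"
  using assms(3)
  by (induction I rule: infinite_finite_induct)
    (simp_all add: smooth_near_const smooth_near_add assms(1,2))

lemma smooth_near_cong:
  assumes "compatible_atlas M" "(U, \<phi>) \<in> M" "chart_nbhd U \<phi> W p"
    "\<And>x. x \<in> U \<Longrightarrow> x \<in> W \<Longrightarrow> f x = g x" "f \<in> smooth_near M p"
  shows "g \<in> smooth_near M p"
proof -
  have "p \<in> U" using assms(3) by (simp add: chart_nbhd_def)
  note near = smooth_near_iff[OF assms(1,2) this]
  show ?thesis
    using assms(5) unfolding near by (rule chart_smooth_cong[OF _ assms(3,4)])
qed

lemma tangent_add:
  "X \<in> tangent M p \<Longrightarrow> f \<in> smooth_near M p \<Longrightarrow> g \<in> smooth_near M p \<Longrightarrow> X (\<lambda>x. f x + g x) = X f + X g"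
  by (simp add: tangent_def)

lemma tangent_mult:
  "X \<in> tangent M p \<Longrightarrow> f \<in> smooth_near M p \<Longrightarrow> g \<in> smooth_near M p \<Longrightarrow>
    X (\<lambda>x. f x * g x) = f p * X g + g p * X f"
  by (simp add: tangent_def)

lemma tangent_cmult: "X \<in> tangent M p \<Longrightarrow> f \<in> smooth_near M p \<Longrightarrow> X (\<lambda>x. c * f x) = c * X f"
  by (simp add: tangent_def)

lemma tangent_outside: "X \<in> tangent M p \<Longrightarrow> f \<notin> smooth_near M p \<Longrightarrow> X f = 0"
  by (simp add: tangent_def)

lemma tangent_const:
  assumes "compatible_atlas M" "p \<in> points M" "X \<in> tangent M p"
  shows "X (\<lambda>x. c) = 0"
proof -
  have 1: "(\<lambda>x. 1) \<in> smooth_near M p" by (rule smooth_near_const[OF assms(1,2)])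
  have "X (\<lambda>x. 1) = 0"
    using tangent_mult[OF assms(3) 1 1] by simp
  then show ?thesis
    using tangent_cmult[OF assms(3) 1, of c] by simp
qed

lemma tangent_sum:
  assumes "compatible_atlas M" "p \<in> points M" "X \<in> tangent M p" "\<And>i. i \<in> I \<Longrightarrow> f i \<in> smooth_near M p"
  shows "X (\<lambda>x. \<Sum>i\<in>I. f i x) = (\<Sum>i\<in>I. X (f i))"
  using assms(4)
  by (induction I rule: infinite_finite_induct)
    (simp_all add: tangent_const[OF assms(1-3)] tangent_add[OF assms(3)] smooth_near_sum[OF assms(1,2)])

text \<open>No bump functions are needed: the indicator function of a neighbourhood of \<open>p\<close> is itself
  smooth near \<open>p\<close>, and the Leibniz rule expresses \<open>X f\<close> through the product with it.\<close>

lemma tangent_germ: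
  assumes M: "compatible_atlas M" and X: "X \<in> tangent M p" and U: "(U, \<phi>) \<in> M"
    and W: "chart_nbhd U \<phi> W p" and fg: "\<And>x. x \<in> U \<Longrightarrow> x \<in> W \<Longrightarrow> f x = g x"
  shows "X f = X g"
proof (cases "f \<in> smooth_near M p")
  case False
  then have "g \<notin> smooth_near M p"
    using smooth_near_cong[OF M U W, of g f] fg by auto
  with False show ?thesis using tangent_outside[OF X] by simp
next
  case f: True
  have g: "g \<in> smooth_near M p"
    by (rule smooth_near_cong[OF M U W _ f]) (rule fg)
  have pU: "p \<in> U" "p \<in> W" using W by (auto simp: chart_nbhd_def)
  define h :: "'a \<Rightarrow> real" where "h x = (if x \<in> U \<inter> W then 1 else 0)" for x
  have "p \<in> points M" using smooth_near_points[OF f] .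
  then have h: "h \<in> smooth_near M p"
    by (intro smooth_near_cong[OF M U W _ smooth_near_const[OF M]]) (auto simp: h_def)
  have "(\<lambda>x. h x * f x) = (\<lambda>x. h x * g x)"
    using fg by (auto simp: h_def)
  then have "h p * X f + f p * X h = h p * X g + g p * X h"
    using tangent_mult[OF X h f] tangent_mult[OF X h g] by simp
  then show ?thesis using fg pU by (simp add: h_def)
qed

text \<open>Hadamard's lemma writes \<open>H (Z x) - H (Z p)\<close> as a sum of products
  \<open>((Z x - Z p) \<bullet> b) * G b (Z x)\<close>. The derivation kills constants, and the
  first factor of each product vanishes at \<open>p\<close>, so the Leibniz rule leaves the
  coefficient \<open>G b (Z p) = H' b\<close>. \<open>Z\<close> is allowed to differ from the chart:
  on a submanifold it will be the ambient coordinates.\<close>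

lemma tangent_chain:
  fixes Z :: "'a \<Rightarrow> 'z::euclidean_space" and H :: "'z \<Rightarrow> real"
  assumes M: "compatible_atlas M" and X: "X \<in> tangent M p" and U: "(U, \<phi>) \<in> M"
    and Z: "chart_smooth U \<phi> UNIV id Z p"
    and H: "smooth_open O' H" "Z p \<in> O'" and H': "(H has_derivative H') (at (Z p))"
    and W: "chart_nbhd U \<phi> W p" and f: "\<And>x. x \<in> U \<Longrightarrow> x \<in> W \<Longrightarrow> f x = H (Z x)"
  shows "X f = H' (chart_vec Z X)"
proof -
  have pU: "p \<in> U" using W by (simp add: chart_nbhd_def)
  then have pM: "p \<in> points M" using U by (auto simp: points_def)
  \<comment> \<open>Hadamard's lemma wants a convex domain, so \<open>O'\<close> is shrunk to a
    ball.\<close>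
  obtain e where e: "e > 0" "ball (Z p) e \<subseteq> O'"
    using H open_contains_ball unfolding smooth_open_def by metis
  have HB: "smooth_open (ball (Z p) e) H"
    using smooth_open_subset[OF H(1) open_ball e(2)] .
  obtain G where G: "\<And>b. smooth_open (ball (Z p) e) (G b)" "\<And>b. G b (Z p) = H' b"
    "\<And>x. x \<in> ball (Z p) e \<Longrightarrow> H x = H (Z p) + (\<Sum>b\<in>Basis. ((x - Z p) \<bullet> b) * G b x)"
    by (rule hadamard[OF HB convex_ball _ H'], simp add: e(1)) (rule that)
  note near = smooth_near_iff[OF M U pU]
  have Zb: "(\<lambda>x. Z x \<bullet> b) \<in> smooth_near M p" for b
    unfolding near by (rule chart_smooth_outer[OF Z smooth_open_linear[OF bounded_linear_inner_left]]) simp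
  have Zc: "(\<lambda>x. (Z x - Z p) \<bullet> b) \<in> smooth_near M p" for b
    using smooth_near_add[OF M Zb[of b] smooth_near_const[OF M pM, of "- (Z p \<bullet> b)"]]
    by (simp add: inner_diff_left)
  have XZc: "X (\<lambda>x. (Z x - Z p) \<bullet> b) = X (\<lambda>x. Z x \<bullet> b)" for b
    using tangent_add[OF X Zb[of b] smooth_near_const[OF M pM, of "- (Z p \<bullet> b)"]]
      tangent_const[OF M pM X, of "- (Z p \<bullet> b)"]
    by (simp add: inner_diff_left)
  have Gb: "(\<lambda>x. G b (Z x)) \<in> smooth_near M p" for b
    unfolding near by (rule chart_smooth_outer[OF Z G(1)]) (use e(1) in simp)
  let ?g = "\<lambda>x. H (Z p) + (\<Sum>b\<in>Basis. ((Z x - Z p) \<bullet> b) * G b (Z x))"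
  have "chart_nbhd UNIV id (ball (Z p) e) (Z p)"
    unfolding chart_nbhd_def using e(1) by (intro conjI exI[of _ "ball (Z p) e"]) auto
  from chart_nbhd_Int[OF W chart_smooth_nbhd[OF Z this]]
  have "X f = X ?g"
    by (rule tangent_germ[OF M X U]) (use f G(3) in auto)
  also have "\<dots> = X (\<lambda>x. \<Sum>b\<in>Basis. ((Z x - Z p) \<bullet> b) * G b (Z x))"
    by (subst tangent_add[OF X])
      (auto intro!: smooth_near_const smooth_near_sum smooth_near_mult M pM Zc Gb simp: tangent_const[OF M pM X])
  also have "\<dots> = (\<Sum>b\<in>Basis. X (\<lambda>x. ((Z x - Z p) \<bullet> b) * G b (Z x)))"
    by (rule tangent_sum[OF M pM X]) (intro smooth_near_mult M Zc Gb)
  also have "\<dots> = (\<Sum>b\<in>Basis. X (\<lambda>x. Z x \<bullet> b) * H' b)"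
    by (intro sum.cong refl) (simp add: tangent_mult[OF X Zc Gb] XZc G(2))
  also have "\<dots> = H' (chart_vec Z X)"
  proof -
    have "linear H'" using H' has_derivative_linear by blast
    then show ?thesis
      by (simp add: chart_vec_def linear_sum linear_scale)
  qed
  finally show ?thesis .
qed

section \<open>Tangent maps\<close>

lemma tangent_map_apply: "g \<in> smooth_near N (f p) \<Longrightarrow> tangent_map N f p X g = X (\<lambda>x. g (f x))"
  by (simp add: tangent_map_def)

lemma tangent_map_minus: "tangent_map N f p (X - Y) = tangent_map N f p X - tangent_map N f p Y"
  by (auto simp: tangent_map_def)

lemma tangent_diff:
  assumes "X \<in> tangent M p" "Y \<in> tangent M p"
  shows "X - Y \<in> tangent M p"
  using assms unfolding tangent_def by (auto simp: algebra_simps)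

lemma tangent_map_tangent:
  assumes M: "compatible_atlas M" and N: "compatible_atlas N" and f: "smooth_at M N f p"
    and X: "X \<in> tangent M p"
  shows "tangent_map N f p X \<in> tangent N (f p)"
proof -
  have "(\<lambda>x. g (f x)) \<in> smooth_near M p" if "g \<in> smooth_near N (f p)" for g
    using smooth_near_compose[OF M N f that] .
  then show ?thesis
    unfolding tangent_def
    using smooth_near_add[OF N] smooth_near_mult[OF N] smooth_near_cmult[OF N]
      tangent_add[OF X] tangent_mult[OF X] tangent_cmult[OF X]
    by (simp add: tangent_map_def)
qed

lemma chart_vec_tangent_map:
  assumes M: "compatible_atlas M" and N: "compatible_atlas N"
    and X: "X \<in> tangent M p" and U: "(U, \<phi>) \<in> M" "p \<in> U" and V: "(V, \<psi>) \<in> N" "f p \<in> V"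
    and g: "smooth_open O' g" "\<phi> p \<in> O'" "(g has_derivative g') (at (\<phi> p))"
      "\<And>x. x \<in> U \<Longrightarrow> \<phi> x \<in> O' \<Longrightarrow> \<psi> (f x) = g (\<phi> x)"
  shows "chart_vec \<psi> (tangent_map N f p X) = g' (chart_vec \<phi> X)"
proof -
  have "tangent_map N f p X (\<lambda>y. \<psi> y \<bullet> b) = g' (chart_vec \<phi> X) \<bullet> b" for b
  proof -
    have "(\<lambda>y. \<psi> y \<bullet> b) \<in> smooth_near N (f p)"
      unfolding smooth_near_iff[OF N V]
      by (rule chart_smooth_linear[OF V(2) bounded_linear_inner_left[of b]]) simp
    then have "tangent_map N f p X (\<lambda>y. \<psi> y \<bullet> b) = X (\<lambda>x. \<psi> (f x) \<bullet> b)"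
      by (rule tangent_map_apply)
    also have "\<dots> = g' (chart_vec \<phi> X) \<bullet> b"
    proof (rule tangent_chain[OF M X U(1), where W = "{x. \<phi> x \<in> O'}" and H = "\<lambda>y. g y \<bullet> b"])
      show "chart_smooth U \<phi> UNIV id \<phi> p"
        by (rule chart_smooth_linear[OF U(2) bounded_linear_ident]) simp
      show "smooth_open O' (\<lambda>y. g y \<bullet> b)"
        using smooth_open_compose[OF smooth_open_linear[OF bounded_linear_inner_left[of b]] g(1)] by simp
      show "((\<lambda>y. g y \<bullet> b) has_derivative (\<lambda>v. g' v \<bullet> b)) (at (\<phi> p))"
        using g(3) by (rule has_derivative_inner_left)
      show "chart_nbhd U \<phi> {x. \<phi> x \<in> O'} p"
        using g(1,2) U(2) by (auto intro!: chart_nbhd_open simp: smooth_open_def)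
    qed (use g in auto)
    finally show ?thesis .
  qed
  then show ?thesis
    by (simp add: chart_vec_def euclidean_representation)
qed

text \<open>For \<open>n\<close> orthogonal to \<open>L\<close>, the function
  \<open>\<phi> x \<bullet> n\<close> is zero on \<open>U\<close>, so the derivation kills it. Hence
  the coordinate vector is in the double orthogonal complement of \<open>L\<close>.\<close>

lemma chart_vec_subspace:
  assumes M: "compatible_atlas M" and X: "X \<in> tangent M p" and U: "(U, \<phi>) \<in> M" "p \<in> U"
    and L: "subspace L" "\<phi> ` U \<subseteq> L"
  shows "chart_vec \<phi> X \<in> L"
proof -
  have pM: "p \<in> points M" using U by (auto simp: points_def)
  have n: "chart_nbhd U \<phi> UNIV p"
    using U(2) by (auto simp: chart_nbhd_def)
  have "chart_vec \<phi> X \<bullet> n = 0" if "\<And>y. y \<in> L \<Longrightarrow> y \<bullet> n = 0" for n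
  proof -
    have "chart_smooth U \<phi> UNIV id \<phi> p"
      by (rule chart_smooth_linear[OF U(2) bounded_linear_ident]) simp
    then have "X (\<lambda>x. \<phi> x \<bullet> n) = chart_vec \<phi> X \<bullet> n"
      by (rule tangent_chain[OF M X U(1) _ smooth_open_linear[OF bounded_linear_inner_left[of n]] _ _ n])
        (auto intro: bounded_linear_imp_has_derivative bounded_linear_inner_left)
    moreover have "X (\<lambda>x. \<phi> x \<bullet> n) = X (\<lambda>x. 0)"
      by (rule tangent_germ[OF M X U(1) n]) (use that L(2) in auto)
    ultimately show ?thesis
      using tangent_const[OF M pM X] by simp
  qed
  then have "chart_vec \<phi> X \<in> orthogonal_comp (orthogonal_comp L)"
    by (auto simp: orthogonal_comp_def orthogonal_def inner_commute)
  then show ?thesis by (simp add: L(1) orthogonal_comp_self)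
qed

section \<open>Velocities of curves\<close>

text \<open>The extension \<open>F\<close> and its derivative are returned together with the
  derivative of \<open>f\<close> along the curve, so that the same \<open>F'\<close> can be compared
  with the value of a derivation. \<open>D\<close> may also be the part of a submanifold inside an
  ambient chart.\<close>

lemma chart_smooth_curve:
  fixes f :: "'a \<Rightarrow> real" and c :: "real \<Rightarrow> 'a"
  assumes f: "chart_smooth D \<phi> UNIV id f p"
    and c: "c 0 = p" "\<forall>\<^sub>F t in at 0. c t \<in> D" "((\<lambda>t. \<phi> (c t)) has_vector_derivative k) (at 0)"
  obtains O' F F' where "smooth_open O' F" "\<phi> p \<in> O'" "(F has_derivative F') (at (\<phi> p))"
    "\<And>x. x \<in> D \<Longrightarrow> \<phi> x \<in> O' \<Longrightarrow> f x = F (\<phi> x)"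
    "((\<lambda>t. f (c t)) has_real_derivative F' k) (at 0)"
proof -
  obtain O' F where F: "p \<in> D" "smooth_open O' F" "\<phi> p \<in> O'"
    "\<And>x. x \<in> D \<Longrightarrow> \<phi> x \<in> O' \<Longrightarrow> id (f x) = F (\<phi> x)"
    by (rule chart_smoothE[OF f]) (rule that)
  obtain d where "\<And>x. x \<in> O' \<Longrightarrow> (F has_derivative d x) (at x)"
    using smooth_open_derivative[OF F(2)] by metis
  then have d: "(F has_derivative d (\<phi> p)) (at (\<phi> p))" using F(3) by blast
  have lin: "linear (d (\<phi> p))" using d has_derivative_linear by blast
  have c': "((\<lambda>t. \<phi> (c t)) has_derivative (\<lambda>t. t *\<^sub>R k)) (at 0)"
    using c(3) by (simp add: has_vector_derivative_def)
  have "((\<lambda>t. F (\<phi> (c t))) has_derivative (\<lambda>t. d (\<phi> p) (t *\<^sub>R k))) (at 0)"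
    by (rule has_derivative_compose[OF c']) (use d c(1) in simp)
  moreover have "\<forall>\<^sub>F t in at 0. F (\<phi> (c t)) = f (c t)"
  proof -
    have "isCont (\<lambda>t. \<phi> (c t)) 0"
      using c' by (rule has_derivative_continuous)
    then have "\<forall>\<^sub>F t in at 0. \<phi> (c t) \<in> O'"
      using F(2,3) c(1) by (auto simp: isCont_def smooth_open_def intro: topological_tendstoD)
    with c(2) show ?thesis
      by eventually_elim (use F(4) in simp)
  qed
  ultimately have "((\<lambda>t. f (c t)) has_derivative (\<lambda>t. d (\<phi> p) (t *\<^sub>R k))) (at 0)"
    by (rule has_derivative_transform_eventually) (use F c(1) in auto)
  then have "((\<lambda>t. f (c t)) has_real_derivative d (\<phi> p) k) (at 0)"
    by (simp add: has_field_derivative_def linear_scale[OF lin] mult_commute_abs)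
  with F d that show ?thesis by auto
qed

text \<open>Both numbers equal \<open>F' (chart_vec \<phi> X)\<close> for one extension
  \<open>F\<close> of \<open>f\<close> in the chart: the derivative along the curve by the chain
  rule, the value \<open>X f\<close> by \<open>tangent_chain\<close>.\<close>

lemma curve_derivative:
  assumes M: "compatible_atlas M" and X: "X \<in> tangent M p" and U: "(U, \<phi>) \<in> M" "p \<in> U"
    and c: "c 0 = p" "\<forall>\<^sub>F t in at 0. c t \<in> U"
      "((\<lambda>t. \<phi> (c t)) has_vector_derivative chart_vec \<phi> X) (at 0)"
    and f: "f \<in> smooth_near M p"
  shows "((\<lambda>t. f (c t)) has_real_derivative X f) (at 0)"
proof -
  have "chart_smooth U \<phi> UNIV id f p"
    using f smooth_near_iff[OF M U] by blast
  then obtain O' F F' where F: "smooth_open O' F" "\<phi> p \<in> O'" "(F has_derivative F') (at (\<phi> p))"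
    "\<And>x. x \<in> U \<Longrightarrow> \<phi> x \<in> O' \<Longrightarrow> f x = F (\<phi> x)"
    "((\<lambda>t. f (c t)) has_real_derivative F' (chart_vec \<phi> X)) (at 0)"
    by (rule chart_smooth_curve[OF _ c]) (rule that)
  have Z: "chart_smooth U \<phi> UNIV id \<phi> p"
    by (rule chart_smooth_linear[OF U(2) bounded_linear_ident]) simp
  have W: "chart_nbhd U \<phi> {x. \<phi> x \<in> O'} p"
    using F(1,2) U(2) by (auto intro!: chart_nbhd_open simp: smooth_open_def)
  have "X f = F' (chart_vec \<phi> X)"
    by (rule tangent_chain[OF M X U(1) Z F(1-3) W]) (use F(4) in auto)
  with F(5) show ?thesis by simp
qed

text \<open>The value 0 on functions that are not smooth near \<open>c 0\<close> is what membership
  in \<open>tangent\<close> demands.\<close>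

definition velocity :: "('a, 'e::euclidean_space) atlas \<Rightarrow> (real \<Rightarrow> 'a) \<Rightarrow> 'a tvec" where
  "velocity M c = (\<lambda>f. if f \<in> smooth_near M (c 0) then deriv (\<lambda>t. f (c t)) 0 else 0)"

lemma velocity_tangent:
  assumes M: "compatible_atlas M"
    and c: "\<And>f. f \<in> smooth_near M (c 0) \<Longrightarrow> (\<lambda>t. f (c t)) field_differentiable at 0"
  shows "velocity M c \<in> tangent M (c 0)"
proof -
  have "velocity M c (\<lambda>x. f x + g x) = velocity M c f + velocity M c g \<and>
      velocity M c (\<lambda>x. f x * g x) = f (c 0) * velocity M c g + g (c 0) * velocity M c f"
    if f: "f \<in> smooth_near M (c 0)" and g: "g \<in> smooth_near M (c 0)" for f g
    using f g smooth_near_add[OF M f g] smooth_near_mult[OF M f g]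
      deriv_add[OF c[OF f] c[OF g]] deriv_mult[OF c[OF f] c[OF g]]
    by (simp add: velocity_def mult.commute)
  moreover have "velocity M c (\<lambda>x. a * f x) = a * velocity M c f" if "f \<in> smooth_near M (c 0)" for f a
    using that smooth_near_cmult[OF M that] c[OF that] by (simp add: velocity_def deriv_cmult)
  ultimately show ?thesis
    unfolding tangent_def by (simp add: velocity_def)
qed

lemma manifold_chart:
  assumes "manifold M" "(U, \<phi>) \<in> M"
  obtains L where "subspace L" "openin (top_of_set L) (\<phi> ` U)"
proof -
  have "\<exists>n. \<forall>(U, \<phi>)\<in>M. inj_on \<phi> U \<and> (\<exists>L. subspace L \<and> dim L = n \<and> openin (top_of_set L) (\<phi> ` U))"
    using assms(1) unfolding manifold_def by (rule conjunct1)
  then obtain n where "\<forall>(U, \<phi>)\<in>M. inj_on \<phi> U \<and>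
      (\<exists>L. subspace L \<and> dim L = n \<and> openin (top_of_set L) (\<phi> ` U))"
    by (rule exE)
  from bspec[OF this assms(2)] show ?thesis using that by auto
qed

lemma tangent_exists:
  assumes M: "compatible_atlas M" and U: "(U, \<phi>) \<in> M" "p \<in> U"
    and L: "subspace L" "openin (top_of_set L) (\<phi> ` U)" and l: "l \<in> L"
  shows "\<exists>X\<in>tangent M p. chart_vec \<phi> X = l"
proof -
  obtain O1 where O1: "open O1" "\<phi> ` U = L \<inter> O1"
    using L(2) unfolding openin_open by blast
  have inj: "inj_on \<phi> U" using compatible_atlas_inj M U(1) by blast
  have "((\<lambda>t. \<phi> p + t *\<^sub>R l) \<longlongrightarrow> \<phi> p + 0 *\<^sub>R l) (at 0)"
    by (intro tendsto_intros)
  then have "\<forall>\<^sub>F t in at 0. \<phi> p + t *\<^sub>R l \<in> O1"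
    using O1 U(2) by (auto intro: topological_tendstoD)
  then have ev: "\<forall>\<^sub>F t in at 0. \<phi> p + t *\<^sub>R l \<in> \<phi> ` U"
    by eventually_elim (use O1(2) U(2) L(1) l in \<open>auto intro!: subspace_add subspace_scale\<close>)
  define c where "c t = inv_into U \<phi> (\<phi> p + t *\<^sub>R l)" for t :: real
  have c0: "c 0 = p" using inj U(2) by (simp add: c_def)
  have cU: "\<forall>\<^sub>F t in at 0. c t \<in> U"
    using ev by eventually_elim (simp add: c_def inv_into_into)
  have c': "((\<lambda>t. \<phi> (c t)) has_vector_derivative l) (at 0)"
  proof -
    have "((\<lambda>t. \<phi> p + t *\<^sub>R l) has_derivative (\<lambda>t. t *\<^sub>R l)) (at 0)"
      by (auto intro!: derivative_eq_intros)
    moreover have "\<forall>\<^sub>F t in at 0. \<phi> p + t *\<^sub>R l = \<phi> (c t)"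
      using ev by eventually_elim (simp add: c_def f_inv_into_f)
    ultimately show ?thesis
      unfolding has_vector_derivative_def
      by (rule has_derivative_transform_eventually) (use c0 in auto)
  qed
  have "(\<lambda>t. f (c t)) field_differentiable at 0" if "f \<in> smooth_near M (c 0)" for f
  proof -
    have "chart_smooth U \<phi> UNIV id f p"
      using that smooth_near_iff[OF M U] c0 by simp
    then obtain D where "((\<lambda>t. f (c t)) has_real_derivative D) (at 0)"
      by (rule chart_smooth_curve[OF _ c0 cU c']) (rule that)
    then show ?thesis
      unfolding field_differentiable_def by blast
  qed
  then have "velocity M c \<in> tangent M p"
    using velocity_tangent[OF M, of c] c0 by simp
  moreover have "velocity M c (\<lambda>x. \<phi> x \<bullet> b) = l \<bullet> b" for b
  proof -
    have "(\<lambda>x. \<phi> x \<bullet> b) \<in> smooth_near M p"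
      unfolding smooth_near_iff[OF M U]
      by (rule chart_smooth_linear[OF U(2) bounded_linear_inner_left[of b]]) simp
    moreover have "((\<lambda>t. \<phi> (c t) \<bullet> b) has_real_derivative l \<bullet> b) (at 0)"
      using has_derivative_inner_left[OF c'[unfolded has_vector_derivative_def], of b]
      by (simp add: has_field_derivative_def mult_commute_abs)
    ultimately show ?thesis
      using c0 by (simp add: velocity_def DERIV_imp_deriv)
  qed
  then have "chart_vec \<phi> (velocity M c) = l"
    by (simp add: chart_vec_def euclidean_representation)
  ultimately show ?thesis by blast
qed

text \<open>This is \<open>level_curve\<close> for the coordinate expression of \<open>s\<close>.
  Its surjectivity hypothesis concerns coordinate vectors, so \<open>tangent_exists\<close> first
  realises a vector of the target subspace by a derivation, to which the submersion property
  applies.\<close>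

lemma submersion_vertical_curve:
  assumes M: "manifold M" and N: "manifold N" and s: "submersion M N s"
    and U: "(U, \<phi>) \<in> M" "p \<in> U" and k: "k \<in> tangent M p" "tangent_map N s p k = 0"
  obtains c :: "real \<Rightarrow> 'a" where "c 0 = p" "\<forall>\<^sub>F t in at 0. c t \<in> U \<and> s (c t) = s p"
    "((\<lambda>t. \<phi> (c t)) has_vector_derivative chart_vec \<phi> k) (at 0)"
proof -
  have cM: "compatible_atlas M" and cN: "compatible_atlas N"
    using manifold_compatible_atlas[OF M] manifold_compatible_atlas[OF N] by simp_all
  have pM: "p \<in> points M" using U by (auto simp: points_def)
  then have sp: "smooth_at M N s p" and onto: "tangent_map N s p ` tangent M p = tangent N (s p)"
    using s unfolding submersion_def smooth_map_def by blast+
  obtain U' \<phi>' V \<psi> where V: "(U', \<phi>') \<in> M" "(V, \<psi>) \<in> N" "chart_smooth U' \<phi>' V \<psi> s p"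
    by (rule smooth_atE[OF sp], erule compatible_atlas_inj[OF cM]) (rule that)
  then have sV: "s p \<in> V" using chart_smooth_point by metis
  obtain O' g where g: "smooth_open O' g" "\<phi> p \<in> O'" "\<And>x. x \<in> U \<Longrightarrow> \<phi> x \<in> O' \<Longrightarrow> s x \<in> V"
    "\<And>x. x \<in> U \<Longrightarrow> \<phi> x \<in> O' \<Longrightarrow> \<psi> (s x) = g (\<phi> x)"
    by (rule chart_smoothE[OF smooth_at_chart_smooth[OF sp cM cN U V(2) sV]]) (rule that)
  obtain g' where g': "(g has_derivative g') (at (\<phi> p))"
    using smooth_open_derivative[OF g(1)] g(2) by metis
  obtain L where L: "subspace L" "openin (top_of_set L) (\<phi> ` U)"
    by (rule manifold_chart[OF M U(1)])
  obtain L' where L': "subspace L'" "openin (top_of_set L') (\<psi> ` V)"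
    by (rule manifold_chart[OF N V(2)])
  obtain O1 where O1: "open O1" "\<phi> ` U = L \<inter> O1"
    using L(2) unfolding openin_open by blast
  have VL: "\<psi> ` V \<subseteq> L'" using L'(2) openin_imp_subset by blast
  have injU: "inj_on \<phi> U" and injV: "inj_on \<psi> V"
    using compatible_atlas_inj cM cN U(1) V(2) by blast+
  have push: "chart_vec \<psi> (tangent_map N s p X) = g' (chart_vec \<phi> X)" if "X \<in> tangent M p" for X
    using chart_vec_tangent_map[OF cM cN that U V(2) sV g(1,2) g' g(4)] .
  have vecL: "chart_vec \<phi> X \<in> L" if "X \<in> tangent M p" for X
    using chart_vec_subspace[OF cM that U L(1)] O1(2) by blast
  \<comment> \<open>Intersecting with \<open>O1\<close> keeps the curve inside
    \<open>L \<inter> O1\<close>, the image of the chart, so that it can be pulled back to the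
    manifold.\<close>
  have gO: "smooth_open (O' \<inter> O1) g" using g(1) O1(1) by (rule smooth_open_Int)
  obtain c where c: "c 0 = \<phi> p" "(c has_vector_derivative chart_vec \<phi> k) (at 0)"
    "\<forall>\<^sub>F t in at 0. c t \<in> L \<and> c t \<in> O' \<inter> O1 \<and> g (c t) = g (\<phi> p)"
  proof (rule level_curve[OF gO _ _ g' L(1) L'(1)])
    show "\<phi> p \<in> O' \<inter> O1" "\<phi> p \<in> L" using g(2) O1(2) U(2) by blast+
    fix x assume x: "x \<in> O' \<inter> O1" "x \<in> L"
    then obtain y where y: "y \<in> U" "x = \<phi> y" using O1(2) by blast
    then show "g x \<in> L'" using g(3,4)[of y] x VL by force
  next
    fix l assume "l \<in> L'"
    then obtain Y where "Y \<in> tangent N (s p)" "chart_vec \<psi> Y = l"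
      using tangent_exists[OF cN V(2) sV L'] by blast
    moreover from this obtain X where "X \<in> tangent M p" "Y = tangent_map N s p X"
      using onto by blast
    ultimately show "\<exists>x\<in>L. g' x = l"
      using push vecL by auto
  next
    show "chart_vec \<phi> k \<in> L" using vecL k(1) by blast
    have "chart_vec \<psi> 0 = 0" by (simp add: chart_vec_def)
    then show "g' (chart_vec \<phi> k) = 0" using push[OF k(1)] k(2) by metis
  qed (rule that)
  define d where "d t = inv_into U \<phi> (c t)" for t
  have d0: "d 0 = p" using c(1) injU U(2) by (simp add: d_def)
  have d: "\<forall>\<^sub>F t in at 0. d t \<in> U \<and> \<phi> (d t) = c t \<and> s (d t) = s p"
    using c(3)
  proof eventually_elim
    case (elim t)
    then have "c t \<in> \<phi> ` U" using O1(2) by blast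
    then have d: "d t \<in> U" "\<phi> (d t) = c t" by (simp_all add: d_def inv_into_into f_inv_into_f)
    then have "s (d t) \<in> V" "\<psi> (s (d t)) = \<psi> (s p)"
      using g(3,4)[of "d t"] g(4)[OF U(2) g(2)] elim by auto
    \<comment> \<open>The level curve fixes only the coordinate of \<open>s (d t)\<close>;
      injectivity of \<open>\<psi>\<close> gives \<open>s (d t) = s p\<close> itself.\<close>
    then show ?case using d injV sV by (auto dest: inj_onD)
  qed
  have "((\<lambda>t. \<phi> (d t)) has_vector_derivative chart_vec \<phi> k) (at 0)"
    unfolding has_vector_derivative_def
  proof (rule has_derivative_transform_eventually)
    show "(c has_derivative (\<lambda>t. t *\<^sub>R chart_vec \<phi> k)) (at 0)"
      using c(2) by (simp add: has_vector_derivative_def)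
    show "\<forall>\<^sub>F t in at 0. c t = \<phi> (d t)" using d by eventually_elim simp
  qed (use c(1) d0 in auto)
  moreover have "\<forall>\<^sub>F t in at 0. d t \<in> U \<and> s (d t) = s p"
    using d by eventually_elim simp
  ultimately show ?thesis using d0 that by blast
qed

section \<open>Tangent vectors of fibre products\<close>

lemma prod_atlas_chart: "(U, \<phi>) \<in> M \<Longrightarrow> (V, \<psi>) \<in> N \<Longrightarrow> (U \<times> V, map_prod \<phi> \<psi>) \<in> prod_atlas M N"
  unfolding prod_atlas_def by blast

lemma points_prod_atlas: "points (prod_atlas M N) = points M \<times> points N"
proof (intro equalityI subsetI)
  fix z assume "z \<in> points (prod_atlas M N)"
  then obtain W \<kappa> where "(W, \<kappa>) \<in> prod_atlas M N" "z \<in> W" by (rule pointsE)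
  then show "z \<in> points M \<times> points N"
    by (auto simp: prod_atlas_def points_def)
next
  fix z assume "z \<in> points M \<times> points N"
  then have z: "fst z \<in> points M" "snd z \<in> points N" by auto
  obtain U \<phi> where "(U, \<phi>) \<in> M" "fst z \<in> U" by (rule pointsE[OF z(1)])
  moreover obtain V \<psi> where "(V, \<psi>) \<in> N" "snd z \<in> V" by (rule pointsE[OF z(2)])
  ultimately have "(U \<times> V, map_prod \<phi> \<psi>) \<in> prod_atlas M N" "z \<in> U \<times> V"
    by (auto simp: mem_Times_iff intro: prod_atlas_chart)
  then show "z \<in> points (prod_atlas M N)"
    unfolding points_def by blast
qed

lemma points_sub_atlas: "points (sub_atlas M S) \<subseteq> S \<inter> points M"
proof
  fix z assume "z \<in> points (sub_atlas M S)"
  then obtain V \<phi> where "(V, \<phi>) \<in> sub_atlas M S" "z \<in> V" by (rule pointsE)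
  then show "z \<in> S \<inter> points M" using sub_atlas_chart_subset by blast
qed

text \<open>\<open>S\<close> is an arbitrary subset; requiring \<open>q\<close> to be a point of the
  atlas is what supplies a submanifold chart there. The fibre product condition enters only as a
  hypothesis of \<open>tangent_map_fibre_product\<close>.\<close>

locale product_submanifold =
  fixes M :: "('a, 'e::euclidean_space) atlas" and N :: "('b, 'f::euclidean_space) atlas"
    and S :: "('a \<times> 'b) set" and P :: "('a \<times> 'b, 'e \<times> 'f) atlas" and q :: "'a \<times> 'b"
  assumes M: "compatible_atlas M" and N: "compatible_atlas N"
  defines P: "P \<equiv> sub_atlas (prod_atlas M N) S"
  assumes q: "q \<in> points P"
begin

lemma MN: "compatible_atlas (prod_atlas M N)"
  by (rule compatible_prod_atlas[OF M N])

lemma compatible_P: "compatible_atlas P"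
  unfolding P by (rule compatible_sub_atlas[OF MN])

lemma q_points: "q \<in> S" "fst q \<in> points M" "snd q \<in> points N"
  using q points_sub_atlas[of "prod_atlas M N" S] unfolding P points_prod_atlas by auto

lemma smooth_near_P_iff:
  assumes "(U, \<phi>) \<in> M" "fst q \<in> U" "(V, \<psi>) \<in> N" "snd q \<in> V"
  shows "f \<in> smooth_near P q \<longleftrightarrow> chart_smooth (S \<inter> U \<times> V) (map_prod \<phi> \<psi>) UNIV id f q"
  using smooth_near_sub_atlas_iff[OF MN q[unfolded P] prod_atlas_chart[OF assms(1,3)]] assms(2,4)
  unfolding P by (simp add: mem_Times_iff)

lemma smooth_at_fst: "smooth_at P M fst q"
  and smooth_at_snd: "smooth_at P N snd q"
proof -
  obtain U \<phi> where U: "(U, \<phi>) \<in> M" "fst q \<in> U" by (rule pointsE[OF q_points(2)])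
  obtain V \<psi> where V: "(V, \<psi>) \<in> N" "snd q \<in> V" by (rule pointsE[OF q_points(3)])
  obtain Z \<zeta> where Z: "(Z, \<zeta>) \<in> P" "q \<in> Z" by (rule pointsE[OF q])
  have Z1: "chart_smooth Z \<zeta> (S \<inter> U \<times> V) (map_prod \<phi> \<psi>) (\<lambda>x. x) q"
    using sub_atlas_charts(2)[OF MN Z(1)[unfolded P] Z(2) prod_atlas_chart[OF U(1) V(1)]] U(2) V(2)
    by (simp add: mem_Times_iff)
  have "chart_smooth (S \<inter> U \<times> V) (map_prod \<phi> \<psi>) U \<phi> fst q"
    by (rule chart_smooth_linear[OF _ bounded_linear_fst]) (use q_points U V in \<open>auto simp: mem_Times_iff\<close>)
  from chart_smooth_compose[OF Z1 this] show "smooth_at P M fst q"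
    using chart_smooth_smooth_at[OF compatible_P Z(1) U(1)] by simp
  have "chart_smooth (S \<inter> U \<times> V) (map_prod \<phi> \<psi>) V \<psi> snd q"
    by (rule chart_smooth_linear[OF _ bounded_linear_snd]) (use q_points U V in \<open>auto simp: mem_Times_iff\<close>)
  from chart_smooth_compose[OF Z1 this] show "smooth_at P N snd q"
    using chart_smooth_smooth_at[OF compatible_P Z(1) V(1)] by simp
qed

text \<open>Each ambient coordinate is a sum of functions pulled back from the two factors, so
  \<open>u\<close> kills all of them. Any function smooth near \<open>q\<close> is a smooth function
  of these coordinates, and \<open>tangent_chain\<close> applies with the ambient coordinates as
  \<open>Z\<close>.\<close>

lemma tangent_eq_0:
  assumes u: "u \<in> tangent P q" and u1: "tangent_map M fst q u = 0" and u2: "tangent_map N snd q u = 0"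
  shows "u = 0"
proof
  fix f
  show "u f = 0 f"
  proof (cases "f \<in> smooth_near P q")
    case False
    then show ?thesis using tangent_outside[OF u] by simp
  next
    case True
    obtain U \<phi> where U: "(U, \<phi>) \<in> M" "fst q \<in> U" by (rule pointsE[OF q_points(2)])
    obtain V \<psi> where V: "(V, \<psi>) \<in> N" "snd q \<in> V" by (rule pointsE[OF q_points(3)])
    obtain Z \<zeta> where Z: "(Z, \<zeta>) \<in> P" "q \<in> Z" by (rule pointsE[OF q])
    let ?D = "S \<inter> U \<times> V" and ?k = "map_prod \<phi> \<psi>"
    have qD: "q \<in> ?D" using q_points(1) U(2) V(2) by (simp add: mem_Times_iff)
    have Z1: "chart_smooth Z \<zeta> ?D ?k (\<lambda>x. x) q"
      using sub_atlas_charts(2)[OF MN Z(1)[unfolded P] Z(2) prod_atlas_chart[OF U(1) V(1)]] U(2) V(2)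
      by (simp add: mem_Times_iff)
    have k: "chart_smooth Z \<zeta> UNIV id ?k q"
      by (rule chart_smooth_compose[OF Z1], rule chart_smooth_linear[OF qD bounded_linear_ident]) simp
    obtain O' F where F: "smooth_open O' F" "?k q \<in> O'"
      "\<And>x. x \<in> ?D \<Longrightarrow> ?k x \<in> O' \<Longrightarrow> id (f x) = F (?k x)"
      by (rule chart_smoothE[OF True[unfolded smooth_near_P_iff[OF U V]]]) (rule that)
    obtain F' where F': "(F has_derivative F') (at (?k q))"
      using smooth_open_derivative[OF F(1)] F(2) by metis
    have W: "chart_nbhd Z \<zeta> {x. x \<in> ?D \<inter> {x. ?k x \<in> O'}} q"
      by (rule chart_smooth_nbhd[OF Z1]) (use F qD in \<open>auto intro!: chart_nbhd_open simp: smooth_open_def\<close>)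
    have "u f = F' (chart_vec ?k u)"
      by (rule tangent_chain[OF compatible_P u Z(1) k F(1,2) F' W]) (use F(3) in simp)
    moreover have "chart_vec ?k u = 0"
    proof -
      have "u (\<lambda>x. ?k x \<bullet> b) = 0" for b
      proof -
        have 1: "(\<lambda>y. \<phi> y \<bullet> fst b) \<in> smooth_near M (fst q)"
          unfolding smooth_near_iff[OF M U]
          by (rule chart_smooth_linear[OF U(2) bounded_linear_inner_left[of "fst b"]]) simp
        have 2: "(\<lambda>y. \<psi> y \<bullet> snd b) \<in> smooth_near N (snd q)"
          unfolding smooth_near_iff[OF N V]
          by (rule chart_smooth_linear[OF V(2) bounded_linear_inner_left[of "snd b"]]) simp
        have "u (\<lambda>x. ?k x \<bullet> b) = u (\<lambda>x. \<phi> (fst x) \<bullet> fst b + \<psi> (snd x) \<bullet> snd b)"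
          by (simp add: inner_prod_def)
        also have "\<dots> = u (\<lambda>x. \<phi> (fst x) \<bullet> fst b) + u (\<lambda>x. \<psi> (snd x) \<bullet> snd b)"
          using smooth_near_compose[OF compatible_P M smooth_at_fst 1]
            smooth_near_compose[OF compatible_P N smooth_at_snd 2] by (rule tangent_add[OF u])
        also have "\<dots> = 0"
          using tangent_map_apply[of _ M fst q, OF 1, of u] tangent_map_apply[of _ N snd q, OF 2, of u] u1 u2 by simp
        finally show ?thesis .
      qed
      then show ?thesis by (simp add: chart_vec_def)
    qed
    ultimately show ?thesis
      using F' by (simp add: linear_0[OF has_derivative_linear])
  qed
qed

lemma tangent_of_curve:
  assumes U: "(U, \<phi>) \<in> M" "fst q \<in> U" and k: "k \<in> tangent M (fst q)"
    and c: "c 0 = fst q" "\<forall>\<^sub>F t in at 0. c t \<in> U" "\<forall>\<^sub>F t in at 0. (c t, snd q) \<in> S"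
      "((\<lambda>t. \<phi> (c t)) has_vector_derivative chart_vec \<phi> k) (at 0)"
  shows "\<exists>u\<in>tangent P q. tangent_map M fst q u = k \<and> tangent_map N snd q u = 0"
proof -
  obtain V \<psi> where V: "(V, \<psi>) \<in> N" "snd q \<in> V" by (rule pointsE[OF q_points(3)])
  let ?D = "S \<inter> U \<times> V" and ?k = "map_prod \<phi> \<psi>"
  define d where "d t = (c t, snd q)" for t
  have d0: "d 0 = q" using c(1) by (simp add: d_def)
  have dD: "\<forall>\<^sub>F t in at 0. d t \<in> ?D"
    using c(2,3) by eventually_elim (use V(2) in \<open>simp add: d_def\<close>)
  have "((\<lambda>t. (\<phi> (c t), \<psi> (snd q))) has_vector_derivative (chart_vec \<phi> k, 0)) (at 0)"
    using has_derivative_Pair[OF c(4)[unfolded has_vector_derivative_def] has_derivative_const]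
    by (simp add: has_vector_derivative_def scaleR_prod_def)
  then have d': "((\<lambda>t. ?k (d t)) has_vector_derivative (chart_vec \<phi> k, 0)) (at 0)"
    by (simp add: d_def)
  have "(\<lambda>t. f (d t)) field_differentiable at 0" if f: "f \<in> smooth_near P (d 0)" for f
  proof -
    \<comment> \<open>Differentiability along the curve is checked in the product coordinates, in
      which its velocity is known.\<close>
    have "chart_smooth ?D ?k UNIV id f q"
      using f smooth_near_P_iff[OF U V] d0 by simp
    then obtain e where "((\<lambda>t. f (d t)) has_real_derivative e) (at 0)"
      by (rule chart_smooth_curve[OF _ d0 dD d']) (rule that)
    then show ?thesis unfolding field_differentiable_def by blast
  qed
  then have "velocity P d \<in> tangent P q"
    using velocity_tangent[OF compatible_P, of d] d0 by simp
  moreover have "tangent_map M fst q (velocity P d) g = k g" for g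
  proof (cases "g \<in> smooth_near M (fst q)")
    case True
    have "(\<lambda>x. g (fst x)) \<in> smooth_near P q"
      by (rule smooth_near_compose[OF compatible_P M smooth_at_fst True])
    then have "tangent_map M fst q (velocity P d) g = deriv (\<lambda>t. g (c t)) 0"
      unfolding tangent_map_apply[of _ M fst q, OF True] by (simp add: velocity_def d0) (simp add: d_def)
    also have "\<dots> = k g"
      by (rule DERIV_imp_deriv, rule curve_derivative[OF M k U c(1,2,4) True])
    finally show ?thesis .
  next
    case False
    then show ?thesis using tangent_outside[OF k] by (simp add: tangent_map_def)
  qed
  moreover have "tangent_map N snd q (velocity P d) g = 0" for g
    by (simp add: tangent_map_def velocity_def d_def)
  ultimately show ?thesis by (auto intro!: bexI[of _ "velocity P d"])
qed

text \<open>The functions \<open>f (s (fst z))\<close> and \<open>f (r (snd z))\<close> agree on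
  \<open>S\<close>, hence on a whole chart of \<open>P\<close>. Off \<open>S\<close> they may
  differ, so the equality of their derivatives is a statement about germs.\<close>

lemma tangent_map_fibre_product:
  assumes K: "compatible_atlas K" and s: "smooth_at M K s (fst q)" and r: "smooth_at N K r (snd q)"
    and S: "\<And>x y. (x, y) \<in> S \<Longrightarrow> s x = r y" and u: "u \<in> tangent P q"
  shows "tangent_map K s (fst q) (tangent_map M fst q u) = tangent_map K r (snd q) (tangent_map N snd q u)"
proof
  fix f
  have sr: "s (fst q) = r (snd q)" using S q_points(1) by (metis prod.collapse)
  show "tangent_map K s (fst q) (tangent_map M fst q u) f = tangent_map K r (snd q) (tangent_map N snd q u) f"
  proof (cases "f \<in> smooth_near K (s (fst q))")
    case True
    have 1: "(\<lambda>x. f (s x)) \<in> smooth_near M (fst q)"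
      by (rule smooth_near_compose[OF M K s True])
    have 2: "(\<lambda>y. f (r y)) \<in> smooth_near N (snd q)"
      by (rule smooth_near_compose[OF N K r]) (use True sr in simp)
    obtain Z \<zeta> where Z: "(Z, \<zeta>) \<in> P" "q \<in> Z" by (rule pointsE[OF q])
    have "Z \<subseteq> S" using sub_atlas_chart_subset Z(1) unfolding P by blast
    moreover have "chart_nbhd Z \<zeta> UNIV q" using Z(2) by (auto simp: chart_nbhd_def)
    ultimately have "u (\<lambda>z. f (s (fst z))) = u (\<lambda>z. f (r (snd z)))"
      by (intro tangent_germ[OF compatible_P u Z(1)]) (use S in force)+
    then show ?thesis
      using tangent_map_apply[of f K s "fst q"] tangent_map_apply[of f K r "snd q"] True sr
        tangent_map_apply[of _ M fst q, OF 1] tangent_map_apply[of _ N snd q, OF 2] by simp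
  qed (use sr in \<open>simp add: tangent_map_def\<close>)
qed

end

section \<open>Freeness of the adjoint classes\<close>

lemma smooth_at_points:
  assumes "smooth_at M N f p"
  shows "f p \<in> points N"
proof -
  obtain U \<phi> V \<psi> W where "(U, \<phi>) \<in> M" "(V, \<psi>) \<in> N" "mopen M W" "p \<in> W" "W \<subseteq> U" "f ` W \<subseteq> V"
    "smooth_on (\<phi> ` W) (\<lambda>y. \<psi> (f (inv_into U \<phi> y)))"
    using assms unfolding smooth_at_def by fast
  then have "(V, \<psi>) \<in> N" "f p \<in> V" by blast+
  then show ?thesis unfolding points_def by blast
qed

text \<open>Freeness is read off a local trivialisation, which turns the action into right
  multiplication on the group component; there cancellation applies.\<close>

lemma ract_free:
  assumes G: "lie_group G" and B: "principal_bundle G X B"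
    and a: "a \<in> points (total_space B)" and g: "g \<in> carrier G" "ract B a g = a"
  shows "g = \<one>\<^bsub>G\<^esub>"
proof -
  interpret group G using G by (simp add: lie_group_def)
  have pts: "points (group_atlas G) = carrier G"
    using G by (simp add: lie_group_def)
  have "bproj B a \<in> points X"
    by (rule smooth_at_points[OF bspec[OF
            B[unfolded principal_bundle_def smooth_map_def, THEN conjunct2, THEN conjunct1] a]])
  from bspec[OF B[unfolded principal_bundle_def Let_def, THEN conjunct2, THEN conjunct2,
        THEN conjunct2, THEN conjunct2] this]
  show ?thesis
  proof (elim exE conjE, goal_cases)
    case (1 U \<tau> \<tau>')
    let ?BU = "{b \<in> points (total_space B). bproj B b \<in> U}"
    have aU: "a \<in> ?BU" using a 1(2) by simp
    then have "a \<in> points (open_sub (total_space B) ?BU)"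
      by (force simp: points_def open_sub_def)
    then have "\<tau> a \<in> points (prod_atlas (open_sub X U) (group_atlas G))"
      by (rule smooth_at_points[OF bspec[OF 1(3)[unfolded smooth_map_def]]])
    then have c: "snd (\<tau> a) \<in> carrier G"
      unfolding points_prod_atlas pts mem_Times_iff by (rule conjunct2)
    have "\<tau> (ract B a g) = (bproj B a, snd (\<tau> a) \<otimes>\<^bsub>G\<^esub> g)"
      using bspec[OF 1(7) aU] g(1) by blast
    then have "snd (\<tau> a) = snd (\<tau> a) \<otimes>\<^bsub>G\<^esub> g"
      using g(2) by (metis snd_conv)
    then show ?thesis using l_cancel_one'[OF c g(1)] by simp
  qed
qed

text \<open>Conjugation by the unit is the identity on the carrier only, so the two functions are
  compared as germs at the unit.\<close>

lemma Ad_one: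
  assumes G: "lie_group G" and A: "A \<in> lie_algebra G"
  shows "Ad G \<one>\<^bsub>G\<^esub> A = A"
proof
  fix f
  interpret group G using G by (simp add: lie_group_def)
  have c: "compatible_atlas (group_atlas G)" and pts: "points (group_atlas G) = carrier G"
    using G manifold_compatible_atlas[of "group_atlas G"] by (simp_all add: lie_group_def)
  have A': "A \<in> tangent (group_atlas G) \<one>\<^bsub>G\<^esub>" using A by (simp add: lie_algebra_def)
  obtain U \<phi> where U: "(U, \<phi>) \<in> group_atlas G" "\<one>\<^bsub>G\<^esub> \<in> U"
    by (rule pointsE[of "\<one>\<^bsub>G\<^esub>" "group_atlas G"]) (auto simp: pts)
  have "U \<subseteq> carrier G" using U(1) pts by (auto simp: points_def)
  moreover have "chart_nbhd U \<phi> UNIV \<one>\<^bsub>G\<^esub>" using U(2) by (auto simp: chart_nbhd_def)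
  ultimately have "A (\<lambda>x. f (\<one>\<^bsub>G\<^esub> \<otimes>\<^bsub>G\<^esub> x \<otimes>\<^bsub>G\<^esub> inv\<^bsub>G\<^esub> \<one>\<^bsub>G\<^esub>)) = A f"
    by (intro tangent_germ[OF c A' U(1)]) (auto simp: subset_iff)
  then show "Ad G \<one>\<^bsub>G\<^esub> A f = A f"
    using tangent_outside[OF A'] by (simp add: Ad_def tangent_map_def)
qed

lemma adclass_inject:
  assumes G: "lie_group G" and B: "principal_bundle G X B"
    and a: "a \<in> points (total_space B)" and A: "A \<in> lie_algebra G" and C: "C \<in> lie_algebra G"
    and eq: "adclass G B a A = adclass G B a C"
  shows "A = C"
proof -
  interpret group G using G by (simp add: lie_group_def)
  have "ract B a \<one>\<^bsub>G\<^esub> = a"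
    using B a by (simp add: principal_bundle_def)
  \<comment> \<open>The representative of the class with base point \<open>a\<close>; freeness then
    forces the group element that exhibits it in the other class to be the unit.\<close>
  then have "(a, Ad G (inv\<^bsub>G\<^esub> \<one>\<^bsub>G\<^esub>) A) \<in> adclass G B a A"
    unfolding adclass_def by force
  then obtain g where g: "g \<in> carrier G" "ract B a g = a"
    "Ad G (inv\<^bsub>G\<^esub> \<one>\<^bsub>G\<^esub>) A = Ad G (inv\<^bsub>G\<^esub> g) C"
    unfolding eq unfolding adclass_def by auto
  then have "g = \<one>\<^bsub>G\<^esub>" using ract_free[OF G B a] by blast
  then show ?thesis using g(3) Ad_one[OF G A] Ad_one[OF G C] by simp
qed

section \<open>The associated form\<close>

lemma vertical_diff: "u \<in> vertical \<Gamma> \<gamma> \<Longrightarrow> v \<in> vertical \<Gamma> \<gamma> \<Longrightarrow> u - v \<in> vertical \<Gamma> \<gamma>"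
  by (simp add: vertical_def tangent_diff tangent_map_minus)

text \<open>Two candidates differ by a vector that is both horizontal and vertical. Phrasing the
  hypotheses as closure under differences and trivial intersection lets the lemma serve
  \<open>H\<close> and \<open>pullback_connection\<close> alike.\<close>

lemma hor_proj_eq:
  assumes "\<And>h h'. h \<in> H \<gamma> \<Longrightarrow> h' \<in> H \<gamma> \<Longrightarrow> h - h' \<in> H \<gamma>" "H \<gamma> \<inter> vertical \<Gamma> \<gamma> \<subseteq> {0}"
    and h: "h \<in> H \<gamma>" "v - h \<in> vertical \<Gamma> \<gamma>"
  shows "hor_proj \<Gamma> H \<gamma> v = h"
  unfolding hor_proj_def
proof (rule the_equality)
  fix h' assume h': "h' \<in> H \<gamma> \<and> v - h' \<in> vertical \<Gamma> \<gamma>"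
  have "h' - h = (v - h) - (v - h')" by (rule ext) simp
  then have "h' - h \<in> H \<gamma> \<inter> vertical \<Gamma> \<gamma>"
    using assms(1) h h' vertical_diff by (metis IntI)
  then show "h' = h" using assms(2) by auto
qed (use h in blast)

theorem proposition4p4p1:
  fixes G :: "('g, 'eg::euclidean_space) smooth_group"
    and \<Gamma> :: "('x1, 'x0, 'e1::euclidean_space, 'e0::euclidean_space) smooth_groupoid"
    and H :: "'x1 \<Rightarrow> 'x1 tvec set"
    and B :: "('x1, 'x0, 'g, 'p, 'ep::euclidean_space) smooth_bundle"
    and D :: "('p \<times> 'p tvec) set \<Rightarrow> ('p \<times> 'g tvec) set"
    and \<omega> :: "'p \<Rightarrow> 'p tvec \<Rightarrow> 'g tvec"
  assumes "lie_group G"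
    and "lie_groupoid \<Gamma>"
    and "groupoid_connection \<Gamma> H"
    and "integrable_connection \<Gamma> H"
    and "groupoid_principal_bundle G \<Gamma> B"
    and "bundle_connection G \<Gamma> H B D"
    and "associated_form G B D \<omega>"
  shows "groupoid_one_form (pullback_groupoid \<Gamma> B) (pullback_connection \<Gamma> H B)
           (lie_algebra_atlas G) \<omega>"
proof -
  let ?P = "pullback_atlas \<Gamma> B" and ?E = "total_space B" and ?X1 = "arrows \<Gamma>" and ?X0 = "objects \<Gamma>"
  let ?\<mu> = "\<lambda>(\<gamma>, a). lact B \<gamma> a"
  note X = assms(2)[unfolded lie_groupoid_def]
  have mX1: "manifold ?X1" using X by (rule conjunct1)
  have mX0: "manifold ?X0" using X[THEN conjunct2] by (rule conjunct1)
  have s: "submersion ?X1 ?X0 (source \<Gamma>)" using X[THEN conjunct2, THEN conjunct2] by (rule conjunct1)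
  note E = assms(5)[unfolded groupoid_principal_bundle_def]
  have B: "principal_bundle G ?X0 B" using E by (rule conjunct1)
  have \<mu>: "smooth_map ?P ?E ?\<mu>" using E[THEN conjunct2] by (rule conjunct1)
  note E' = B[unfolded principal_bundle_def]
  have mE: "manifold ?E" using E' by (rule conjunct1)
  have \<pi>: "smooth_map ?E ?X0 (bproj B)" using E'[THEN conjunct2] by (rule conjunct1)
  note C = assms(3)[unfolded groupoid_connection_def subbundle_def]
  have H: "subspace (H \<gamma>)" "H \<gamma> \<subseteq> tangent ?X1 \<gamma>" "H \<gamma> \<inter> vertical \<Gamma> \<gamma> \<subseteq> {0}"
    "tangent ?X1 \<gamma> = {h + k | h k. h \<in> H \<gamma> \<and> k \<in> vertical \<Gamma> \<gamma>}" if "\<gamma> \<in> points ?X1" for \<gamma>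
    using bspec[OF C[THEN conjunct1, THEN conjunct1] that] bspec[OF C[THEN conjunct2, THEN conjunct1] that]
    by auto
  note W = assms(7)[unfolded associated_form_def]
  have \<omega>: "one_form ?E (lie_algebra_atlas G) \<omega>" using W by (rule conjunct1)
  have D\<omega>: "\<And>a v. a \<in> points ?E \<Longrightarrow> v \<in> tangent ?E a \<Longrightarrow> D (tclass G B a v) = adclass G B a (\<omega> a v)"
    using W[THEN conjunct2] by blast
  have \<omega>A: "\<omega> a v \<in> lie_algebra G" if "a \<in> points ?E" "v \<in> tangent ?E a" for a v
  proof -
    have "\<omega> a v \<in> points (lie_algebra_atlas G)"
      using \<omega> that unfolding one_form_def by blast
    then show ?thesis
      by (auto simp: points_def lie_algebra_atlas_def tangent_space_atlas_def lie_algebra_def)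
  qed
  have equiv: "D (tclass G B (lact B \<gamma> a) (bundle_transport \<Gamma> H B \<gamma> a w)) = adclass G B (lact B \<gamma> a) A"
    if "(\<gamma>, a) \<in> pullback_points \<Gamma> B" "w \<in> tangent ?E a" "A \<in> lie_algebra G"
      "D (tclass G B a w) = adclass G B a A" for \<gamma> a w A
    using bspec[OF assms(6)[unfolded bundle_connection_def, THEN conjunct2, THEN conjunct1] that(1)] that(2-4)
    by simp
  have "hor_form (pullback_groupoid \<Gamma> B) (pullback_connection \<Gamma> H B)
          (pullback_form ?E (\<lambda>(\<gamma>, a). a) \<omega>) q v =
        hor_form (pullback_groupoid \<Gamma> B) (pullback_connection \<Gamma> H B) (pullback_form ?E ?\<mu> \<omega>) q v"
    if q: "q \<in> points ?P" and v: "v \<in> tangent ?P q" for q v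
  proof -
    interpret product_submanifold ?X1 ?E "pullback_points \<Gamma> B" ?P q
      using q manifold_compatible_atlas[OF mX1] manifold_compatible_atlas[OF mE]
      by unfold_locales (simp_all add: pullback_atlas_def)
    obtain \<gamma> a where qe: "q = (\<gamma>, a)" by (cases q)
    have X0: "compatible_atlas ?X0" by (rule manifold_compatible_atlas[OF mX0])
    have pts: "\<gamma> \<in> points ?X1" "a \<in> points ?E" "q \<in> pullback_points \<Gamma> B" "source \<Gamma> \<gamma> = bproj B a"
      using q_points by (auto simp: qe pullback_points_def)
    have s\<gamma>: "smooth_at ?X1 ?X0 (source \<Gamma>) \<gamma>" and \<pi>a: "smooth_at ?E ?X0 (bproj B) a"
      and \<mu>q: "smooth_at ?P ?E ?\<mu> q"
      using bspec[OF s[unfolded submersion_def smooth_map_def, THEN conjunct1] pts(1)]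
        bspec[OF \<pi>[unfolded smooth_map_def] pts(2)] bspec[OF \<mu>[unfolded smooth_map_def] q] .
    have commute: "tangent_map ?X0 (source \<Gamma>) \<gamma> (tangent_map ?X1 fst q u) =
        tangent_map ?X0 (bproj B) a (tangent_map ?E snd q u)" if "u \<in> tangent ?P q" for u
      using tangent_map_fibre_product[OF X0 _ _ _ that, of "source \<Gamma>" "bproj B"] s\<gamma> \<pi>a
      by (simp add: qe pullback_points_def)
    have fstT: "tangent_map ?X1 fst q u \<in> tangent ?X1 \<gamma>" and sndT: "tangent_map ?E snd q u \<in> tangent ?E a"
      and \<mu>T: "tangent_map ?E ?\<mu> q u \<in> tangent ?E (lact B \<gamma> a)" if "u \<in> tangent ?P q" for u
      using tangent_map_tangent[OF compatible_P M smooth_at_fst that]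
        tangent_map_tangent[OF compatible_P N smooth_at_snd that]
        tangent_map_tangent[OF compatible_P N \<mu>q that] by (simp_all add: qe)
    have snd_eq: "(\<lambda>(\<gamma>, a). a) = (snd :: 'x1 \<times> 'p \<Rightarrow> 'p)" by auto
    \<comment> \<open>The source map of the pull-back groupoid is \<open>snd\<close>, so vertical
      means that the second component vanishes.\<close>
    have vert: "vertical (pullback_groupoid \<Gamma> B) q = {u \<in> tangent ?P q. tangent_map ?E snd q u = 0}"
      by (simp add: vertical_def pullback_groupoid_def snd_eq)
    obtain h0 k0 where hk: "tangent_map ?X1 fst q v = h0 + k0" "h0 \<in> H \<gamma>" "k0 \<in> vertical \<Gamma> \<gamma>"
      using fstT[OF v] H(4)[OF pts(1)] by auto
    obtain U \<phi> where U: "(U, \<phi>) \<in> ?X1" "\<gamma> \<in> U" by (rule pointsE[OF pts(1)])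
    have k0: "k0 \<in> tangent ?X1 \<gamma>" "tangent_map ?X0 (source \<Gamma>) \<gamma> k0 = 0"
      using hk(3) by (simp_all add: vertical_def)
    obtain c where c: "c 0 = \<gamma>" "\<forall>\<^sub>F t in at 0. c t \<in> U \<and> source \<Gamma> (c t) = source \<Gamma> \<gamma>"
      "((\<lambda>t. \<phi> (c t)) has_vector_derivative chart_vec \<phi> k0) (at 0)"
      by (rule submersion_vertical_curve[OF mX1 mX0 s U k0]) (rule that)
    have "\<exists>u\<in>tangent ?P q. tangent_map ?X1 fst q u = k0 \<and> tangent_map ?E snd q u = 0"
    proof (rule tangent_of_curve[OF U(1)])
      show "\<forall>\<^sub>F t in at 0. c t \<in> U"
        using c(2) by eventually_elim simp
      show "\<forall>\<^sub>F t in at 0. (c t, snd q) \<in> pullback_points \<Gamma> B"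
        using c(2)
      proof eventually_elim
        case (elim t)
        then have "c t \<in> points ?X1" using U(1) by (auto simp: points_def)
        with elim pts show ?case by (simp add: qe pullback_points_def)
      qed
    qed (use c U(2) k0 in \<open>simp_all add: qe\<close>)
    then obtain u where u: "u \<in> tangent ?P q" "tangent_map ?X1 fst q u = k0" "tangent_map ?E snd q u = 0"
      by blast
    \<comment> \<open>Subtracting the lift \<open>u\<close> of \<open>k0\<close> leaves the
      horizontal vector \<open>h0\<close> as first component and does not change the second
      component of \<open>v\<close>.\<close>
    define h where "h = v - u"
    have h: "h \<in> tangent ?P q" unfolding h_def by (rule tangent_diff[OF v u(1)])
    have h1: "tangent_map ?X1 fst q h = h0"
      using hk(1) u(2) by (simp add: h_def tangent_map_minus)
    define w where "w = tangent_map ?E snd q h"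
    have w: "w \<in> tangent ?E a" using sndT[OF h] w_def by simp
    have hp: "hor_proj (pullback_groupoid \<Gamma> B) (pullback_connection \<Gamma> H B) q v = h"
    proof (rule hor_proj_eq)
      show "x - y \<in> pullback_connection \<Gamma> H B q"
        if "x \<in> pullback_connection \<Gamma> H B q" "y \<in> pullback_connection \<Gamma> H B q" for x y
        using that subspace_diff[OF H(1)[OF pts(1)]]
        by (auto simp: pullback_connection_def tangent_map_minus qe intro: tangent_diff)
      show "pullback_connection \<Gamma> H B q \<inter> vertical (pullback_groupoid \<Gamma> B) q \<subseteq> {0}"
      proof
        fix x assume "x \<in> pullback_connection \<Gamma> H B q \<inter> vertical (pullback_groupoid \<Gamma> B) q"
        then have x: "x \<in> tangent ?P q" "tangent_map ?X1 fst q x \<in> H \<gamma>" "tangent_map ?E snd q x = 0"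
          by (auto simp: pullback_connection_def vert[unfolded qe] qe)
        \<comment> \<open>With zero second component, compatibility of the components makes the
          first one vertical for \<open>\<Gamma>\<close>. Being horizontal too it is 0, and then
          both components of \<open>x\<close> vanish.\<close>
        have "tangent_map ?X0 (bproj B) a 0 = 0"
          by (auto simp: tangent_map_def)
        then have "tangent_map ?X1 fst q x \<in> vertical \<Gamma> \<gamma>"
          using commute[OF x(1)] x(3) fstT[OF x(1)] by (simp add: vertical_def)
        then have "tangent_map ?X1 fst q x = 0"
          using H(3)[OF pts(1)] x(2) by blast
        then show "x \<in> {0}" using tangent_eq_0[OF x(1) _ x(3)] by simp
      qed
      show "h \<in> pullback_connection \<Gamma> H B q"
        using h h1 hk(2) by (simp add: pullback_connection_def qe)
      show "v - h \<in> vertical (pullback_groupoid \<Gamma> B) q"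
        using u by (simp add: vert h_def)
    qed
    have "bundle_transport \<Gamma> H B \<gamma> a w = tangent_map ?E ?\<mu> q h"
    proof -
      let ?v = "SOME v. v \<in> tangent ?X1 \<gamma> \<and>
        tangent_map ?X0 (source \<Gamma>) \<gamma> v = tangent_map ?X0 (bproj B) a w"
      have h0: "h0 \<in> tangent ?X1 \<gamma>" using H(2)[OF pts(1)] hk(2) by blast
      have sh0: "tangent_map ?X0 (source \<Gamma>) \<gamma> h0 = tangent_map ?X0 (bproj B) a w"
        using commute[OF h] h1 w_def by simp
      have v': "?v \<in> tangent ?X1 \<gamma> \<and> tangent_map ?X0 (source \<Gamma>) \<gamma> ?v = tangent_map ?X0 (bproj B) a w"
        using someI[of "\<lambda>v. v \<in> tangent ?X1 \<gamma> \<and>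
          tangent_map ?X0 (source \<Gamma>) \<gamma> v = tangent_map ?X0 (bproj B) a w" h0] h0 sh0 by blast
      \<comment> \<open>The chosen vector may differ from \<open>h0\<close>, but both have the same
        image under the differential of the source map, so their difference is vertical.\<close>
      have "hor_proj \<Gamma> H \<gamma> ?v = h0"
      proof (rule hor_proj_eq)
        show "?v - h0 \<in> vertical \<Gamma> \<gamma>"
          using v' h0 sh0 by (simp add: vertical_def tangent_map_minus tangent_diff)
      qed (use H[OF pts(1)] hk(2) subspace_diff in auto)
      moreover have "pullback_vec \<Gamma> B (\<gamma>, a) h0 w = h"
        unfolding pullback_vec_def
      proof (rule the_equality)
        fix x assume x: "x \<in> tangent ?P (\<gamma>, a) \<and> tangent_map ?X1 fst (\<gamma>, a) x = h0 \<and>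
          tangent_map ?E snd (\<gamma>, a) x = w"
        then have "x - h = 0"
          using h h1 w_def
          by (intro tangent_eq_0) (auto simp: qe tangent_map_minus intro: tangent_diff)
        then show "x = h" by simp
      qed (use h h1 w_def in \<open>simp add: qe\<close>)
      ultimately show ?thesis
        by (simp add: bundle_transport_def qe)
    qed
    \<comment> \<open>Two descriptions of \<open>D\<close> on the class of the transported vector:
      equivariance gives the left side, the definition of \<open>\<omega>\<close> at the point
      \<open>\<gamma> a\<close> the right side.\<close>
    then have "adclass G B (lact B \<gamma> a) (\<omega> a w) =
        adclass G B (lact B \<gamma> a) (\<omega> (lact B \<gamma> a) (tangent_map ?E ?\<mu> q h))"
      using equiv[OF pts(3)[unfolded qe] w \<omega>A[OF pts(2) w] D\<omega>[OF pts(2) w]]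
        D\<omega>[OF _ \<mu>T[OF h]] smooth_at_points[OF \<mu>q] by (simp add: qe)
    then have "\<omega> a w = \<omega> (lact B \<gamma> a) (tangent_map ?E ?\<mu> q h)"
      using adclass_inject[OF assms(1) B _ \<omega>A[OF pts(2) w] \<omega>A[OF _ \<mu>T[OF h]]] smooth_at_points[OF \<mu>q]
      by (simp add: qe)
    then show ?thesis
      by (simp add: hor_form_def pullback_form_def hp[unfolded qe] snd_eq w_def qe)
  qed
  with \<omega> show ?thesis
    unfolding groupoid_one_form_def by (simp add: pullback_groupoid_def)
qed

end
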